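(* Let $\alpha,\beta\in\mathbb{R}$ with $\beta\neq 0$, and let $(M^{n},g)$ be a compact locally conformal Kähler manifold of complex dimension $n$ with constant mixed curvature, i.e. there is a constant $c\in\mathbb{R}$ with $\mathcal{C}_{\alpha,\beta}(X)=c$ for every nonzero $(1,0)$-tangent vector $X$ at every point of $M$. (1) If $c=0$ and $n\alpha+\beta\neq0$, then $g$ is Kähler. (2) If $c<0$ and $[(n+2)\alpha+4\beta](n\alpha+\beta)\beta>0$, then $g$ is Kähler. (3) If $c>0$ and $[(n+2)\alpha+4\beta](n\alpha+\beta)\beta<0$, then $g$ is Kähler.
   Context: For a Hermitian manifold $(M^n,g)$ of complex dimension $n$, the Chern connection is the connection preserving $g$ and the complex structure whose torsion has no $(1,1)$-component. Its curvature in local holomorphic coordinates is $$R_{i\bar j k\bar l}=-\frac{\partial^2 g_{k\bar l}}{\partial z^i\partial\bar z^j}+g^{p\bar q}\frac{\partial g_{k\bar q}}{\partial z^i}\frac{\partial g_{p\bar l}}{\partial \bar z^j}.$$ The first Chern Ricci curvature is $Ric=-\sqrt{-1}\,\partial\bar\partial\log\det g$, with components $R_{i\bar j}=g^{k\bar l}R_{i\bar jk\bar l}$, and we write $Ric(X,\bar X)=R_{i\bar j}X^i\overline{X^j}$. The holomorphic sectional curvature is $H(X)=R(X,\bar X,X,\bar X)/|X|_g^4$. For $\alpha,\beta\in\mathbb{R}$ the mixed curvature is $$\mathcal{C}_{\alpha,\beta}(X)=\frac{\alpha}{|X|_g^2}Ric(X,\bar X)+\beta H(X),\qquad 0\ne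 X\in T^{1,0}M.$$ $g$ is Kähler if its associated $(1,1)$-form $\omega=\sqrt{-1}g_{i\bar j}dz^i\wedge d\bar z^j$ satisfies $d\omega=0$. The Hermitian manifold $(M,g)$ is locally conformal Kähler if every point has a neighborhood $U$ and a smooth function $\phi:U\to\mathbb{R}$ such that $e^{\phi}g$ is Kähler on $U$. *)

theory Defs
  imports "HOL-Analysis.Analysis"
begin

section \<open>Smooth and holomorphic maps\<close>

primrec continuously_differentiable_on ::
  "nat \<Rightarrow> 'a::real_normed_vector set \<Rightarrow> ('a \<Rightarrow> 'b::real_normed_vector) \<Rightarrow> bool" where
  "continuously_differentiable_on 0 S f \<longleftrightarrow> continuous_on S f"
| "continuously_differentiable_on (Suc k) S f \<longleftrightarrow>
     (\<forall>x\<in>S. f differentiable (at x)) \<and>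
     (\<forall>v. continuously_differentiable_on k S (\<lambda>x. frechet_derivative f (at x) v))"

text \<open>Only used for open \<open>S\<close> in a finite-dimensional space; differentiability is over the reals.\<close>

definition smooth_on :: "'a::real_normed_vector set \<Rightarrow> ('a \<Rightarrow> 'b::real_normed_vector) \<Rightarrow> bool" where
  "smooth_on S f \<longleftrightarrow> (\<forall>k. continuously_differentiable_on k S f)"

definition holomorphic_map_on :: "(complex^'n) set \<Rightarrow> (complex^'n \<Rightarrow> complex^'m) \<Rightarrow> bool" where
  "holomorphic_map_on S f \<longleftrightarrow>
     (\<forall>z\<in>S. \<exists>A :: complex^'n^'m. (f has_derivative (\<lambda>v. A *v v)) (at z))"

text \<open>With \<open>z\<^sup>i = x\<^sup>i + \<i> y\<^sup>i\<close>, the real tangent vectors along \<open>x\<^sup>i\<close> and \<open>y\<^sup>i\<close> are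
  \<open>axis i 1\<close> and \<open>axis i \<i>\<close>.\<close>

definition dz :: "'n \<Rightarrow> (complex^'n \<Rightarrow> complex) \<Rightarrow> complex^'n \<Rightarrow> complex" where
  "dz i f z = (frechet_derivative f (at z) (axis i 1)
               - \<i> * frechet_derivative f (at z) (axis i \<i>)) / 2"

definition dzbar :: "'n \<Rightarrow> (complex^'n \<Rightarrow> complex) \<Rightarrow> complex^'n \<Rightarrow> complex" where
  "dzbar i f z = (frechet_derivative f (at z) (axis i 1)
                  + \<i> * frechet_derivative f (at z) (axis i \<i>)) / 2"


section \<open>Complex manifolds\<close>

text \<open>The underlying manifold is the whole type \<open>'a\<close>, its complex dimension is \<open>CARD('n)\<close>.\<close>

type_synonym ('a, 'n) chart = "'a set \<times> ('a \<Rightarrow> complex^'n)"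

definition chart_inv :: "('a, 'n) chart \<Rightarrow> complex^'n \<Rightarrow> 'a" where
  "chart_inv c = inv_into (fst c) (snd c)"

definition transition :: "('a, 'n) chart \<Rightarrow> ('a, 'n) chart \<Rightarrow> complex^'n \<Rightarrow> complex^'n" where
  "transition c c' = snd c' \<circ> chart_inv c"

definition complex_atlas ::
  "('a::{t2_space, second_countable_topology}, 'n::finite) chart set \<Rightarrow> bool" where
  "complex_atlas A \<longleftrightarrow>
     (\<forall>c\<in>A. open (fst c) \<and> open (snd c ` fst c) \<and>
        homeomorphism (fst c) (snd c ` fst c) (snd c) (chart_inv c)) \<and>
     (\<Union>c\<in>A. fst c) = UNIV \<and>
     (\<forall>c\<in>A. \<forall>c'\<in>A. holomorphic_map_on (snd c ` (fst c \<inter> fst c')) (transition c c'))"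

definition smooth_function_on ::
  "('a::topological_space, 'n::finite) chart set \<Rightarrow> 'a set \<Rightarrow> ('a \<Rightarrow> real) \<Rightarrow> bool" where
  "smooth_function_on A V f \<longleftrightarrow> (\<forall>c\<in>A. smooth_on (snd c ` (fst c \<inter> V)) (f \<circ> chart_inv c))"


section \<open>Hermitian metrics\<close>

text \<open>A tensor field is given by its components in every chart: \<open>g c z $ i $ j\<close> is the component
  \<open>g\<^sub>i\<^sub>j\<close> (second index barred) at the point with coordinates \<open>z\<close> in the chart \<open>c\<close>. Only the values
  at \<open>z \<in> snd c ` fst c\<close> matter. Likewise \<open>X :: complex^'n\<close> stands for the \<open>(1,0)\<close>-vector
  with components \<open>X $ i\<close> in the chart under consideration.\<close>

type_synonym ('a, 'n) metric = "('a, 'n) chart \<Rightarrow> complex^'n \<Rightarrow> complex^'n^'n"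

definition norm_sq :: "complex^'n^'n \<Rightarrow> complex^'n \<Rightarrow> complex" where
  "norm_sq G X = (\<Sum>i\<in>UNIV. \<Sum>j\<in>UNIV. G $ i $ j * X $ i * cnj (X $ j))"

definition hermitian_metric ::
  "('a::topological_space, 'n::finite) chart set \<Rightarrow> ('a, 'n) metric \<Rightarrow> bool" where
  "hermitian_metric A g \<longleftrightarrow>
     (\<forall>c\<in>A. smooth_on (snd c ` fst c) (g c)) \<and>
     (\<forall>c\<in>A. \<forall>z\<in>snd c ` fst c.
        (\<forall>i j. g c z $ j $ i = cnj (g c z $ i $ j)) \<and>
        (\<forall>X. X \<noteq> 0 \<longrightarrow> Re (norm_sq (g c z) X) > 0)) \<and>
     (\<forall>c\<in>A. \<forall>c'\<in>A. \<forall>z\<in>snd c ` (fst c \<inter> fst c'). \<forall>i j.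
        g c z $ i $ j =
          (\<Sum>k\<in>UNIV. \<Sum>l\<in>UNIV. g c' (transition c c' z) $ k $ l
             * dz i (\<lambda>w. transition c c' w $ k) z
             * cnj (dz j (\<lambda>w. transition c c' w $ l) z)))"

text \<open>\<open>\<omega> = \<i> \<Sum> g\<^sub>i\<^sub>j dz\<^sup>i \<and> d(cnj z)\<^sup>j\<close>, evaluated on real tangent vectors
  \<open>u\<close>, \<open>v\<close> of the coordinate space.\<close>

definition fundamental_form ::
  "(complex^'n \<Rightarrow> complex^'n^'n) \<Rightarrow> complex^'n \<Rightarrow> complex^'n \<Rightarrow> complex^'n \<Rightarrow> complex" where
  "fundamental_form G z u v =
     \<i> * (\<Sum>i\<in>UNIV. \<Sum>j\<in>UNIV. G z $ i $ j * (u $ i * cnj (v $ j) - v $ i * cnj (u $ j)))"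

text \<open>The invariant formula for the exterior derivative of a 2-form, applied to constant vector
  fields, whose brackets vanish.\<close>

definition exterior_derivative2 ::
  "('v::real_normed_vector \<Rightarrow> 'v \<Rightarrow> 'v \<Rightarrow> complex) \<Rightarrow> 'v \<Rightarrow> 'v \<Rightarrow> 'v \<Rightarrow> 'v \<Rightarrow> complex" where
  "exterior_derivative2 \<omega> z u v w =
     frechet_derivative (\<lambda>x. \<omega> x v w) (at z) u
     - frechet_derivative (\<lambda>x. \<omega> x u w) (at z) v
     + frechet_derivative (\<lambda>x. \<omega> x u v) (at z) w"

definition kaehler_on ::
  "('a::topological_space, 'n::finite) chart set \<Rightarrow> 'a set \<Rightarrow> ('a, 'n) metric \<Rightarrow> bool" where
  "kaehler_on A V g \<longleftrightarrow>
     (\<forall>c\<in>A. \<forall>z\<in>snd c ` (fst c \<inter> V). \<forall>u v w.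
        exterior_derivative2 (fundamental_form (g c)) z u v w = 0)"

definition conformal_change :: "('a \<Rightarrow> real) \<Rightarrow> ('a, 'n::finite) metric \<Rightarrow> ('a, 'n) metric" where
  "conformal_change f g = (\<lambda>c z. exp (f (chart_inv c z)) *\<^sub>R g c z)"

definition locally_conformal_kaehler ::
  "('a::topological_space, 'n::finite) chart set \<Rightarrow> ('a, 'n) metric \<Rightarrow> bool" where
  "locally_conformal_kaehler A g \<longleftrightarrow>
     (\<forall>p. \<exists>V f. open V \<and> p \<in> V \<and> smooth_function_on A V f \<and>
        kaehler_on A V (conformal_change f g))"


section \<open>Chern curvature\<close>

text \<open>In this section \<open>G\<close> is the component matrix of the metric in one chart. The inverse
  components are normalised by \<open>\<Sum>q. g\<^sup>p\<^sup>q g\<^sub>k\<^sub>q = \<delta>\<^sub>k\<^sub>p\<close>, hence the transposition.\<close>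

definition inverse_metric :: "complex^'n^'n \<Rightarrow> 'n \<Rightarrow> 'n \<Rightarrow> complex" where
  "inverse_metric G p q = matrix_inv G $ q $ p"

text \<open>The barred indices are \<open>j\<close> and \<open>l\<close>.\<close>

definition chern_curvature ::
  "(complex^'n \<Rightarrow> complex^'n^'n) \<Rightarrow> complex^'n \<Rightarrow> 'n \<Rightarrow> 'n \<Rightarrow> 'n \<Rightarrow> 'n \<Rightarrow> complex" where
  "chern_curvature G z i j k l =
     - dz i (dzbar j (\<lambda>w. G w $ k $ l)) z
     + (\<Sum>p\<in>UNIV. \<Sum>q\<in>UNIV. inverse_metric (G z) p q
          * dz i (\<lambda>w. G w $ k $ q) z * dzbar j (\<lambda>w. G w $ p $ l) z)"

definition chern_ricci ::
  "(complex^'n \<Rightarrow> complex^'n^'n) \<Rightarrow> complex^'n \<Rightarrow> 'n \<Rightarrow> 'n \<Rightarrow> complex" where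
  "chern_ricci G z i j =
     (\<Sum>k\<in>UNIV. \<Sum>l\<in>UNIV. inverse_metric (G z) k l * chern_curvature G z i j k l)"

definition ricci_form_at ::
  "(complex^'n \<Rightarrow> complex^'n^'n) \<Rightarrow> complex^'n \<Rightarrow> complex^'n \<Rightarrow> complex" where
  "ricci_form_at G z X = (\<Sum>i\<in>UNIV. \<Sum>j\<in>UNIV. chern_ricci G z i j * X $ i * cnj (X $ j))"

definition holomorphic_sectional_curvature ::
  "(complex^'n \<Rightarrow> complex^'n^'n) \<Rightarrow> complex^'n \<Rightarrow> complex^'n \<Rightarrow> complex" where
  "holomorphic_sectional_curvature G z X =
     (\<Sum>i\<in>UNIV. \<Sum>j\<in>UNIV. \<Sum>k\<in>UNIV. \<Sum>l\<in>UNIV.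
        chern_curvature G z i j k l * X $ i * cnj (X $ j) * X $ k * cnj (X $ l))
     / (norm_sq (G z) X)\<^sup>2"

definition mixed_curvature ::
  "real \<Rightarrow> real \<Rightarrow> (complex^'n \<Rightarrow> complex^'n^'n) \<Rightarrow> complex^'n \<Rightarrow> complex^'n \<Rightarrow> complex" where
  "mixed_curvature \<alpha> \<beta> G z X =
     of_real \<alpha> / norm_sq (G z) X * ricci_form_at G z X
     + of_real \<beta> * holomorphic_sectional_curvature G z X"

definition constant_mixed_curvature ::
  "('a::topological_space, 'n::finite) chart set \<Rightarrow> ('a, 'n) metric \<Rightarrow> real \<Rightarrow> real \<Rightarrow> real \<Rightarrow> bool" where
  "constant_mixed_curvature A g \<alpha> \<beta> c \<longleftrightarrow>
     (\<forall>\<phi>\<in>A. \<forall>p\<in>fst \<phi>. \<forall>X. X \<noteq> 0 \<longrightarrow>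
        mixed_curvature \<alpha> \<beta> (g \<phi>) (snd \<phi> p) X = complex_of_real c)"

end

theory Submission
  imports Defs "HOL-Complex_Analysis.Cauchy_Integral_Formula"
begin

text \<open>Locally \<open>g = exp u \<cdot> h\<close> with \<open>h\<close> Kaehler, so \<open>R + \<partial>\<partial>bar u \<otimes> g\<close> has the symmetries of a Kaehler
  curvature tensor. Polarising \<open>\<C>\<^sub>\<alpha>\<^sub>,\<^sub>\<beta> = c\<close> and contracting once gives
  \<open>((n+2)\<alpha> + 4\<beta>) Ric + (3n-2)\<beta> \<partial>\<partial>bar u = \<mu> g\<close>. The left-hand side is closed, hence \<open>\<mu> exp u\<close> is
  locally constant, and a second contraction turns this into \<open>D = q + \<kappa> exp (-u)\<close>, where
  \<open>D = tr\<^sub>g \<partial>\<partial>bar u\<close>, \<open>\<kappa>\<close> is locally constant, and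
  \<open>q = - c(n+1)((n+2)\<alpha> + 4\<beta>) / (2(n\<alpha> + \<beta>)\<beta>)\<close> is nonnegative in each of the three cases.

  At a minimum of \<open>D\<close> on \<open>M\<close> either \<open>D \<ge> q\<close>, or \<open>\<kappa> < 0\<close> and \<open>u\<close> has a local minimum, so that
  \<open>D \<ge> 0\<close>; hence \<open>D \<ge> 0\<close> everywhere. Up to a constant, \<open>\<partial>\<partial>bar \<omega>\<^sup>n\<^sup>-\<^sup>1\<close> is
  \<open>((n-1)|\<partial>u|\<^sup>2 + D) \<omega>\<^sup>n\<close>, and its integral over \<open>M\<close> vanishes, so \<open>\<partial>u = 0\<close> and \<open>g\<close> is Kaehler.
  In complex dimension 1 every Hermitian metric is Kaehler.\<close>

section \<open>Smooth functions\<close>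

text \<open>The conformal factor \<open>u\<close> exists only locally and up to an additive
  constant, so no global statement can mention it. What survives is its derivative, read off from
  the torsion of the metric, and hence D. This is why the minimum is taken for D although the sign
  information, a nonnegative complex Hessian at a local minimum, concerns \<open>u\<close>. The
  constant q arises by eliminating the Chern scalar curvature between the contracted identity and
  its trace, which leaves (2\<beta> + (n+1)\<alpha>) \<mu> = 2(n\<alpha> + \<beta>)\<beta> (D - q).
  The factor on the left may vanish and is never inverted: then D = q, and the argument goes through
  with \<kappa> = 0. Only (n\<alpha> + \<beta>)\<beta> is inverted. The sign conditions in (2) and
  (3) say that q > 0, and c = 0 gives q = 0. The vanishing integral is obtained by hand, with the
  determinant of the metric as density and a partition of unity of class C1. Since the atlas asks
  for complex differentiable transition maps only, the second derivatives needed to compare D in two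
  charts are first extracted from Cauchy's formula.\<close>

lemma frechet_derivative_cong_open:
  assumes "open S" "x \<in> S" "\<And>y. y \<in> S \<Longrightarrow> f y = g y"
  shows "frechet_derivative f (at x) = frechet_derivative g (at x)"
proof -
  \<comment> \<open>Comparing all candidate derivatives also settles the non-differentiable case,
    where \<open>frechet_derivative\<close> is an unspecified choice.\<close>
  have "(f has_derivative D) (at x) \<longleftrightarrow> (g has_derivative D) (at x)" for D
    using has_derivative_transform_within_open[OF _ assms(1,2), of f D UNIV g]
      has_derivative_transform_within_open[OF _ assms(1,2), of g D UNIV f] assms(3) by auto
  then show ?thesis unfolding frechet_derivative_def by simp
qed

lemma differentiable_cong_open:
  assumes "open S" "x \<in> S" "\<And>y. y \<in> S \<Longrightarrow> f y = g y"
  shows "f differentiable (at x) \<longleftrightarrow> g differentiable (at x)"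
  unfolding differentiable_def
  using has_derivative_transform_within_open[OF _ assms(1,2), of f _ UNIV g]
    has_derivative_transform_within_open[OF _ assms(1,2), of g _ UNIV f] assms(3) by metis

lemma continuously_differentiable_on_cong:
  assumes "open S" "\<And>y. y \<in> S \<Longrightarrow> f y = g y"
  shows "continuously_differentiable_on k S f \<longleftrightarrow> continuously_differentiable_on k S g"
  using assms(2)
proof (induction k arbitrary: f g)
  case 0
  then show ?case by (simp cong: continuous_on_cong)
next
  case (Suc k)
  have "continuously_differentiable_on k S (\<lambda>x. frechet_derivative f (at x) v)
      \<longleftrightarrow> continuously_differentiable_on k S (\<lambda>x. frechet_derivative g (at x) v)" for v
    using frechet_derivative_cong_open[OF assms(1) _ Suc.prems] by (intro Suc.IH) simp
  then show ?case using differentiable_cong_open[OF assms(1) _ Suc.prems] by auto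
qed

lemma continuously_differentiable_on_transfer:
  assumes "open S" "continuously_differentiable_on k S g" "\<And>y. y \<in> S \<Longrightarrow> f y = g y"
  shows "continuously_differentiable_on k S f"
  using continuously_differentiable_on_cong[of S f g] assms by blast

lemma continuously_differentiable_on_Suc_imp:
  "continuously_differentiable_on (Suc k) S f \<Longrightarrow> continuously_differentiable_on k S f"
proof (induction k arbitrary: f)
  case 0
  then show ?case
    by (auto intro!: continuous_at_imp_continuous_on differentiable_imp_continuous_within)
next
  case (Suc k)
  then show ?case by (metis continuously_differentiable_on.simps(2))
qed

lemma continuously_differentiable_on_le:
  assumes "continuously_differentiable_on k S f" "j \<le> k"
  shows "continuously_differentiable_on j S f"
  using assms(2,1)
proof (induction j rule: inc_induct)
  case (step n)
  then show ?case using continuously_differentiable_on_Suc_imp by blast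
qed

lemma continuously_differentiable_on_subset:
  "continuously_differentiable_on k S f \<Longrightarrow> T \<subseteq> S \<Longrightarrow> continuously_differentiable_on k T f"
  by (induction k arbitrary: f) (auto intro: continuous_on_subset)

lemma continuously_differentiable_on_const:
  "continuously_differentiable_on k S (\<lambda>x. c)"
  by (induction k arbitrary: c) auto

lemma continuously_differentiable_on_add:
  assumes "open S" "continuously_differentiable_on k S f" "continuously_differentiable_on k S g"
  shows "continuously_differentiable_on k S (\<lambda>x. f x + g x)"
  using assms(2,3)
proof (induction k arbitrary: f g)
  case 0
  then show ?case by (auto intro: continuous_intros)
next
  case (Suc k)
  have "continuously_differentiable_on k S
      (\<lambda>x. frechet_derivative (\<lambda>x. f x + g x) (at x) v)" for v
  proof -
    have "frechet_derivative (\<lambda>x. f x + g x) (at x) v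
        = frechet_derivative f (at x) v + frechet_derivative g (at x) v" if "x \<in> S" for x
    proof -
      have "((\<lambda>x. f x + g x) has_derivative
        (\<lambda>v. frechet_derivative f (at x) v + frechet_derivative g (at x) v)) (at x)"
        using Suc.prems that by (auto simp: frechet_derivative_works intro!: has_derivative_add)
      then show ?thesis using frechet_derivative_at by metis
    qed
    moreover have "continuously_differentiable_on k S
        (\<lambda>x. frechet_derivative f (at x) v + frechet_derivative g (at x) v)"
      using Suc.prems by (intro Suc.IH) auto
    ultimately show ?thesis
      by (rule continuously_differentiable_on_transfer[OF assms(1), rotated])
  qed
  then show ?case using Suc.prems by auto
qed

lemma continuously_differentiable_on_sum:
  "open S \<Longrightarrow> (\<And>i. i \<in> I \<Longrightarrow> continuously_differentiable_on k S (f i)) \<Longrightarrow>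
    continuously_differentiable_on k S (\<lambda>x. \<Sum>i\<in>I. f i x)"
  by (induction I rule: infinite_finite_induct)
    (auto intro: continuously_differentiable_on_const continuously_differentiable_on_add)

lemma continuously_differentiable_on_bilinear:
  assumes "bounded_bilinear pr" "open S"
    "continuously_differentiable_on k S f" "continuously_differentiable_on k S g"
  shows "continuously_differentiable_on k S (\<lambda>x. pr (f x) (g x))"
  using assms(3,4)
proof (induction k arbitrary: f g)
  case 0
  then show ?case by (auto intro: bounded_bilinear.continuous_on[OF assms(1)])
next
  case (Suc k)
  have d: "((\<lambda>x. pr (f x) (g x)) has_derivative
        (\<lambda>v. pr (f x) (frechet_derivative g (at x) v) + pr (frechet_derivative f (at x) v) (g x))) (at x)"
    if "x \<in> S" for x
    using Suc.prems that
    by (auto simp: frechet_derivative_works intro!: bounded_bilinear.FDERIV[OF assms(1)])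
  have "continuously_differentiable_on k S
      (\<lambda>x. frechet_derivative (\<lambda>x. pr (f x) (g x)) (at x) v)" for v
  proof -
    have "continuously_differentiable_on k S
       (\<lambda>x. pr (f x) (frechet_derivative g (at x) v) + pr (frechet_derivative f (at x) v) (g x))"
      using Suc.prems continuously_differentiable_on_Suc_imp[OF Suc.prems(1)]
        continuously_differentiable_on_Suc_imp[OF Suc.prems(2)]
      by (intro continuously_differentiable_on_add[OF assms(2)] Suc.IH) auto
    moreover have "frechet_derivative (\<lambda>x. pr (f x) (g x)) (at x) v =
        pr (f x) (frechet_derivative g (at x) v) + pr (frechet_derivative f (at x) v) (g x)"
      if "x \<in> S" for x
      using frechet_derivative_at[OF d[OF that]] by metis
    ultimately show ?thesis by (rule continuously_differentiable_on_transfer[OF assms(2)])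
  qed
  moreover have "\<forall>x\<in>S. (\<lambda>x. pr (f x) (g x)) differentiable at x"
    using d unfolding differentiable_def by blast
  ultimately show ?case by auto
qed

lemma continuously_differentiable_on_linear:
  assumes "bounded_linear h" "open S" "continuously_differentiable_on k S f"
  shows "continuously_differentiable_on k S (\<lambda>x. h (f x))"
  using assms(3)
proof (induction k arbitrary: f)
  case 0
  then show ?case by (auto intro: bounded_linear.continuous_on[OF assms(1)])
next
  case (Suc k)
  have d: "((\<lambda>x. h (f x)) has_derivative (\<lambda>v. h (frechet_derivative f (at x) v))) (at x)"
    if "x \<in> S" for x
    using Suc.prems that
    by (auto simp: frechet_derivative_works intro!: bounded_linear.has_derivative[OF assms(1)])
  have "continuously_differentiable_on k S
      (\<lambda>x. frechet_derivative (\<lambda>x. h (f x)) (at x) v)" for v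
  proof -
    have "frechet_derivative (\<lambda>x. h (f x)) (at x) v = h (frechet_derivative f (at x) v)"
      if "x \<in> S" for x
      using frechet_derivative_at[OF d[OF that]] by metis
    moreover have "continuously_differentiable_on k S (\<lambda>x. h (frechet_derivative f (at x) v))"
      using Suc.prems by (intro Suc.IH) auto
    ultimately show ?thesis
      by (rule continuously_differentiable_on_transfer[OF assms(2), rotated])
  qed
  moreover have "\<forall>x\<in>S. (\<lambda>x. h (f x)) differentiable at x"
    using d unfolding differentiable_def by blast
  ultimately show ?case by auto
qed

lemma continuously_differentiable_on_inverse:
  fixes f :: "'a::real_normed_vector \<Rightarrow> 'b::real_normed_field"
  assumes "open S" "continuously_differentiable_on k S f" "\<And>x. x \<in> S \<Longrightarrow> f x \<noteq> 0"
  shows "continuously_differentiable_on k S (\<lambda>x. inverse (f x))"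
  using assms(2)
proof (induction k)
  case 0
  then show ?case using assms(3) by (auto intro!: continuous_on_inverse)
next
  case (Suc k)
  have d: "((\<lambda>x. inverse (f x)) has_derivative
      (\<lambda>v. - (inverse (f x) * frechet_derivative f (at x) v * inverse (f x)))) (at x)"
    if "x \<in> S" for x
    using Suc.prems that assms(3)[OF that]
    by (intro Deriv.has_derivative_inverse) (auto simp: frechet_derivative_works)
  \<comment> \<open>The derivative -(1/f) f' (1/f) contains 1/f again, so the induction hypothesis
    is needed for 1/f itself, one order lower.\<close>
  have inv: "continuously_differentiable_on k S (\<lambda>x. inverse (f x))"
    using Suc continuously_differentiable_on_Suc_imp by blast
  have "continuously_differentiable_on k S
      (\<lambda>x. frechet_derivative (\<lambda>x. inverse (f x)) (at x) v)" for v
  proof -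
    have eq: "frechet_derivative (\<lambda>x. inverse (f x)) (at x) v =
      - (inverse (f x) * frechet_derivative f (at x) v * inverse (f x))" if "x \<in> S" for x
      using frechet_derivative_at[OF d[OF that]] by metis
    have "continuously_differentiable_on k S (\<lambda>x. frechet_derivative f (at x) v)"
      using Suc.prems by simp
    then have "continuously_differentiable_on k S
        (\<lambda>x. - (inverse (f x) * frechet_derivative f (at x) v * inverse (f x)))"
      by (intro continuously_differentiable_on_linear[OF bounded_linear_minus[OF bounded_linear_ident]]
          continuously_differentiable_on_bilinear[OF bounded_bilinear_mult] assms(1) inv)
    then show ?thesis
      by (rule continuously_differentiable_on_transfer[OF assms(1) _ eq])
  qed
  moreover have "\<forall>x\<in>S. (\<lambda>x. inverse (f x)) differentiable at x"
    using d unfolding differentiable_def by blast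
  ultimately show ?case by auto
qed

lemma smooth_on_subset: "smooth_on S f \<Longrightarrow> T \<subseteq> S \<Longrightarrow> smooth_on T f"
  unfolding smooth_on_def using continuously_differentiable_on_subset by blast

lemma smooth_on_cong:
  "open S \<Longrightarrow> (\<And>y. y \<in> S \<Longrightarrow> f y = g y) \<Longrightarrow> smooth_on S f \<longleftrightarrow> smooth_on S g"
  unfolding smooth_on_def by (simp add: continuously_differentiable_on_cong[of S f g])

lemma smooth_on_const: "smooth_on S (\<lambda>x. c)"
  by (simp add: smooth_on_def continuously_differentiable_on_const)

lemma smooth_on_add: "open S \<Longrightarrow> smooth_on S f \<Longrightarrow> smooth_on S g \<Longrightarrow> smooth_on S (\<lambda>x. f x + g x)"
  unfolding smooth_on_def by (intro allI continuously_differentiable_on_add) auto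

lemma smooth_on_linear:
  "bounded_linear h \<Longrightarrow> open S \<Longrightarrow> smooth_on S f \<Longrightarrow> smooth_on S (\<lambda>x. h (f x))"
  unfolding smooth_on_def using continuously_differentiable_on_linear by metis

lemma smooth_on_minus: "open S \<Longrightarrow> smooth_on S f \<Longrightarrow> smooth_on S (\<lambda>x. - f x)"
  by (rule smooth_on_linear[OF bounded_linear_minus[OF bounded_linear_ident]])

lemma smooth_on_diff: "open S \<Longrightarrow> smooth_on S f \<Longrightarrow> smooth_on S g \<Longrightarrow> smooth_on S (\<lambda>x. f x - g x)"
  using smooth_on_add[of S f "\<lambda>x. - g x"] smooth_on_minus[of S g] by simp

lemma smooth_on_mult:
  fixes f g :: "'a::real_normed_vector \<Rightarrow> 'b::real_normed_algebra"
  shows "open S \<Longrightarrow> smooth_on S f \<Longrightarrow> smooth_on S g \<Longrightarrow> smooth_on S (\<lambda>x. f x * g x)"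
  unfolding smooth_on_def
  by (intro allI continuously_differentiable_on_bilinear[OF bounded_bilinear_mult]) auto

lemma smooth_on_inverse:
  fixes f :: "'a::real_normed_vector \<Rightarrow> 'b::real_normed_field"
  shows "open S \<Longrightarrow> smooth_on S f \<Longrightarrow> (\<And>x. x \<in> S \<Longrightarrow> f x \<noteq> 0) \<Longrightarrow> smooth_on S (\<lambda>x. inverse (f x))"
  unfolding smooth_on_def by (intro allI continuously_differentiable_on_inverse) auto

lemma smooth_on_sum:
  "open S \<Longrightarrow> (\<And>i. i \<in> I \<Longrightarrow> smooth_on S (f i)) \<Longrightarrow> smooth_on S (\<lambda>x. \<Sum>i\<in>I. f i x)"
  by (simp add: smooth_on_def continuously_differentiable_on_sum)

lemma smooth_on_prod:
  fixes f :: "'i \<Rightarrow> 'a::real_normed_vector \<Rightarrow> 'b::real_normed_field"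
  shows "open S \<Longrightarrow> (\<And>i. i \<in> I \<Longrightarrow> smooth_on S (f i)) \<Longrightarrow> smooth_on S (\<lambda>x. \<Prod>i\<in>I. f i x)"
  by (induction I rule: infinite_finite_induct) (auto intro: smooth_on_const smooth_on_mult)

lemma smooth_on_frechet_derivative:
  "smooth_on S f \<Longrightarrow> smooth_on S (\<lambda>x. frechet_derivative f (at x) v)"
  unfolding smooth_on_def using continuously_differentiable_on.simps(2) by blast

lemma smooth_on_imp_differentiable: "smooth_on S f \<Longrightarrow> x \<in> S \<Longrightarrow> f differentiable (at x)"
  unfolding smooth_on_def using continuously_differentiable_on.simps(2) by blast

lemma smooth_on_imp_continuous_on: "smooth_on S f \<Longrightarrow> continuous_on S f"
  unfolding smooth_on_def using continuously_differentiable_on.simps(1) by blast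

lemma smooth_on_cnj: "open S \<Longrightarrow> smooth_on S f \<Longrightarrow> smooth_on S (\<lambda>x. cnj (f x))"
  by (rule smooth_on_linear[OF bounded_linear_cnj])

lemma smooth_on_vec_nth: "open S \<Longrightarrow> smooth_on S f \<Longrightarrow> smooth_on S (\<lambda>x. f x $ i)"
  by (rule smooth_on_linear[OF bounded_linear_vec_nth])

lemma smooth_on_dz: "open S \<Longrightarrow> smooth_on S f \<Longrightarrow> smooth_on S (dz i f)"
  and smooth_on_dzbar: "open S \<Longrightarrow> smooth_on S f \<Longrightarrow> smooth_on S (dzbar i f)"
  unfolding dz_def[abs_def] dzbar_def[abs_def] divide_inverse
  by (intro smooth_on_mult smooth_on_diff smooth_on_add smooth_on_const smooth_on_frechet_derivative;
      assumption)+

lemma smooth_on_det: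
  fixes B :: "'a::real_normed_vector \<Rightarrow> 'b::real_normed_field^'n^'n"
  assumes "open S" "\<And>i j. smooth_on S (\<lambda>x. B x $ i $ j)"
  shows "smooth_on S (\<lambda>x. det (B x))"
  unfolding det_def
  by (intro smooth_on_sum smooth_on_mult smooth_on_const smooth_on_prod assms)

section \<open>Matrix inverses with smooth entries\<close>

lemma matrix_inv_inverse:
  fixes B :: "'a::field^'n^'n"
  assumes "det B \<noteq> 0"
  shows "B ** matrix_inv B = mat 1" "matrix_inv B ** B = mat 1"
  using someI_ex[of "\<lambda>C. B ** C = mat 1 \<and> C ** B = mat 1"] assms invertible_det_nz[of B]
  unfolding invertible_def matrix_inv_def by auto

text \<open>Cramer's rule, applied to the columns of the inverse, makes its entries quotients of
  polynomials in the entries of \<open>B\<close>. Smoothness of the inverse metric thereby reduces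
  to smoothness of determinants.\<close>

lemma matrix_inv_cramer:
  fixes B :: "'a::field^'n^'n"
  assumes "det B \<noteq> 0"
  shows "matrix_inv B $ p $ q
    = det (\<chi> i j. if j = p then axis q 1 $ i else B $ i $ j) * inverse (det B)"
proof -
  have "B ** matrix_inv B = mat 1" by (rule matrix_inv_inverse[OF assms])
  then have "B *v column q (matrix_inv B) = axis q 1"
    by (simp add: vec_eq_iff matrix_vector_mult_def matrix_matrix_mult_def column_def mat_def axis_def)
  then have "column q (matrix_inv B)
      = (\<chi> k. det (\<chi> i j. if j = k then axis q 1 $ i else B $ i $ j) / det B)"
    using cramer[OF assms] by blast
  then show ?thesis by (simp add: vec_eq_iff column_def divide_inverse)
qed

lemma smooth_on_matrix_inv:
  fixes B :: "'a::real_normed_vector \<Rightarrow> 'b::real_normed_field^'n^'n"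
  assumes "open S" "\<And>i j. smooth_on S (\<lambda>x. B x $ i $ j)" "\<And>x. x \<in> S \<Longrightarrow> det (B x) \<noteq> 0"
  shows "smooth_on S (\<lambda>x. matrix_inv (B x) $ p $ q)"
proof -
  have ite: "smooth_on S (\<lambda>x. if j = p then axis q 1 $ i else B x $ i $ j)" for i j
    using assms(2) by (cases "j = p") (auto intro: smooth_on_const)
  have "smooth_on S (\<lambda>x. det (\<chi> i j. if j = p then axis q 1 $ i else B x $ i $ j) * inverse (det (B x)))"
    using assms ite by (intro smooth_on_mult smooth_on_inverse smooth_on_det) simp_all
  moreover have "smooth_on S (\<lambda>x. matrix_inv (B x) $ p $ q) \<longleftrightarrow> smooth_on S
      (\<lambda>x. det (\<chi> i j. if j = p then axis q 1 $ i else B x $ i $ j) * inverse (det (B x)))"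
    by (rule smooth_on_cong[OF assms(1)]) (simp add: matrix_inv_cramer[OF assms(3)])
  ultimately show ?thesis by blast
qed

section \<open>Second derivatives\<close>

lemma has_real_derivative_along_line:
  fixes f :: "'a::real_normed_vector \<Rightarrow> real"
  assumes "f differentiable (at (z + s *\<^sub>R v))"
  shows "((\<lambda>s. f (z + s *\<^sub>R v)) has_real_derivative frechet_derivative f (at (z + s *\<^sub>R v)) v) (at s)"
proof -
  let ?D = "frechet_derivative f (at (z + s *\<^sub>R v))"
  have "((\<lambda>s. z + s *\<^sub>R v) has_derivative (\<lambda>h. h *\<^sub>R v)) (at s)"
    by (auto intro!: derivative_eq_intros)
  moreover have "(f has_derivative ?D) (at (z + s *\<^sub>R v))"
    using assms frechet_derivative_works by blast
  ultimately have "((\<lambda>s. f (z + s *\<^sub>R v)) has_derivative (\<lambda>h. ?D (h *\<^sub>R v))) (at s)"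
    by (rule has_derivative_compose)
  moreover have "(\<lambda>h. ?D (h *\<^sub>R v)) = (*) (?D v)"
    using linear_cmul[OF linear_frechet_derivative[OF assms]] by (auto simp: fun_eq_iff mult.commute)
  ultimately show ?thesis unfolding has_field_derivative_def by simp
qed

text \<open>The second difference on the left is symmetric in \<open>v\<close> and \<open>w\<close>,
  the derivative on the right is not; this is what yields Schwarz's theorem below. The mean value
  theorem is used twice: along \<open>v\<close> for the increment in direction \<open>w\<close>,
  then along \<open>w\<close> for the derivative in direction \<open>v\<close>.\<close>

lemma second_difference:
  fixes f :: "'a::real_normed_vector \<Rightarrow> real"
  assumes f: "smooth_on S f" and S: "ball z r \<subseteq> S"
    and t: "0 < t" "t * (norm v + norm w) < r"
  shows "\<exists>x. dist z x \<le> t * (norm v + norm w) \<and>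
    f (z + t *\<^sub>R v + t *\<^sub>R w) - f (z + t *\<^sub>R v) - f (z + t *\<^sub>R w) + f z
      = t * t * frechet_derivative (\<lambda>x. frechet_derivative f (at x) v) (at x) w"
proof -
  have close: "dist z (z + a *\<^sub>R v + b *\<^sub>R w) \<le> t * (norm v + norm w)"
    if "0 \<le> a" "a \<le> t" "0 \<le> b" "b \<le> t" for a b
  proof -
    have "dist z (z + a *\<^sub>R v + b *\<^sub>R w) = norm (a *\<^sub>R v + b *\<^sub>R w)"
      by (metis add.assoc add_diff_cancel_left' dist_commute dist_norm)
    also have "\<dots> \<le> a * norm v + b * norm w"
      using norm_triangle_ineq[of "a *\<^sub>R v" "b *\<^sub>R w"] that by simp
    also have "\<dots> \<le> t * norm v + t * norm w"
      using that by (intro add_mono mult_right_mono) auto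
    finally show ?thesis by (simp add: algebra_simps)
  qed
  have mem: "z + a *\<^sub>R v + b *\<^sub>R w \<in> S" if "0 \<le> a" "a \<le> t" "0 \<le> b" "b \<le> t" for a b
    using close[OF that] t S by (metis le_less_trans mem_ball subsetD)
  have d1: "((\<lambda>s. f (z + s *\<^sub>R v + b *\<^sub>R w)) has_real_derivative
      frechet_derivative f (at (z + a *\<^sub>R v + b *\<^sub>R w)) v) (at a)"
    if "0 \<le> a" "a \<le> t" "0 \<le> b" "b \<le> t" for a b
    using has_real_derivative_along_line[of f "z + b *\<^sub>R w" a v]
      smooth_on_imp_differentiable[OF f mem[OF that]] by (simp add: algebra_simps)
  have "\<exists>a>0. a < t \<and> (\<lambda>s. f (z + s *\<^sub>R v + t *\<^sub>R w) - f (z + s *\<^sub>R v)) t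
      - (\<lambda>s. f (z + s *\<^sub>R v + t *\<^sub>R w) - f (z + s *\<^sub>R v)) 0
      = (t - 0) * (frechet_derivative f (at (z + a *\<^sub>R v + t *\<^sub>R w)) v
          - frechet_derivative f (at (z + a *\<^sub>R v)) v)"
    using t d1[of _ t] d1[of _ 0] by (intro MVT2 DERIV_diff) auto
  then obtain a where a: "0 < a" "a < t"
    and e1: "f (z + t *\<^sub>R v + t *\<^sub>R w) - f (z + t *\<^sub>R v) - f (z + t *\<^sub>R w) + f z
      = t * (frechet_derivative f (at (z + a *\<^sub>R v + t *\<^sub>R w)) v
          - frechet_derivative f (at (z + a *\<^sub>R v)) v)"
    by (auto simp: algebra_simps)
  have "\<exists>b>0. b < t \<and> frechet_derivative f (at (z + a *\<^sub>R v + t *\<^sub>R w)) v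
       - frechet_derivative f (at (z + a *\<^sub>R v + 0 *\<^sub>R w)) v
      = (t - 0) * frechet_derivative (\<lambda>x. frechet_derivative f (at x) v)
          (at (z + a *\<^sub>R v + b *\<^sub>R w)) w"
    using t a mem smooth_on_imp_differentiable[OF smooth_on_frechet_derivative[OF f]]
    by (intro MVT2 has_real_derivative_along_line) auto
  then obtain b where b: "0 < b" "b < t"
    and e2: "frechet_derivative f (at (z + a *\<^sub>R v + t *\<^sub>R w)) v
       - frechet_derivative f (at (z + a *\<^sub>R v)) v
      = t * frechet_derivative (\<lambda>x. frechet_derivative f (at x) v)
          (at (z + a *\<^sub>R v + b *\<^sub>R w)) w"
    by auto
  show ?thesis
    using close[of a b] a b e1 e2 by (intro exI[of _ "z + a *\<^sub>R v + b *\<^sub>R w"]) auto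
qed

text \<open>Schwarz's theorem. Computing the same second difference in both orders gives two points
  near \<open>z\<close> at which the two mixed derivatives take equal values; continuity of both at
  \<open>z\<close> does the rest.\<close>

lemma frechet_derivative_commute_real:
  fixes f :: "'a::real_normed_vector \<Rightarrow> real"
  assumes f: "smooth_on S f" and S: "open S" "z \<in> S"
  shows "frechet_derivative (\<lambda>x. frechet_derivative f (at x) v) (at z) w
    = frechet_derivative (\<lambda>x. frechet_derivative f (at x) w) (at z) v"
proof -
  define F where "F v w = (\<lambda>x. frechet_derivative (\<lambda>x. frechet_derivative f (at x) v) (at x) w)" for v w
  have cont: "isCont (F v w) z" for v w
    using smooth_on_imp_continuous_on[OF smooth_on_frechet_derivative[OF smooth_on_frechet_derivative[OF f]]]
      S unfolding F_def by (simp add: continuous_on_eq_continuous_at)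
  have "\<bar>F v w z - F w v z\<bar> \<le> e" if "e > 0" for e
  proof -
    obtain d1 where d1: "d1 > 0" "\<And>x. dist x z < d1 \<Longrightarrow> dist (F v w x) (F v w z) < e / 2"
      using cont[of v w] \<open>e > 0\<close> unfolding continuous_at_eps_delta
      by (metis dist_commute half_gt_zero)
    obtain d2 where d2: "d2 > 0" "\<And>x. dist x z < d2 \<Longrightarrow> dist (F w v x) (F w v z) < e / 2"
      using cont[of w v] \<open>e > 0\<close> unfolding continuous_at_eps_delta
      by (metis dist_commute half_gt_zero)
    obtain r where r: "r > 0" "ball z r \<subseteq> S" using S openE by blast
    define m where "m = Min {d1, d2, r}"
    have m: "m > 0" "m \<le> d1" "m \<le> d2" "m \<le> r" using d1 d2 r by (auto simp: m_def)
    \<comment> \<open>The summand 1 keeps the quotient meaningful when \<open>v\<close> and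
      \<open>w\<close> both vanish, and makes the bound by \<open>m\<close> strict.\<close>
    define t where "t = m / (norm v + norm w + 1)"
    have N: "norm v + norm w + 1 > 0" by (simp add: add_nonneg_pos)
    have t: "t > 0" "t * (norm v + norm w) < m"
    proof -
      show "t > 0" unfolding t_def using m N by simp
      have "t * (norm v + norm w) < t * (norm v + norm w + 1)" using \<open>t > 0\<close> by (intro mult_strict_left_mono) auto
      also have "\<dots> = m" unfolding t_def using N by simp
      finally show "t * (norm v + norm w) < m" .
    qed
    obtain x where x: "dist z x \<le> t * (norm v + norm w)"
      "f (z + t *\<^sub>R v + t *\<^sub>R w) - f (z + t *\<^sub>R v) - f (z + t *\<^sub>R w) + f z = t * t * F v w x"
      using second_difference[OF f r(2) t(1), of v w] t m unfolding F_def by auto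
    obtain y where y: "dist z y \<le> t * (norm v + norm w)"
      "f (z + t *\<^sub>R w + t *\<^sub>R v) - f (z + t *\<^sub>R w) - f (z + t *\<^sub>R v) + f z = t * t * F w v y"
      using second_difference[OF f r(2) t(1), of w v] t m unfolding F_def by (auto simp: add.commute)
    have "z + t *\<^sub>R w + t *\<^sub>R v = z + t *\<^sub>R v + t *\<^sub>R w" by simp
    then have "t * t * F v w x = t * t * F w v y" using x(2) y(2) by (simp add: algebra_simps)
    then have "F v w x = F w v y" using t by simp
    moreover have "dist (F v w x) (F v w z) < e / 2"
      using d1(2)[of x] x(1) t m by (simp add: dist_commute)
    moreover have "dist (F w v y) (F w v z) < e / 2"
      using d2(2)[of y] y(1) t m by (simp add: dist_commute)
    ultimately show ?thesis unfolding dist_real_def by linarith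
  qed
  then have "\<bar>F v w z - F w v z\<bar> \<le> 0" by (meson dense_ge not_less)
  then show ?thesis unfolding F_def by simp
qed

lemma frechet_derivative_eqI:
  "(f has_derivative D) (at z) \<Longrightarrow> frechet_derivative f (at z) v = D v"
  using frechet_derivative_at by metis

lemma frechet_derivative_linear:
  assumes "bounded_linear h" "f differentiable (at x)"
  shows "frechet_derivative (\<lambda>x. h (f x)) (at x) v = h (frechet_derivative f (at x) v)"
proof -
  have "((\<lambda>x. h (f x)) has_derivative (\<lambda>v. h (frechet_derivative f (at x) v))) (at x)"
    using bounded_linear.has_derivative[OF assms(1)] assms(2) by (simp add: frechet_derivative_works)
  from frechet_derivative_eqI[OF this] show ?thesis .
qed

text \<open>The mean value theorem behind the real case has no complex version, so real and
  imaginary parts are treated separately.\<close>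

lemma frechet_derivative_commute:
  fixes f :: "'a::real_normed_vector \<Rightarrow> complex"
  assumes f: "smooth_on S f" and S: "open S" "z \<in> S"
  shows "frechet_derivative (\<lambda>x. frechet_derivative f (at x) v) (at z) w
    = frechet_derivative (\<lambda>x. frechet_derivative f (at x) w) (at z) v"
proof -
  have *: "h (frechet_derivative (\<lambda>x. frechet_derivative f (at x) v) (at z) w)
      = frechet_derivative (\<lambda>x. frechet_derivative (\<lambda>x. h (f x)) (at x) v) (at z) w"
    if "bounded_linear h" for h :: "complex \<Rightarrow> real" and v w
  proof -
    have "frechet_derivative (\<lambda>x. frechet_derivative (\<lambda>x. h (f x)) (at x) v) (at z)
        = frechet_derivative (\<lambda>x. h (frechet_derivative f (at x) v)) (at z)"
      using frechet_derivative_linear[OF that smooth_on_imp_differentiable[OF f]]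
      by (intro frechet_derivative_cong_open[OF S]) auto
    then show ?thesis
      using frechet_derivative_linear[OF that
          smooth_on_imp_differentiable[OF smooth_on_frechet_derivative[OF f] S(2)]] by simp
  qed
  show ?thesis
    using *[OF bounded_linear_Re] *[OF bounded_linear_Im]
      frechet_derivative_commute_real[OF smooth_on_linear[OF bounded_linear_Re S(1) f] S]
      frechet_derivative_commute_real[OF smooth_on_linear[OF bounded_linear_Im S(1) f] S]
    by (simp add: complex_eq_iff)
qed

text \<open>A negative second derivative along the line would make the first derivative, which is
  zero at the minimum, negative just to the right of it; the mean value theorem would then produce a
  smaller value of \<open>f\<close>.\<close>

lemma second_derivative_nonneg_at_local_min:
  fixes f :: "'a::real_normed_vector \<Rightarrow> real"
  assumes f: "smooth_on S f" and S: "open S" "z \<in> S"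
    and min: "\<And>y. y \<in> S \<Longrightarrow> f z \<le> f y"
  shows "frechet_derivative (\<lambda>x. frechet_derivative f (at x) v) (at z) v \<ge> 0"
proof (rule ccontr)
  define p where "p s = frechet_derivative f (at (z + s *\<^sub>R v)) v" for s :: real
  define l where "l = frechet_derivative (\<lambda>x. frechet_derivative f (at x) v) (at z) v"
  assume "\<not> ?thesis"
  then have l: "l < 0" by (simp add: l_def)
  have "continuous_on UNIV (\<lambda>s::real. z + s *\<^sub>R v)" by (intro continuous_intros)
  then have "open ((\<lambda>s::real. z + s *\<^sub>R v) -` S)" using S(1) open_vimage by blast
  moreover have "0 \<in> (\<lambda>s::real. z + s *\<^sub>R v) -` S" using S by simp
  ultimately obtain r where r: "r > 0" "ball 0 r \<subseteq> (\<lambda>s::real. z + s *\<^sub>R v) -` S"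
    using openE by blast
  have inS: "z + s *\<^sub>R v \<in> S" if "\<bar>s\<bar> < r" for s
    using r(2) that by (auto simp: subset_iff)
  have dphi: "((\<lambda>s. f (z + s *\<^sub>R v)) has_real_derivative p s) (at s)" if "\<bar>s\<bar> < r" for s
    unfolding p_def using smooth_on_imp_differentiable[OF f inS[OF that]]
    by (rule has_real_derivative_along_line)
  have p0: "p 0 = 0"
    using dphi[of 0] r min inS by (intro DERIV_local_min[of _ _ 0 r]) auto
  have "(p has_real_derivative l) (at 0)"
    unfolding p_def l_def using has_real_derivative_along_line[of "\<lambda>x. frechet_derivative f (at x) v" z 0 v]
      smooth_on_imp_differentiable[OF smooth_on_frechet_derivative[OF f]] S by simp
  from DERIV_neg_dec_right[OF this l] obtain d where d: "d > 0" "\<And>h. 0 < h \<Longrightarrow> h < d \<Longrightarrow> p h < p 0"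
    by auto
  define t where "t = min d r / 2"
  have t: "0 < t" "t < d" "t < r" using d r by (auto simp: t_def)
  have "\<exists>s>0. s < t \<and> f (z + t *\<^sub>R v) - f (z + 0 *\<^sub>R v) = (t - 0) * p s"
    using t dphi by (intro MVT2) auto
  then obtain s where s: "0 < s" "s < t" "f (z + t *\<^sub>R v) - f z = t * p s" by auto
  have "p s < 0" using d(2)[of s] s t p0 by auto
  then have "f (z + t *\<^sub>R v) < f z" using s t by (smt (verit) mult_pos_neg)
  then show False using min[OF inS[of t]] t by auto
qed

section \<open>Complex coordinate derivatives\<close>

lemma frechet_derivative_add_at:
  assumes "f differentiable (at z)" "g differentiable (at z)"
  shows "frechet_derivative (\<lambda>x. f x + g x) (at z) v
    = frechet_derivative f (at z) v + frechet_derivative g (at z) v"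
proof -
  have "((\<lambda>x. f x + g x) has_derivative
    (\<lambda>v. frechet_derivative f (at z) v + frechet_derivative g (at z) v)) (at z)"
    using assms unfolding frechet_derivative_works by (rule has_derivative_add)
  from frechet_derivative_eqI[OF this] show ?thesis .
qed

lemma frechet_derivative_mult_at:
  fixes f g :: "'a::real_normed_vector \<Rightarrow> 'b::real_normed_field"
  assumes "f differentiable (at z)" "g differentiable (at z)"
  shows "frechet_derivative (\<lambda>x. f x * g x) (at z) v
    = f z * frechet_derivative g (at z) v + frechet_derivative f (at z) v * g z"
proof -
  have "((\<lambda>x. f x * g x) has_derivative
    (\<lambda>v. f z * frechet_derivative g (at z) v + frechet_derivative f (at z) v * g z)) (at z)"
    using assms unfolding frechet_derivative_works by (rule has_derivative_mult)
  from frechet_derivative_eqI[OF this] show ?thesis .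
qed

lemma
  assumes "f differentiable (at z)" "g differentiable (at z)"
  shows dz_add: "dz i (\<lambda>x. f x + g x) z = dz i f z + dz i g z"
    and dzbar_add: "dzbar i (\<lambda>x. f x + g x) z = dzbar i f z + dzbar i g z"
    and dz_mult: "dz i (\<lambda>x. f x * g x) z = f z * dz i g z + dz i f z * g z"
    and dzbar_mult: "dzbar i (\<lambda>x. f x * g x) z = f z * dzbar i g z + dzbar i f z * g z"
  unfolding dz_def dzbar_def frechet_derivative_add_at[OF assms] frechet_derivative_mult_at[OF assms]
  by (simp_all add: algebra_simps add_divide_distrib diff_divide_distrib)

lemma dz_const: "dz i (\<lambda>x. c) z = 0" and dzbar_const: "dzbar i (\<lambda>x. c) z = 0"
  by (simp_all add: dz_def dzbar_def)

lemma
  assumes "f differentiable (at z)"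
  shows dz_cmult: "dz i (\<lambda>x. c * f x) z = c * dz i f z"
    and dzbar_cmult: "dzbar i (\<lambda>x. c * f x) z = c * dzbar i f z"
    and dz_minus: "dz i (\<lambda>x. - f x) z = - dz i f z"
    and dzbar_minus: "dzbar i (\<lambda>x. - f x) z = - dzbar i f z"
    and dz_cnj: "dz i (\<lambda>x. cnj (f x)) z = cnj (dzbar i f z)"
    and dzbar_cnj: "dzbar i (\<lambda>x. cnj (f x)) z = cnj (dz i f z)"
  using dz_mult[of "\<lambda>x. c" z f i] dzbar_mult[of "\<lambda>x. c" z f i]
    frechet_derivative_linear[OF bounded_linear_minus[OF bounded_linear_ident] assms]
    frechet_derivative_linear[OF bounded_linear_cnj assms] assms
  by (simp_all add: dz_const dzbar_const)
     (simp_all add: dz_def dzbar_def algebra_simps minus_divide_left)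

lemma
  assumes "f differentiable (at z)" "g differentiable (at z)"
  shows dz_diff: "dz i (\<lambda>x. f x - g x) z = dz i f z - dz i g z"
    and dzbar_diff: "dzbar i (\<lambda>x. f x - g x) z = dzbar i f z - dzbar i g z"
  using dz_add[OF assms(1), of "\<lambda>x. - g x" i] dzbar_add[OF assms(1), of "\<lambda>x. - g x" i]
    dz_minus[OF assms(2)] dzbar_minus[OF assms(2)] assms(2) by auto

lemma
  assumes "\<And>i. i \<in> I \<Longrightarrow> f i differentiable (at z)"
  shows dz_sum: "dz k (\<lambda>x. \<Sum>i\<in>I. f i x) z = (\<Sum>i\<in>I. dz k (f i) z)"
    and dzbar_sum: "dzbar k (\<lambda>x. \<Sum>i\<in>I. f i x) z = (\<Sum>i\<in>I. dzbar k (f i) z)"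
proof -
  have "dz k (\<lambda>x. \<Sum>i\<in>I. f i x) z = (\<Sum>i\<in>I. dz k (f i) z) \<and>
    dzbar k (\<lambda>x. \<Sum>i\<in>I. f i x) z = (\<Sum>i\<in>I. dzbar k (f i) z)"
    using assms
  proof (induction I rule: infinite_finite_induct)
    case (insert j I)
    have "(\<lambda>x. \<Sum>i\<in>I. f i x) differentiable at z"
      using insert by (intro differentiable_sum) auto
    then show ?case using insert by (simp add: dz_add dzbar_add)
  qed (simp_all add: dz_const dzbar_const)
  then show "dz k (\<lambda>x. \<Sum>i\<in>I. f i x) z = (\<Sum>i\<in>I. dz k (f i) z)"
    "dzbar k (\<lambda>x. \<Sum>i\<in>I. f i x) z = (\<Sum>i\<in>I. dzbar k (f i) z)" by auto
qed

lemma
  assumes "open S" "z \<in> S" "\<And>y. y \<in> S \<Longrightarrow> f y = g y"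
  shows dz_cong_open: "dz i f z = dz i g z"
    and dzbar_cong_open: "dzbar i f z = dzbar i g z"
  unfolding dz_def dzbar_def using frechet_derivative_cong_open[OF assms] by auto

lemma vec_real_decomposition:
  fixes v :: "complex^'n"
  shows "v = (\<Sum>i\<in>UNIV. Re (v $ i) *\<^sub>R axis i 1 + Im (v $ i) *\<^sub>R axis i \<i>)"
proof -
  have "Re (v $ i) *\<^sub>R axis i 1 + Im (v $ i) *\<^sub>R axis i \<i> = axis i (v $ i)" for i
    by (simp add: vec_eq_iff axis_def complex_eq_iff)
  moreover have "(\<Sum>i\<in>UNIV. axis i (v $ i)) = v"
    by (simp add: vec_eq_iff axis_def sum.delta)
  ultimately show ?thesis by simp
qed

text \<open>The splitting of df into its (1,0)- and (0,1)-part. Through it, vanishing or continuity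
  of all \<open>dz\<close> and \<open>dzbar\<close> derivatives passes to the Frechet
  derivative.\<close>

lemma frechet_derivative_eq_dz_dzbar:
  fixes f :: "complex^'n \<Rightarrow> complex"
  assumes "f differentiable (at z)"
  shows "frechet_derivative f (at z) v = (\<Sum>i\<in>UNIV. v $ i * dz i f z + cnj (v $ i) * dzbar i f z)"
proof -
  let ?F = "frechet_derivative f (at z)"
  note lin = linear_frechet_derivative[OF assms]
  have "?F v = (\<Sum>i\<in>UNIV. Re (v $ i) *\<^sub>R ?F (axis i 1) + Im (v $ i) *\<^sub>R ?F (axis i \<i>))"
    by (subst vec_real_decomposition[of v])
      (simp add: linear_sum[OF lin] linear_add[OF lin] linear_cmul[OF lin])
  also have "\<dots> = (\<Sum>i\<in>UNIV. v $ i * dz i f z + cnj (v $ i) * dzbar i f z)"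
    by (intro sum.cong refl) (simp add: dz_def dzbar_def complex_eq_iff field_simps)
  finally show ?thesis .
qed

lemma
  fixes f :: "complex^'n \<Rightarrow> complex"
  assumes f: "smooth_on S f" and S: "open S" "z \<in> S"
  shows dz_dz_commute: "dz i (dz j f) z = dz j (dz i f) z"
    and dz_dzbar_commute: "dz i (dzbar j f) z = dzbar j (dz i f) z"
proof -
  define D where "D v w = frechet_derivative (\<lambda>x. frechet_derivative f (at x) v) (at z) w" for v w
  have d: "(\<lambda>x. frechet_derivative f (at x) v) differentiable (at z)" for v
    using smooth_on_imp_differentiable[OF smooth_on_frechet_derivative[OF f]] S by blast
  have D: "D v w = D w v" for v w
    unfolding D_def by (rule frechet_derivative_commute[OF f S])
  have lin: "frechet_derivative (\<lambda>x. (frechet_derivative f (at x) v + c * frechet_derivative f (at x) v') / 2) (at z) w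
     = (D v w + c * D v' w) / 2" for c v v' w
  proof -
    have "((\<lambda>x. (frechet_derivative f (at x) v + c * frechet_derivative f (at x) v') / 2) has_derivative
      (\<lambda>w. (D v w + c * D v' w) / 2)) (at z)"
      using d[of v] d[of v'] unfolding D_def frechet_derivative_works
      by (auto intro!: derivative_eq_intros)
    from frechet_derivative_eqI[OF this] show ?thesis .
  qed
  note lin1 = lin[of _ 1, simplified] lin[of _ "-1", simplified]
  have dz2: "frechet_derivative (dz j f) (at z) w = (D (axis j 1) w - \<i> * D (axis j \<i>) w) / 2" for j w
    using lin[of "axis j 1" "-\<i>" "axis j \<i>" w] unfolding dz_def[abs_def] by simp
  have dzbar2: "frechet_derivative (dzbar j f) (at z) w = (D (axis j 1) w + \<i> * D (axis j \<i>) w) / 2" for j w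
    using lin[of "axis j 1" "\<i>" "axis j \<i>" w] unfolding dzbar_def[abs_def] by simp
  show "dz i (dz j f) z = dz j (dz i f) z"
    unfolding dz_def[of i "dz j f"] dz_def[of j "dz i f"] dz2
    using D by (simp add: D[of "axis j _"] field_simps)
  show "dz i (dzbar j f) z = dzbar j (dz i f) z"
    unfolding dz_def[of i "dzbar j f"] dzbar_def[of j "dz i f"] dz2 dzbar2
    using D by (simp add: D[of "axis j _"] field_simps)
qed

text \<open>Passing from \<open>X\<close> to \<open>\<i> *s X\<close> changes the sign of the parts
  of the real Hessian that are quadratic in \<open>X\<close> or in its conjugate, and leaves the
  mixed part alone. The sum of the two real second derivatives is therefore four times the Levi
  form.\<close>

lemma levi_form_nonneg_at_local_min:
  fixes f :: "complex^'n \<Rightarrow> real"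
  assumes f: "smooth_on S f" and S: "open S" "z \<in> S"
    and min: "\<And>y. y \<in> S \<Longrightarrow> f z \<le> f y"
  shows "0 \<le> Re (\<Sum>i\<in>UNIV. \<Sum>j\<in>UNIV. dz i (dzbar j (\<lambda>w. complex_of_real (f w))) z * X $ i * cnj (X $ j))"
proof -
  define F where "F = (\<lambda>w. complex_of_real (f w))"
  have F: "smooth_on S F" unfolding F_def by (rule smooth_on_linear[OF bounded_linear_of_real S(1) f])
  define D where "D v = frechet_derivative (\<lambda>x. frechet_derivative F (at x) v) (at z) v" for v
  have D0: "Re (D v) \<ge> 0" for v
  proof -
    have "frechet_derivative (\<lambda>x. frechet_derivative F (at x) v) (at z)
      = frechet_derivative (\<lambda>x. complex_of_real (frechet_derivative f (at x) v)) (at z)" (is "_ = ?R")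
      unfolding F_def using frechet_derivative_linear[OF bounded_linear_of_real smooth_on_imp_differentiable[OF f]]
      by (intro frechet_derivative_cong_open[OF S]) auto
    moreover have "?R v = complex_of_real (frechet_derivative (\<lambda>x. frechet_derivative f (at x) v) (at z) v)"
      using smooth_on_imp_differentiable[OF smooth_on_frechet_derivative[OF f] S(2)]
      by (rule frechet_derivative_linear[OF bounded_linear_of_real])
    ultimately show ?thesis
      unfolding D_def using second_derivative_nonneg_at_local_min[OF f S min] by simp
  qed
  have d1: "dz i F differentiable (at z)" "dzbar i F differentiable (at z)" for i
    using smooth_on_imp_differentiable[OF smooth_on_dz[OF S(1) F] S(2)]
      smooth_on_imp_differentiable[OF smooth_on_dzbar[OF S(1) F] S(2)] by auto
  have exp: "D v = (\<Sum>j\<in>UNIV. \<Sum>i\<in>UNIV. v $ j * (v $ i * dz j (dz i F) z + cnj (v $ i) * dz j (dzbar i F) z)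
      + cnj (v $ j) * (v $ i * dzbar j (dz i F) z + cnj (v $ i) * dzbar j (dzbar i F) z))" for v
  proof -
    have dd: "(\<lambda>x. v $ i * dz i F x + cnj (v $ i) * dzbar i F x) differentiable (at z)" for i
      using d1 by auto
    have "frechet_derivative (\<lambda>x. frechet_derivative F (at x) v) (at z)
       = frechet_derivative (\<lambda>x. \<Sum>i\<in>UNIV. v $ i * dz i F x + cnj (v $ i) * dzbar i F x) (at z)"
      using frechet_derivative_eq_dz_dzbar[OF smooth_on_imp_differentiable[OF F]]
      by (intro frechet_derivative_cong_open[OF S]) auto
    then have "D v = (\<Sum>j\<in>UNIV. v $ j * dz j (\<lambda>x. \<Sum>i\<in>UNIV. v $ i * dz i F x + cnj (v $ i) * dzbar i F x) z
       + cnj (v $ j) * dzbar j (\<lambda>x. \<Sum>i\<in>UNIV. v $ i * dz i F x + cnj (v $ i) * dzbar i F x) z)"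
      unfolding D_def using dd by (simp add: frechet_derivative_eq_dz_dzbar differentiable_sum)
    also have "\<dots> = (\<Sum>j\<in>UNIV. \<Sum>i\<in>UNIV. v $ j * (v $ i * dz j (dz i F) z + cnj (v $ i) * dz j (dzbar i F) z)
      + cnj (v $ j) * (v $ i * dzbar j (dz i F) z + cnj (v $ i) * dzbar j (dzbar i F) z))"
      using d1 dd by (simp add: dz_sum dzbar_sum dz_add dzbar_add dz_cmult dzbar_cmult
        sum_distrib_left sum.distrib distrib_left)
    finally show ?thesis .
  qed
  let ?L = "\<Sum>i\<in>UNIV. \<Sum>j\<in>UNIV. dz i (dzbar j F) z * X $ i * cnj (X $ j)"
  have L2: "(\<Sum>j\<in>UNIV. \<Sum>i\<in>UNIV. cnj (X $ j) * X $ i * dzbar j (dz i F) z) = ?L"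
    by (subst sum.swap) (simp add: dz_dzbar_commute[OF F S] mult.commute mult.left_commute)
  have "D X + D (\<i> *s X) = (\<Sum>j\<in>UNIV. \<Sum>i\<in>UNIV. 2 * (X $ j * cnj (X $ i) * dz j (dzbar i F) z)
      + 2 * (cnj (X $ j) * X $ i * dzbar j (dz i F) z))"
    unfolding exp sum.distrib[symmetric] by (intro sum.cong refl) (simp add: algebra_simps)
  also have "\<dots> = 2 * ?L + 2 * ?L"
    unfolding sum.distrib sum_distrib_left[symmetric] L2 by (simp add: mult_ac)
  finally have "?L = (D X + D (\<i> *s X)) / 4" by simp
  moreover have "Re a = (Re p + Re q) / 4" if "a = (p + q) / 4" for a p q :: complex
    by (simp add: that)
  ultimately have "Re ?L = (Re (D X) + Re (D (\<i> *s X))) / 4" by blast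
  then show ?thesis using D0[of X] D0[of "\<i> *s X"] unfolding F_def by simp
qed

section \<open>Hermitian linear algebra\<close>

definition hermitian_pd :: "complex^'n^'n \<Rightarrow> bool" where
  "hermitian_pd G \<longleftrightarrow> (\<forall>i j. G $ j $ i = cnj (G $ i $ j)) \<and>
    (\<forall>X. X \<noteq> 0 \<longrightarrow> Re (norm_sq G X) > 0)"

lemma hermitian_pd_cnj: "hermitian_pd G \<Longrightarrow> cnj (G $ i $ j) = G $ j $ i"
  unfolding hermitian_pd_def by metis

lemma hermitian_pd_pos: "hermitian_pd G \<Longrightarrow> X \<noteq> 0 \<Longrightarrow> Re (norm_sq G X) > 0"
  unfolding hermitian_pd_def by blast

text \<open>\<open>norm_sq\<close> pairs the second index with a conjugated entry while
  \<open>*v\<close> sums over it without conjugation, so the form attached to \<open>*v\<close> sees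
  the conjugate vector.\<close>

lemma norm_sq_cnj: "norm_sq G (\<chi> i. cnj (Z $ i)) = (\<Sum>i\<in>UNIV. cnj (Z $ i) * (G *v Z) $ i)"
  by (simp add: norm_sq_def matrix_vector_mult_def sum_distrib_left mult_ac)

lemma hermitian_pd_det_nonzero:
  fixes G :: "complex^'n^'n"
  assumes "hermitian_pd G"
  shows "det G \<noteq> 0"
proof -
  have "Z = 0" if "G *v Z = 0" for Z
  proof (rule ccontr)
    assume "Z \<noteq> 0"
    then have "(\<chi> i. cnj (Z $ i)) \<noteq> 0" by (auto simp: vec_eq_iff)
    then have "Re (norm_sq G (\<chi> i. cnj (Z $ i))) > 0" using assms(1) by (intro hermitian_pd_pos)
    then show False using that by (simp add: norm_sq_cnj)
  qed
  then have "invertible G" using matrix_left_invertible_ker[of G] invertible_left_inverse by blast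
  then show ?thesis by (simp add: invertible_det_nz)
qed

lemma
  fixes G :: "complex^'n^'n"
  assumes "hermitian_pd G"
  shows inverse_metric_right: "(\<Sum>q\<in>UNIV. inverse_metric G p q * G $ k $ q) = (if k = p then 1 else 0)"
    and inverse_metric_left: "(\<Sum>p\<in>UNIV. inverse_metric G p q * G $ p $ l) = (if l = q then 1 else 0)"
proof -
  note inv = matrix_inv_inverse[OF hermitian_pd_det_nonzero[OF assms]]
  have "(\<Sum>q\<in>UNIV. G $ k $ q * matrix_inv G $ q $ p) = (G ** matrix_inv G) $ k $ p"
    "(\<Sum>p\<in>UNIV. matrix_inv G $ q $ p * G $ p $ l) = (matrix_inv G ** G) $ q $ l"
    by (simp_all add: matrix_matrix_mult_def)
  then show "(\<Sum>q\<in>UNIV. inverse_metric G p q * G $ k $ q) = (if k = p then 1 else 0)"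
    "(\<Sum>p\<in>UNIV. inverse_metric G p q * G $ p $ l) = (if l = q then 1 else 0)"
    unfolding inv by (auto simp: inverse_metric_def mat_def mult.commute)
qed

text \<open>The conjugate transpose of the inverse is a left inverse of \<open>G\<close> as well,
  and inverses are unique.\<close>

lemma inverse_metric_hermitian:
  fixes G :: "complex^'n^'n"
  assumes "hermitian_pd G"
  shows "cnj (inverse_metric G p q) = inverse_metric G q p"
proof -
  let ?W = "(\<chi> i j. cnj (matrix_inv G $ j $ i)) :: complex^'n^'n"
  note inv = matrix_inv_inverse[OF hermitian_pd_det_nonzero[OF assms]]
  note G = hermitian_pd_cnj[OF assms]
  have "(?W ** G) $ i $ j = mat 1 $ i $ j" for i j
  proof -
    have "(?W ** G) $ i $ j = cnj ((G ** matrix_inv G) $ j $ i)"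
      by (simp add: matrix_matrix_mult_def G mult.commute)
    then show ?thesis unfolding inv by (auto simp: mat_def)
  qed
  then have "?W ** G = mat 1" by (simp add: vec_eq_iff)
  then have "?W = matrix_inv G"
    using inv by (metis matrix_mul_assoc matrix_mul_lid matrix_mul_rid)
  then show ?thesis by (simp add: inverse_metric_def vec_eq_iff)
qed

text \<open>Substituting \<open>Y = G *v Z\<close> turns the form of the inverse into that of
  \<open>G\<close> on the conjugate of \<open>Z\<close>, up to a conjugation that the real part
  ignores.\<close>

lemma inverse_metric_pos:
  fixes G :: "complex^'n^'n"
  assumes "hermitian_pd G" "Y \<noteq> 0"
  shows "0 < Re (\<Sum>k\<in>UNIV. \<Sum>l\<in>UNIV. inverse_metric G k l * Y $ k * cnj (Y $ l))"
proof -
  define Z where "Z = matrix_inv G *v Y"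
  note inv = matrix_inv_inverse[OF hermitian_pd_det_nonzero[OF assms(1)]]
  have GZ: "G *v Z = Y" by (simp add: Z_def matrix_vector_mul_assoc inv)
  have "Z \<noteq> 0" using GZ assms(2) by (auto simp: matrix_vector_mult_0_right)
  then have "(\<chi> i. cnj (Z $ i)) \<noteq> 0" by (auto simp: vec_eq_iff)
  then have "Re (norm_sq G (\<chi> i. cnj (Z $ i))) > 0" using assms(1) by (intro hermitian_pd_pos)
  moreover have "(\<Sum>k\<in>UNIV. \<Sum>l\<in>UNIV. inverse_metric G k l * Y $ k * cnj (Y $ l))
      = cnj (\<Sum>i\<in>UNIV. cnj (Z $ i) * (G *v Z) $ i)"
    unfolding GZ by (subst sum.swap)
      (simp add: Z_def inverse_metric_def matrix_vector_mult_def sum_distrib_right)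
  ultimately show ?thesis unfolding norm_sq_cnj by simp
qed

text \<open>Eliminating one index at a time, passing to the Schur complement of \<open>P\<close>, avoids a simultaneous
  diagonalisation.\<close>

lemma sum_hermitian_pd_mult_psd_nonneg:
  fixes P U :: "'n \<Rightarrow> 'n \<Rightarrow> complex"
  assumes "finite S"
    and "\<And>k l. P l k = cnj (P k l)"
    and "\<And>Y. (\<exists>k\<in>S. Y k \<noteq> 0) \<Longrightarrow> 0 < Re (\<Sum>k\<in>S. \<Sum>l\<in>S. P k l * Y k * cnj (Y l))"
    and U: "\<And>S v. finite S \<Longrightarrow> 0 \<le> Re (\<Sum>k\<in>S. \<Sum>l\<in>S. U k l * v k * cnj (v l))"
  shows "0 \<le> Re (\<Sum>k\<in>S. \<Sum>l\<in>S. P k l * U k l)"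
  using assms(1-3)
proof (induction S arbitrary: P rule: finite_induct)
  case (insert s S)
  have cP: "cnj (P k l) = P l k" for k l using insert.prems(1) by metis
  define p where "p = P s s"
  define e :: "'n \<Rightarrow> complex" where "e k = (if k = s then 1 else 0)" for k
  have e: "e s = 1" "\<And>k. k \<in> S \<Longrightarrow> e k = 0" using insert.hyps by (auto simp: e_def)
  have "(\<Sum>k\<in>insert s S. \<Sum>l\<in>insert s S. P k l * e k * cnj (e l)) = p"
    using insert.hyps by (simp add: p_def e)
  then have "Re p > 0" using insert.prems(2)[of e] e(1) by auto
  moreover have pc: "cnj p = p" by (simp add: p_def cP)
  ultimately obtain r where r: "p = complex_of_real r" "r > 0"
    by (metis Reals_cnj_iff Re_complex_of_real of_real_Re)
  then have p0: "p \<noteq> 0" by simp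
  define P' where "P' k l = P k l - P k s * P s l / p" for k l
  have pos1: "0 \<le> Re (\<Sum>k\<in>S. \<Sum>l\<in>S. P' k l * U k l)"
  proof (rule insert.IH)
    fix k l show "P' l k = cnj (P' k l)"
      by (simp add: P'_def cP pc mult.commute)
  next
    fix Y :: "'n \<Rightarrow> complex" assume Y: "\<exists>k\<in>S. Y k \<noteq> 0"
    define A where "A = (\<Sum>k\<in>S. P k s * Y k)"
    \<comment> \<open>This value at \<open>s\<close> completes the square, so that the form of
      \<open>P\<close> at \<open>Z\<close> is the form of the Schur complement at
      \<open>Y\<close>.\<close>
    define Z where "Z = Y(s := - A / p)"
    have cA: "cnj A = (\<Sum>l\<in>S. P s l * cnj (Y l))"
      by (simp add: A_def cP)
    have ZS: "Z k = Y k" if "k \<in> S" for k using that insert.hyps by (auto simp: Z_def)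
    have "(\<Sum>k\<in>insert s S. \<Sum>l\<in>insert s S. P k l * Z k * cnj (Z l))
      = (\<Sum>k\<in>S. \<Sum>l\<in>S. P k l * Z k * cnj (Z l)) + Z s * (\<Sum>l\<in>S. P s l * cnj (Z l))
        + cnj (Z s) * (\<Sum>k\<in>S. P k s * Z k) + p * Z s * cnj (Z s)"
      using insert.hyps by (simp add: sum.distrib sum_distrib_left p_def mult_ac)
    also have "\<dots> = (\<Sum>k\<in>S. \<Sum>l\<in>S. P k l * Y k * cnj (Y l)) + Z s * cnj A + cnj (Z s) * A + p * Z s * cnj (Z s)"
      unfolding A_def using ZS by (simp add: cP)
    also have "\<dots> = (\<Sum>k\<in>S. \<Sum>l\<in>S. P k l * Y k * cnj (Y l)) - A * cnj A / p"
      using p0 pc by (simp add: Z_def field_simps)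
    also have "A * cnj A / p = (\<Sum>k\<in>S. \<Sum>l\<in>S. P k s * P s l / p * Y k * cnj (Y l))"
      unfolding cA unfolding A_def sum_product sum_divide_distrib by (simp add: mult_ac)
    also have "(\<Sum>k\<in>S. \<Sum>l\<in>S. P k l * Y k * cnj (Y l)) - \<dots>
      = (\<Sum>k\<in>S. \<Sum>l\<in>S. P' k l * Y k * cnj (Y l))"
      by (simp add: P'_def sum_subtractf algebra_simps)
    finally show "0 < Re (\<Sum>k\<in>S. \<Sum>l\<in>S. P' k l * Y k * cnj (Y l))"
      using insert.prems(2)[of Z] Y ZS by force
  qed
  \<comment> \<open>\<open>P\<close> differs from its Schur complement by a rank-one matrix built
    from the column \<open>P k s\<close>; pairing that matrix with \<open>U\<close> gives a value of
    the form of \<open>U\<close>, divided by the positive number \<open>p\<close>.\<close>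
  have pos2: "0 \<le> Re ((\<Sum>k\<in>insert s S. \<Sum>l\<in>insert s S. U k l * P k s * cnj (P l s)) / p)"
    using U[of "insert s S" "\<lambda>k. P k s"] insert.hyps r by (simp del: sum.insert)
  have eq: "(\<Sum>k\<in>insert s S. \<Sum>l\<in>insert s S. P k l * U k l) = (\<Sum>k\<in>S. \<Sum>l\<in>S. P' k l * U k l)
      + (\<Sum>k\<in>insert s S. \<Sum>l\<in>insert s S. U k l * P k s * cnj (P l s)) / p"
  proof -
    have "(\<Sum>k\<in>insert s S. \<Sum>l\<in>insert s S. U k l * P k s * cnj (P l s)) / p
        = (\<Sum>k\<in>insert s S. \<Sum>l\<in>insert s S. P k s * P s l / p * U k l)"
      unfolding sum_divide_distrib by (intro sum.cong refl) (simp add: cP)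
    also have "\<dots> = (\<Sum>k\<in>S. \<Sum>l\<in>S. P k s * P s l / p * U k l)
        + (\<Sum>l\<in>S. P s l * U s l) + (\<Sum>k\<in>S. P k s * U k s) + P s s * U s s"
      using insert.hyps p0 by (simp add: sum.distrib p_def)
    finally show ?thesis
      using insert.hyps by (simp add: P'_def sum.distrib sum_subtractf left_diff_distrib)
  qed
  show ?case unfolding eq plus_complex.sel by (rule add_nonneg_nonneg[OF pos1 pos2])
next
  case empty
  show ?case by simp
qed

section \<open>Polarisation\<close>

definition quartic_form :: "('n \<Rightarrow> 'n \<Rightarrow> 'n \<Rightarrow> 'n \<Rightarrow> complex) \<Rightarrow>
    complex^'n \<Rightarrow> complex^'n \<Rightarrow> complex^'n \<Rightarrow> complex^'n \<Rightarrow> complex" where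
  "quartic_form B a b c d = (\<Sum>i\<in>UNIV. \<Sum>j\<in>UNIV. \<Sum>k\<in>UNIV. \<Sum>l\<in>UNIV.
     B i j k l * a $ i * cnj (b $ j) * c $ k * cnj (d $ l))"

lemma quartic_form_add:
  "quartic_form B (a + a') b c d = quartic_form B a b c d + quartic_form B a' b c d"
  "quartic_form B a (b + b') c d = quartic_form B a b c d + quartic_form B a b' c d"
  "quartic_form B a b (c + c') d = quartic_form B a b c d + quartic_form B a b c' d"
  "quartic_form B a b c (d + d') = quartic_form B a b c d + quartic_form B a b c d'"
  by (simp_all add: quartic_form_def algebra_simps sum.distrib)

lemma quartic_form_scale:
  "quartic_form B (t *s a) b c d = t * quartic_form B a b c d"
  "quartic_form B a (t *s b) c d = cnj t * quartic_form B a b c d"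
  "quartic_form B a b (t *s c) d = t * quartic_form B a b c d"
  "quartic_form B a b c (t *s d) = cnj t * quartic_form B a b c d"
  by (simp_all add: quartic_form_def sum_distrib_left mult_ac)

lemma quartic_form_axis:
  fixes B :: "'n::finite \<Rightarrow> 'n \<Rightarrow> 'n \<Rightarrow> 'n \<Rightarrow> complex"
  shows "quartic_form B (axis i 1) (axis j 1) (axis k 1) (axis l 1) = B i j k l"
proof -
  have delta: "(\<Sum>x\<in>UNIV. f x * (if x = a then 1 else 0)) = f a" for f :: "'n \<Rightarrow> complex" and a
    by (simp add: if_distrib cong: if_cong)
  have cnj_delta: "cnj (if x = a then 1 else 0) = (if x = a then 1 else 0)" for x a :: 'n by simp
  show ?thesis unfolding quartic_form_def axis_def vec_lambda_beta cnj_delta delta ..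
qed

text \<open>\<open>B\<close> need not be symmetric, so the diagonal values see only its
  symmetrisation in the two unbarred and in the two barred indices, which is the four-term sum. Once
  \<open>X\<close> and \<open>Y\<close> are separated, the form is polarised in the unbarred pair,
  then in the barred pair, and basis vectors are inserted.\<close>

lemma quartic_form_polarisation:
  fixes B :: "'n::finite \<Rightarrow> 'n \<Rightarrow> 'n \<Rightarrow> 'n \<Rightarrow> complex"
  assumes zero: "\<And>X. quartic_form B X X X X = 0"
  shows "B i j k l + B k j i l + B i l k j + B k l i j = 0"
proof -
  let ?Q = "quartic_form B"
  \<comment> \<open>Summing over the fourth roots of unity \<open>t\<close> with weight \<open>t\<^sup>2\<close> keeps the terms of bidegree
    \<open>(2,0)\<close> and \<open>(0,2)\<close> in \<open>(t, cnj t)\<close>; then \<open>(1 + \<i>)\<^sup>2 = 2\<i>\<close> separates these two.\<close>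
  have sum0: "?Q Y X Y X + ?Q X Y X Y = 0" for X Y
  proof -
    define F where "F t = ?Q (X + t *s Y) (X + t *s Y) (X + t *s Y) (X + t *s Y)" for t
    have F0: "F t = 0" for t by (simp add: F_def zero)
    have "?Q Y X Y X + ?Q X Y X Y = (F 1 - F \<i> + F (-1) - F (-\<i>)) / 4"
      unfolding F_def quartic_form_add quartic_form_scale by (simp add: algebra_simps)
    then show ?thesis unfolding F0 by simp
  qed
  have diag: "?Q X Y X Y = 0" for X Y
    using sum0[of Y X] sum0[of "(1 + \<i>) *s Y" X] unfolding quartic_form_scale
    by (simp add: algebra_simps)
  have mid: "?Q X Y Z Y + ?Q Z Y X Y = 0" for X Y Z
    using diag[of "X + Z" Y] diag[of X Y] diag[of Z Y] unfolding quartic_form_add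
    by (simp add: add.commute)
  have "?Q X Y Z W + ?Q X W Z Y + ?Q Z Y X W + ?Q Z W X Y = 0" for X Y Z W
  proof -
    have "?Q X Y Z W + ?Q X W Z Y + ?Q Z Y X W + ?Q Z W X Y
      = (?Q X (Y + W) Z (Y + W) + ?Q Z (Y + W) X (Y + W))
        - (?Q X Y Z Y + ?Q Z Y X Y) - (?Q X W Z W + ?Q Z W X W)"
      unfolding quartic_form_add by (simp add: algebra_simps)
    then show ?thesis unfolding mid by simp
  qed
  from this[of "axis i 1" "axis j 1" "axis k 1" "axis l 1"] show ?thesis
    by (simp add: quartic_form_axis add_ac)
qed

section \<open>Curvature of a locally conformal Kaehler metric in a chart\<close>

text \<open>Below, \<open>g\<close> is the metric, \<open>h\<close> its inverse, \<open>R\<close> the Chern curvature, and \<open>U\<close> the complex Hessian of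
  the conformal factor \<open>u\<close>; by \<open>sym1\<close> and \<open>sym2\<close>, \<open>R + U \<otimes> g\<close> is the curvature of the Kaehler
  metric \<open>exp (- u) g\<close> up to a factor.\<close>

lemma mixed_curvature_contraction:
  fixes g h U Ric :: "'n::finite \<Rightarrow> 'n \<Rightarrow> complex" and R :: "'n \<Rightarrow> 'n \<Rightarrow> 'n \<Rightarrow> 'n \<Rightarrow> complex"
    and \<alpha> \<beta> c :: complex
  defines "n \<equiv> of_nat CARD('n)"
    and "D \<equiv> (\<Sum>k\<in>UNIV. \<Sum>l\<in>UNIV. h k l * U k l)"
    and "s \<equiv> (\<Sum>k\<in>UNIV. \<Sum>l\<in>UNIV. h k l * Ric k l)"
  assumes right: "\<And>k p. (\<Sum>q\<in>UNIV. h p q * g k q) = (if k = p then 1 else 0)"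
    and left: "\<And>l q. (\<Sum>p\<in>UNIV. h p q * g p l) = (if l = q then 1 else 0)"
    and Ric: "\<And>i j. Ric i j = (\<Sum>k\<in>UNIV. \<Sum>l\<in>UNIV. h k l * R i j k l)"
    and sym1: "\<And>i j k l. R i j k l + U i j * g k l = R k j i l + U k j * g i l"
    and sym2: "\<And>i j k l. R i j k l + U i j * g k l = R i l k j + U i l * g k j"
    and zero: "\<And>i j k l. (\<alpha> * Ric i j * g k l + \<beta> * R i j k l - c * g i j * g k l)
        + (\<alpha> * Ric k j * g i l + \<beta> * R k j i l - c * g k j * g i l)
        + (\<alpha> * Ric i l * g k j + \<beta> * R i l k j - c * g i l * g k j)
        + (\<alpha> * Ric k l * g i j + \<beta> * R k l i j - c * g k l * g i j) = 0"
  shows "(4 * \<beta> + (n + 2) * \<alpha>) * Ric i j + (3 * n - 2) * \<beta> * U i j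
      = (2 * c * (n + 1) + \<beta> * D - \<alpha> * s) * g i j"
    and "(4 * \<beta> + (n + 2) * \<alpha>) * s + (3 * n - 2) * \<beta> * D = n * (2 * c * (n + 1) + \<beta> * D - \<alpha> * s)"
proof -
  define C :: "('n \<Rightarrow> 'n \<Rightarrow> complex) \<Rightarrow> complex"
    where "C F = (\<Sum>k\<in>UNIV. \<Sum>l\<in>UNIV. h k l * F k l)" for F
  have C_add: "C (\<lambda>k l. F k l + F' k l) = C F + C F'" for F F'
    by (simp add: C_def distrib_left sum.distrib)
  have C_diff: "C (\<lambda>k l. F k l - F' k l) = C F - C F'" for F F'
    by (simp add: C_def right_diff_distrib sum_subtractf)
  have C_mult: "C (\<lambda>k l. a * F k l) = a * C F" "C (\<lambda>k l. F k l * a) = C F * a" for F a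
    by (simp_all add: C_def sum_distrib_left sum_distrib_right mult_ac)
  have C_g: "C g = n"
    unfolding C_def right n_def by simp
  have C_1: "C (\<lambda>k l. x k * g i l) = x i" for x i
  proof -
    have "C (\<lambda>k l. x k * g i l) = (\<Sum>k\<in>UNIV. x k * (\<Sum>l\<in>UNIV. h k l * g i l))"
      by (simp add: C_def sum_distrib_left mult_ac)
    then show ?thesis unfolding right by (simp add: if_distrib cong: if_cong)
  qed
  have C_2: "C (\<lambda>k l. x l * g k j) = x j" for x j
  proof -
    have "C (\<lambda>k l. x l * g k j) = (\<Sum>l\<in>UNIV. x l * (\<Sum>k\<in>UNIV. h k l * g k j))"
      unfolding C_def by (subst sum.swap) (simp add: sum_distrib_left mult_ac)
    then show ?thesis unfolding left by (simp add: if_distrib cong: if_cong)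
  qed
  note C_simps = C_add C_diff C_mult C_g
  have CD: "C U = D" "C Ric = s" by (simp_all add: C_def D_def s_def)
  have R1: "C (\<lambda>k l. R i j k l) = Ric i j" for i j by (simp add: C_def Ric)
  \<comment> \<open>Exchanging \<open>i\<close> and \<open>k\<close> costs
    \<open>U i j * g k l - U k j * g i l\<close>, whose trace is n - 1 times \<open>U i j\<close>;
    \<open>R3\<close> is the same for the barred indices.\<close>
  have R2: "C (\<lambda>k l. R k j i l) = Ric i j + n * U i j - U i j" for i j
  proof -
    have "(\<lambda>k l. R k j i l) = (\<lambda>k l. R i j k l + U i j * g k l - U k j * g i l)"
      using sym1 by (simp add: fun_eq_iff eq_diff_eq)
    then have "C (\<lambda>k l. R k j i l) = C (\<lambda>k l. R i j k l + U i j * g k l - U k j * g i l)" by simp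
    then show ?thesis by (simp only: C_simps R1 C_1[of "\<lambda>k. U k j"]) (simp add: mult.commute)
  qed
  have R3: "C (\<lambda>k l. R i l k j) = Ric i j + n * U i j - U i j" for i j
  proof -
    have "(\<lambda>k l. R i l k j) = (\<lambda>k l. R i j k l + U i j * g k l - U i l * g k j)"
      using sym2 by (simp add: fun_eq_iff eq_diff_eq)
    then have "C (\<lambda>k l. R i l k j) = C (\<lambda>k l. R i j k l + U i j * g k l - U i l * g k j)" by simp
    then show ?thesis by (simp only: C_simps R1 C_2[of "\<lambda>l. U i l"]) (simp add: mult.commute)
  qed
  \<comment> \<open>Both pairs are exchanged here: the barred exchange is \<open>R3\<close>, and the
    unbarred one traces to \<open>U i j - D * g i j\<close>.\<close>
  have R4: "C (\<lambda>k l. R k l i j) = Ric i j + n * U i j - D * g i j" for i j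
  proof -
    have "(\<lambda>k l. R k l i j) = (\<lambda>k l. R i l k j + U i l * g k j - U k l * g i j)"
      using sym1[of _ _ _ j] by (simp add: fun_eq_iff eq_diff_eq)
    then have "C (\<lambda>k l. R k l i j) = C (\<lambda>k l. R i l k j + U i l * g k j - U k l * g i j)" by simp
    then show ?thesis by (simp only: C_simps R3 C_2[of "\<lambda>l. U i l"] CD) simp
  qed
  have main: "(4 * \<beta> + (n + 2) * \<alpha>) * Ric i j + (3 * n - 2) * \<beta> * U i j
      = (2 * c * (n + 1) + \<beta> * D - \<alpha> * s) * g i j" for i j
  proof -
    \<comment> \<open>Tracing over \<open>k\<close> and \<open>l\<close> gives n + 1 + 1 copies of
      \<alpha> and four of \<beta> in front of the Ricci term, (n-1) + (n-1) + n = 3n - 2 copies of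
      \<beta> in front of \<open>U i j\<close> from the exchanges, and n + 1 + 1 + n copies of c in
      front of the metric.\<close>
    have "C (\<lambda>k l. (\<alpha> * Ric i j * g k l + \<beta> * R i j k l - c * g i j * g k l)
        + (\<alpha> * (Ric k j * g i l) + \<beta> * R k j i l - c * (g k j * g i l))
        + (\<alpha> * (Ric i l * g k j) + \<beta> * R i l k j - c * (g i l * g k j))
        + (\<alpha> * Ric k l * g i j + \<beta> * R k l i j - c * g k l * g i j)) = 0"
      using zero[of i j, unfolded mult.assoc] unfolding mult.assoc by (simp only: C_def) simp
    then have "(\<alpha> * Ric i j * n + \<beta> * Ric i j - c * g i j * n)
        + (\<alpha> * Ric i j + \<beta> * (Ric i j + n * U i j - U i j) - c * g i j)
        + (\<alpha> * Ric i j + \<beta> * (Ric i j + n * U i j - U i j) - c * g i j)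
        + (\<alpha> * s * g i j + \<beta> * (Ric i j + n * U i j - D * g i j) - c * n * g i j) = 0"
      by (simp only: C_simps R1 R2 R3 R4 C_1[of "\<lambda>k. Ric k j"] C_2[of "\<lambda>l. Ric i l"]
          C_1[of "\<lambda>k. g k j"] C_2[of "\<lambda>l. g i l"] CD)
    then show ?thesis by algebra
  qed
  then show "(4 * \<beta> + (n + 2) * \<alpha>) * Ric i j + (3 * n - 2) * \<beta> * U i j
      = (2 * c * (n + 1) + \<beta> * D - \<alpha> * s) * g i j" .
  have "C (\<lambda>i j. (4 * \<beta> + (n + 2) * \<alpha>) * Ric i j + (3 * n - 2) * \<beta> * U i j)
      = C (\<lambda>i j. (2 * c * (n + 1) + \<beta> * D - \<alpha> * s) * g i j)"
    using main by (simp add: C_def)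
  then show "(4 * \<beta> + (n + 2) * \<alpha>) * s + (3 * n - 2) * \<beta> * D = n * (2 * c * (n + 1) + \<beta> * D - \<alpha> * s)"
    by (simp only: C_simps CD) (simp only: mult.commute)
qed

text \<open>The last assumption says that \<open>exp (- u) G\<close> is Kaehler.\<close>

locale lck_chart =
  fixes S :: "(complex^'n::finite) set" and G :: "complex^'n \<Rightarrow> complex^'n^'n"
    and u :: "complex^'n \<Rightarrow> complex"
  assumes S: "open S" and G: "smooth_on S G"
    and pd: "\<And>z. z \<in> S \<Longrightarrow> hermitian_pd (G z)"
    and u: "smooth_on S u" and u_real: "\<And>z. z \<in> S \<Longrightarrow> cnj (u z) = u z"
    and lck: "\<And>z i j k. z \<in> S \<Longrightarrow> dz k (\<lambda>w. G w $ i $ j) z - dz i (\<lambda>w. G w $ k $ j) z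
        = dz k u z * G z $ i $ j - dz i u z * G z $ k $ j"
begin

abbreviation "hess i j z \<equiv> dz i (dzbar j u) z"
abbreviation "h z p q \<equiv> inverse_metric (G z) p q"

lemma smooth_G: "smooth_on S (\<lambda>w. G w $ i $ j)"
  using smooth_on_vec_nth[OF S smooth_on_vec_nth[OF S G]] .

lemma smooth_h: "smooth_on S (\<lambda>w. h w p q)"
  unfolding inverse_metric_def
  by (rule smooth_on_matrix_inv[OF S smooth_G]) (simp add: hermitian_pd_det_nonzero pd)

lemmas smooth_rules = smooth_G smooth_h u smooth_on_dz[OF S] smooth_on_dzbar[OF S]
  smooth_on_sum[OF S] smooth_on_mult[OF S] smooth_on_add[OF S] smooth_on_diff[OF S]
  smooth_on_const smooth_on_cnj[OF S]

lemmas diff = smooth_on_imp_differentiable[of S]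

lemma dzbar_u: "z \<in> S \<Longrightarrow> dzbar i u z = cnj (dz i u z)"
  using dzbar_cong_open[OF S, of z u "\<lambda>w. cnj (u w)" i] u_real dzbar_cnj[of u z i] diff[OF u] by simp

lemma G_cnj: "z \<in> S \<Longrightarrow> cnj (G z $ i $ j) = G z $ j $ i"
  using hermitian_pd_cnj pd by blast

lemma lck_bar:
  assumes z: "z \<in> S"
  shows "dzbar k (\<lambda>w. G w $ i $ j) z - dzbar j (\<lambda>w. G w $ i $ k) z
    = dzbar k u z * G z $ i $ j - dzbar j u z * G z $ i $ k"
proof -
  have *: "dzbar k (\<lambda>w. G w $ i $ j) z = cnj (dz k (\<lambda>w. G w $ j $ i) z)" for i j k
    using dzbar_cong_open[OF S z, of "\<lambda>w. G w $ i $ j" "\<lambda>w. cnj (G w $ j $ i)" k]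
      dzbar_cnj[OF diff[OF smooth_G z]] G_cnj by simp
  show ?thesis
    unfolding * dzbar_u[OF z] using lck[OF z, of k j i] G_cnj[OF z]
    by (metis complex_cnj_diff complex_cnj_mult)
qed

text \<open>Applying \<open>dzbar j\<close> to \<open>lck\<close> turns the difference of the second
  derivatives of \<open>G\<close> into the Hessian terms plus products of derivatives of
  \<open>u\<close> with derivatives of \<open>G\<close>. The difference of the quadratic parts of
  the curvature, again by \<open>lck\<close> and with \<open>h\<close> contracted against
  \<open>G\<close>, consists of the same products, which cancel.\<close>

lemma curvature_swap_holomorphic:
  assumes z: "z \<in> S"
  shows "chern_curvature G z i j k l + hess i j z * G z $ k $ l
    = chern_curvature G z k j i l + hess k j z * G z $ i $ l"
proof -
  have d: "f differentiable (at z)" if "smooth_on S f" for f :: "complex^'n \<Rightarrow> complex"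
    using diff[OF that z] .
  have "dzbar j (\<lambda>w. dz i (\<lambda>w. G w $ k $ l) w - dz k (\<lambda>w. G w $ i $ l) w) z
      = dzbar j (\<lambda>w. dz i u w * G w $ k $ l - dz k u w * G w $ i $ l) z"
    using lck by (intro dzbar_cong_open[OF S z]) auto
  then have "dzbar j (dz i (\<lambda>w. G w $ k $ l)) z - dzbar j (dz k (\<lambda>w. G w $ i $ l)) z
     = dz i u z * dzbar j (\<lambda>w. G w $ k $ l) z + dzbar j (dz i u) z * G z $ k $ l
     - (dz k u z * dzbar j (\<lambda>w. G w $ i $ l) z + dzbar j (dz k u) z * G z $ i $ l)"
    by (simp add: dzbar_diff dzbar_mult d smooth_rules)
  then have 1: "dz i (dzbar j (\<lambda>w. G w $ k $ l)) z - dz k (dzbar j (\<lambda>w. G w $ i $ l)) z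
     = dz i u z * dzbar j (\<lambda>w. G w $ k $ l) z + hess i j z * G z $ k $ l
     - (dz k u z * dzbar j (\<lambda>w. G w $ i $ l) z + hess k j z * G z $ i $ l)"
    by (simp add: dz_dzbar_commute[OF u S z] dz_dzbar_commute[OF smooth_G S z])
  have con: "(\<Sum>p\<in>UNIV. \<Sum>q\<in>UNIV. h z p q * G z $ k $ q * x p) = x k" for k x
  proof -
    have "(\<Sum>p\<in>UNIV. \<Sum>q\<in>UNIV. h z p q * G z $ k $ q * x p)
      = (\<Sum>p\<in>UNIV. (\<Sum>q\<in>UNIV. h z p q * G z $ k $ q) * x p)" by (simp add: sum_distrib_right)
    then show ?thesis
      unfolding inverse_metric_right[OF pd[OF z]] by (simp add: if_distrib if_distribR cong: if_cong)
  qed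
  have "(\<Sum>p\<in>UNIV. \<Sum>q\<in>UNIV. h z p q * dz i (\<lambda>w. G w $ k $ q) z * dzbar j (\<lambda>w. G w $ p $ l) z)
    - (\<Sum>p\<in>UNIV. \<Sum>q\<in>UNIV. h z p q * dz k (\<lambda>w. G w $ i $ q) z * dzbar j (\<lambda>w. G w $ p $ l) z)
    = (\<Sum>p\<in>UNIV. \<Sum>q\<in>UNIV. h z p q * (dz i (\<lambda>w. G w $ k $ q) z - dz k (\<lambda>w. G w $ i $ q) z)
        * dzbar j (\<lambda>w. G w $ p $ l) z)"
    by (simp add: sum_subtractf algebra_simps)
  also have "\<dots> = dz i u z * (\<Sum>p\<in>UNIV. \<Sum>q\<in>UNIV. h z p q * G z $ k $ q * dzbar j (\<lambda>w. G w $ p $ l) z)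
    - dz k u z * (\<Sum>p\<in>UNIV. \<Sum>q\<in>UNIV. h z p q * G z $ i $ q * dzbar j (\<lambda>w. G w $ p $ l) z)"
    unfolding lck[OF z] by (simp add: sum_subtractf sum_distrib_left algebra_simps)
  finally show ?thesis using 1 unfolding chern_curvature_def con by algebra
qed

text \<open>The conjugate argument: \<open>dz i\<close> is applied to \<open>lck_bar\<close>, and
  \<open>h\<close> is contracted against \<open>G\<close> over the unbarred index.\<close>

lemma curvature_swap_antiholomorphic:
  assumes z: "z \<in> S"
  shows "chern_curvature G z i j k l + hess i j z * G z $ k $ l
    = chern_curvature G z i l k j + hess i l z * G z $ k $ j"
proof -
  have d: "f differentiable (at z)" if "smooth_on S f" for f :: "complex^'n \<Rightarrow> complex"
    using diff[OF that z] .
  have "dz i (\<lambda>w. dzbar j (\<lambda>w. G w $ k $ l) w - dzbar l (\<lambda>w. G w $ k $ j) w) z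
      = dz i (\<lambda>w. dzbar j u w * G w $ k $ l - dzbar l u w * G w $ k $ j) z"
    using lck_bar by (intro dz_cong_open[OF S z]) auto
  then have 1: "dz i (dzbar j (\<lambda>w. G w $ k $ l)) z - dz i (dzbar l (\<lambda>w. G w $ k $ j)) z
     = dzbar j u z * dz i (\<lambda>w. G w $ k $ l) z + hess i j z * G z $ k $ l
     - (dzbar l u z * dz i (\<lambda>w. G w $ k $ j) z + hess i l z * G z $ k $ j)"
    by (simp add: dz_diff dz_mult d smooth_rules)
  have con: "(\<Sum>p\<in>UNIV. \<Sum>q\<in>UNIV. h z p q * x q * G z $ p $ l) = x l" for l x
  proof -
    have "(\<Sum>p\<in>UNIV. \<Sum>q\<in>UNIV. h z p q * x q * G z $ p $ l)
      = (\<Sum>q\<in>UNIV. (\<Sum>p\<in>UNIV. h z p q * G z $ p $ l) * x q)"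
      by (subst sum.swap) (simp add: sum_distrib_right sum_distrib_left mult_ac)
    then show ?thesis
      unfolding inverse_metric_left[OF pd[OF z]] by (simp add: if_distrib if_distribR cong: if_cong)
  qed
  have "(\<Sum>p\<in>UNIV. \<Sum>q\<in>UNIV. h z p q * dz i (\<lambda>w. G w $ k $ q) z * dzbar j (\<lambda>w. G w $ p $ l) z)
    - (\<Sum>p\<in>UNIV. \<Sum>q\<in>UNIV. h z p q * dz i (\<lambda>w. G w $ k $ q) z * dzbar l (\<lambda>w. G w $ p $ j) z)
    = (\<Sum>p\<in>UNIV. \<Sum>q\<in>UNIV. h z p q * dz i (\<lambda>w. G w $ k $ q) z
        * (dzbar j (\<lambda>w. G w $ p $ l) z - dzbar l (\<lambda>w. G w $ p $ j) z))"
    by (simp add: sum_subtractf algebra_simps)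
  also have "\<dots> = dzbar j u z * (\<Sum>p\<in>UNIV. \<Sum>q\<in>UNIV. h z p q * dz i (\<lambda>w. G w $ k $ q) z * G z $ p $ l)
    - dzbar l u z * (\<Sum>p\<in>UNIV. \<Sum>q\<in>UNIV. h z p q * dz i (\<lambda>w. G w $ k $ q) z * G z $ p $ j)"
    unfolding lck_bar[OF z] by (simp add: sum_subtractf sum_distrib_left algebra_simps)
  finally show ?thesis using 1 unfolding chern_curvature_def con by algebra
qed

lemma dz_h:
  assumes z: "z \<in> S"
  shows "dz i (\<lambda>w. h w p l) z
    = - (\<Sum>k\<in>UNIV. \<Sum>q\<in>UNIV. h z p q * dz i (\<lambda>w. G w $ k $ q) z * h z k l)"
proof -
  have d: "f differentiable (at z)" if "smooth_on S f" for f :: "complex^'n \<Rightarrow> complex"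
    using diff[OF that z] .
  have "dz i (\<lambda>w. \<Sum>q\<in>UNIV. h w p q * G w $ k $ q) z = 0" for k
    using dz_cong_open[OF S z, of "\<lambda>w. \<Sum>q\<in>UNIV. h w p q * G w $ k $ q" "\<lambda>w. if k = p then 1 else 0" i]
      inverse_metric_right[OF pd] dz_const[of i "if k = p then 1 else 0" z] by simp
  then have "(\<Sum>q\<in>UNIV. dz i (\<lambda>w. h w p q) z * G z $ k $ q) = - (\<Sum>q\<in>UNIV. h z p q * dz i (\<lambda>w. G w $ k $ q) z)" for k
    by (simp add: dz_sum dz_mult d smooth_rules sum.distrib eq_neg_iff_add_eq_0 add.commute)
  then have "(\<Sum>k\<in>UNIV. (\<Sum>q\<in>UNIV. dz i (\<lambda>w. h w p q) z * G z $ k $ q) * h z k l)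
     = - (\<Sum>k\<in>UNIV. \<Sum>q\<in>UNIV. h z p q * dz i (\<lambda>w. G w $ k $ q) z * h z k l)"
    by (simp add: sum_distrib_right sum_negf)
  moreover have "(\<Sum>k\<in>UNIV. (\<Sum>q\<in>UNIV. dz i (\<lambda>w. h w p q) z * G z $ k $ q) * h z k l)
     = (\<Sum>q\<in>UNIV. dz i (\<lambda>w. h w p q) z * (\<Sum>k\<in>UNIV. h z k l * G z $ k $ q))"
    by (simp add: sum_distrib_right sum_distrib_left mult_ac) (subst sum.swap, simp)
  moreover have "\<dots> = dz i (\<lambda>w. h w p l) z"
    unfolding inverse_metric_left[OF pd[OF z]] by (simp add: if_distrib cong: if_cong)
  ultimately show ?thesis by simp
qed

text \<open>By Jacobi's formula the inner sum is \<open>dzbar j\<close> of log det \<open>G\<close>;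
  writing it as a contraction avoids the logarithm. The quadratic part of the curvature is the
  derivative of the inverse metric, by \<open>dz_h\<close>. The gain is that the Ricci tensor
  becomes a \<open>dz i\<close>-derivative, so that closedness is the commutation of two
  derivatives.\<close>

lemma chern_ricci_eq:
  assumes z: "z \<in> S"
  shows "chern_ricci G z i j = - dz i (\<lambda>w. \<Sum>k\<in>UNIV. \<Sum>l\<in>UNIV. h w k l * dzbar j (\<lambda>w. G w $ k $ l) w) z"
proof -
  have d: "f differentiable (at z)" if "smooth_on S f" for f :: "complex^'n \<Rightarrow> complex"
    using diff[OF that z] .
  have "(\<Sum>k\<in>UNIV. \<Sum>l\<in>UNIV. dz i (\<lambda>w. h w k l) z * dzbar j (\<lambda>w. G w $ k $ l) z)
    = - (\<Sum>p\<in>UNIV. \<Sum>l\<in>UNIV. \<Sum>k\<in>UNIV. \<Sum>q\<in>UNIV. h z p q * dz i (\<lambda>w. G w $ k $ q) z * h z k l * dzbar j (\<lambda>w. G w $ p $ l) z)"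
    unfolding dz_h[OF z] by (simp add: sum_distrib_right sum_negf)
  also have "(\<Sum>p\<in>UNIV. \<Sum>l\<in>UNIV. \<Sum>k\<in>UNIV. \<Sum>q\<in>UNIV. h z p q * dz i (\<lambda>w. G w $ k $ q) z * h z k l * dzbar j (\<lambda>w. G w $ p $ l) z)
    = (\<Sum>l\<in>UNIV. \<Sum>k\<in>UNIV. \<Sum>p\<in>UNIV. \<Sum>q\<in>UNIV. h z p q * dz i (\<lambda>w. G w $ k $ q) z * h z k l * dzbar j (\<lambda>w. G w $ p $ l) z)"
    by (subst sum.swap, rule sum.cong[OF refl], subst sum.swap, rule refl)
  also have "\<dots> = (\<Sum>k\<in>UNIV. \<Sum>l\<in>UNIV. \<Sum>p\<in>UNIV. \<Sum>q\<in>UNIV. h z k l * (h z p q * dz i (\<lambda>w. G w $ k $ q) z * dzbar j (\<lambda>w. G w $ p $ l) z))"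
    by (subst sum.swap) (simp add: mult_ac)
  finally have 1: "(\<Sum>k\<in>UNIV. \<Sum>l\<in>UNIV. dz i (\<lambda>w. h w k l) z * dzbar j (\<lambda>w. G w $ k $ l) z)
    = - (\<Sum>k\<in>UNIV. \<Sum>l\<in>UNIV. \<Sum>p\<in>UNIV. \<Sum>q\<in>UNIV. h z k l * (h z p q * dz i (\<lambda>w. G w $ k $ q) z * dzbar j (\<lambda>w. G w $ p $ l) z))" .
  have "dz i (\<lambda>w. \<Sum>k\<in>UNIV. \<Sum>l\<in>UNIV. h w k l * dzbar j (\<lambda>w. G w $ k $ l) w) z
    = (\<Sum>k\<in>UNIV. \<Sum>l\<in>UNIV. h z k l * dz i (dzbar j (\<lambda>w. G w $ k $ l)) z)
     + (\<Sum>k\<in>UNIV. \<Sum>l\<in>UNIV. dz i (\<lambda>w. h w k l) z * dzbar j (\<lambda>w. G w $ k $ l) z)"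
    by (simp add: dz_sum dz_mult d smooth_rules sum.distrib)
  then show ?thesis
    unfolding 1 chern_ricci_def chern_curvature_def
    by (simp add: sum_distrib_left right_diff_distrib sum_subtractf)
qed

lemma smooth_chern_ricci: "smooth_on S (\<lambda>z. chern_ricci G z i j)"
  unfolding chern_ricci_def chern_curvature_def
  by (intro smooth_rules smooth_on_minus[OF S])

lemma dz_chern_ricci_commute:
  assumes z: "z \<in> S"
  shows "dz k (\<lambda>w. chern_ricci G w i j) z = dz i (\<lambda>w. chern_ricci G w k j) z"
proof -
  define \<Gamma> where "\<Gamma> = (\<lambda>w. \<Sum>k\<in>UNIV. \<Sum>l\<in>UNIV. h w k l * dzbar j (\<lambda>w. G w $ k $ l) w)"
  have sm: "smooth_on S \<Gamma>" unfolding \<Gamma>_def by (intro smooth_rules)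
  have "dz k (\<lambda>w. chern_ricci G w i j) z = - dz k (dz i \<Gamma>) z" for i k
    using dz_cong_open[OF S z, of "\<lambda>w. chern_ricci G w i j" "\<lambda>w. - dz i \<Gamma> w" k] chern_ricci_eq
      dz_minus[OF diff[OF smooth_on_dz[OF S sm] z]] unfolding \<Gamma>_def by simp
  then show ?thesis using dz_dz_commute[OF sm S z] by simp
qed

end

text \<open>In complex dimension at least 2, contracting the torsion recovers the derivative of the conformal
  factor, which is therefore independent of the choice of the local Kaehler metric. (In dimension 1
  the denominator is zero.)\<close>

definition lee_form :: "(complex^'n \<Rightarrow> complex^'n^'n) \<Rightarrow> complex^'n \<Rightarrow> 'n \<Rightarrow> complex" where
  "lee_form G z k = (\<Sum>i\<in>UNIV. \<Sum>j\<in>UNIV. inverse_metric (G z) i j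
      * (dz k (\<lambda>w. G w $ i $ j) z - dz i (\<lambda>w. G w $ k $ j) z)) / (of_nat CARD('n) - 1)"

text \<open>In a chart this is the trace of the complex Hessian of \<open>u\<close>. The conjugate
  Lee form stands in for \<open>dzbar l u\<close>, so that only the metric enters and the function
  makes sense globally.\<close>

definition lee_divergence :: "(complex^'n \<Rightarrow> complex^'n^'n) \<Rightarrow> complex^'n \<Rightarrow> complex" where
  "lee_divergence G z = (\<Sum>k\<in>UNIV. \<Sum>l\<in>UNIV. inverse_metric (G z) k l * dz k (\<lambda>w. cnj (lee_form G w l)) z)"

lemma product_of_sesquilinear_sums:
  fixes a b :: "'n::finite \<Rightarrow> 'n \<Rightarrow> complex"
  shows "(\<Sum>i\<in>UNIV. \<Sum>j\<in>UNIV. a i j * X $ i * cnj (X $ j)) * (\<Sum>k\<in>UNIV. \<Sum>l\<in>UNIV. b k l * X $ k * cnj (X $ l))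
    = quartic_form (\<lambda>i j k l. a i j * b k l) X X X X"
  unfolding quartic_form_def sum_distrib_right by (simp add: sum_distrib_left mult_ac)

lemma frechet_derivative_exp:
  fixes f :: "'a::real_normed_vector \<Rightarrow> complex"
  assumes "f differentiable (at z)"
  shows "(\<lambda>w. exp (f w)) differentiable (at z)"
    and "frechet_derivative (\<lambda>w. exp (f w)) (at z) v = exp (f z) * frechet_derivative f (at z) v"
proof -
  have "((\<lambda>w. exp (f w)) has_derivative (\<lambda>v. exp (f z) * frechet_derivative f (at z) v)) (at z)"
    using assms has_derivative_compose[of f "frechet_derivative f (at z)" z UNIV exp "(*) (exp (f z))"]
      DERIV_exp[of "f z"] by (simp add: frechet_derivative_works has_field_derivative_def)
  then show "(\<lambda>w. exp (f w)) differentiable (at z)"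
    "frechet_derivative (\<lambda>w. exp (f w)) (at z) v = exp (f z) * frechet_derivative f (at z) v"
    using frechet_derivative_eqI differentiableI by blast+
qed

section \<open>The Lee form and its divergence in a chart\<close>

context lck_chart
begin

lemma contract_G: "z \<in> S \<Longrightarrow> (\<Sum>i\<in>UNIV. \<Sum>j\<in>UNIV. h z i j * G z $ i $ j) = of_nat CARD('n)"
  by (simp add: inverse_metric_right[OF pd])

lemma contract_G_left:
  assumes "z \<in> S"
  shows "(\<Sum>i\<in>UNIV. \<Sum>j\<in>UNIV. h z i j * (x i * G z $ k $ j)) = x k"
proof -
  have "(\<Sum>i\<in>UNIV. \<Sum>j\<in>UNIV. h z i j * (x i * G z $ k $ j))
      = (\<Sum>i\<in>UNIV. x i * (\<Sum>j\<in>UNIV. h z i j * G z $ k $ j))"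
    by (simp add: sum_distrib_left mult_ac)
  then show ?thesis unfolding inverse_metric_right[OF pd[OF assms]] by (simp add: if_distrib cong: if_cong)
qed

text \<open>Contracting the hypothesis with the inverse metric over \<open>i\<close> and
  \<open>j\<close> says that n times \<open>v k\<close> equals \<open>v k\<close>.\<close>

lemma proportional_covector_zero:
  assumes z: "z \<in> S" and n: "CARD('n) \<ge> 2"
    and v: "\<And>i j k. v k * G z $ i $ j = v i * G z $ k $ j"
  shows "v k = 0"
proof -
  have "(\<Sum>i\<in>UNIV. \<Sum>j\<in>UNIV. h z i j * (v k * G z $ i $ j)) = v k * of_nat CARD('n)"
    unfolding contract_G[OF z, symmetric] by (simp add: sum_distrib_left mult_ac)
  then have "v k * of_nat CARD('n) = v k" using contract_G_left[OF z, of v k] v by simp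
  then show ?thesis using n by auto
qed

lemma lee_form_eq:
  assumes z: "z \<in> S" and n: "CARD('n) \<ge> 2"
  shows "lee_form G z k = dz k u z"
proof -
  have "(\<Sum>i\<in>UNIV. \<Sum>j\<in>UNIV. h z i j * (dz k (\<lambda>w. G w $ i $ j) z - dz i (\<lambda>w. G w $ k $ j) z))
    = (\<Sum>i\<in>UNIV. \<Sum>j\<in>UNIV. h z i j * (dz k u z * G z $ i $ j)) - (\<Sum>i\<in>UNIV. \<Sum>j\<in>UNIV. h z i j * (dz i u z * G z $ k $ j))"
    unfolding lck[OF z] by (simp add: right_diff_distrib sum_subtractf)
  also have "(\<Sum>i\<in>UNIV. \<Sum>j\<in>UNIV. h z i j * (dz k u z * G z $ i $ j)) = dz k u z * of_nat CARD('n)"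
    unfolding contract_G[OF z, symmetric] by (simp add: sum_distrib_left mult_ac)
  finally have "lee_form G z k = dz k u z * (of_nat CARD('n) - 1) / (of_nat CARD('n) - 1)"
    unfolding lee_form_def contract_G_left[OF z, of "\<lambda>i. dz i u z"] by (simp add: algebra_simps)
  moreover have "(of_nat CARD('n) :: complex) \<noteq> 1"
    using n by (metis One_nat_def Suc_1 not_less_eq_eq of_nat_1 of_nat_eq_iff order_refl)
  ultimately show ?thesis by simp
qed

lemma lee_divergence_eq:
  assumes z: "z \<in> S" and n: "CARD('n) \<ge> 2"
  shows "lee_divergence G z = (\<Sum>k\<in>UNIV. \<Sum>l\<in>UNIV. h z k l * hess k l z)"
proof -
  have "dz k (\<lambda>w. cnj (lee_form G w l)) z = hess k l z" for k l
    by (rule dz_cong_open[OF S z]) (simp add: lee_form_eq n dzbar_u)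
  then show ?thesis by (simp add: lee_divergence_def)
qed

lemma hess_hermitian:
  assumes z: "z \<in> S"
  shows "cnj (hess i j z) = hess j i z"
proof -
  have "cnj (hess i j z) = dzbar i (\<lambda>w. cnj (dzbar j u w)) z"
    using dzbar_cnj[OF diff[OF smooth_on_dzbar[OF S u] z]] by simp
  also have "\<dots> = dzbar i (dz j u) z"
    by (rule dzbar_cong_open[OF S z]) (simp add: dzbar_u)
  finally show ?thesis using dz_dzbar_commute[OF u S z] by simp
qed

lemma lee_divergence_real:
  assumes z: "z \<in> S" and n: "CARD('n) \<ge> 2"
  shows "cnj (lee_divergence G z) = lee_divergence G z"
  unfolding lee_divergence_eq[OF z n]
  by (subst sum.swap) (simp add: hess_hermitian[OF z] inverse_metric_hermitian[OF pd[OF z]])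

lemma lee_divergence_nonneg_at_local_min:
  assumes z: "z \<in> S" and n: "CARD('n) \<ge> 2" and T: "open T" "z \<in> T" "T \<subseteq> S"
    and min: "\<And>w. w \<in> T \<Longrightarrow> Re (u z) \<le> Re (u w)"
  shows "0 \<le> Re (lee_divergence G z)"
proof -
  define f where "f w = Re (u w)" for w
  have f: "smooth_on T f" unfolding f_def
    by (rule smooth_on_linear[OF bounded_linear_Re T(1) smooth_on_subset[OF u T(3)]])
  have uf: "of_real (f w) = u w" if "w \<in> T" for w
  proof -
    have "cnj (u w) = u w" using u_real[of w] that T(3) by blast
    then have "Im (u w) = 0" by (simp add: complex_eq_iff)
    then show ?thesis unfolding f_def by (simp add: complex_eq_iff)
  qed
  have "dz i (dzbar j (\<lambda>w. complex_of_real (f w))) z = hess i j z" for i j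
    by (rule dz_cong_open[OF T(1,2) dzbar_cong_open[OF T(1)]]) (auto simp: uf)
  then have levi: "0 \<le> Re (\<Sum>i\<in>UNIV. \<Sum>j\<in>UNIV. hess i j z * X $ i * cnj (X $ j))" for X
    using levi_form_nonneg_at_local_min[OF f T(1,2), of X] min by (simp add: f_def)
  have "0 \<le> Re (\<Sum>k\<in>UNIV. \<Sum>l\<in>UNIV. h z k l * hess k l z)"
  proof (rule sum_hermitian_pd_mult_psd_nonneg)
    show "h z l k = cnj (h z k l)" for k l by (simp add: inverse_metric_hermitian[OF pd[OF z]])
  next
    fix Y :: "'n \<Rightarrow> complex" assume "\<exists>k\<in>UNIV. Y k \<noteq> 0"
    then have "(\<chi> k. Y k) \<noteq> 0" by (auto simp: vec_eq_iff)
    from inverse_metric_pos[OF pd[OF z] this]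
    show "0 < Re (\<Sum>k\<in>UNIV. \<Sum>l\<in>UNIV. h z k l * Y k * cnj (Y l))" by simp
  next
    \<comment> \<open>The pairing lemma asks for semidefiniteness on every finite index set, so
      \<open>v\<close> is extended by zero to all indices.\<close>
    fix I :: "'n set" and v :: "'n \<Rightarrow> complex"
    have "(\<Sum>i\<in>UNIV. \<Sum>j\<in>UNIV. hess i j z * (if i \<in> I then v i else 0) * cnj (if j \<in> I then v j else 0))
        = (\<Sum>i\<in>I. \<Sum>j\<in>I. hess i j z * v i * cnj (v j))"
    proof -
      have "(\<Sum>i\<in>UNIV. \<Sum>j\<in>UNIV. hess i j z * (if i \<in> I then v i else 0) * cnj (if j \<in> I then v j else 0))
        = (\<Sum>i\<in>UNIV. if i \<in> I then (\<Sum>j\<in>UNIV. if j \<in> I then hess i j z * v i * cnj (v j) else 0) else 0)"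
        by (intro sum.cong refl) (auto intro!: sum.cong)
      then show ?thesis by (simp add: sum.If_cases)
    qed
    then show "0 \<le> Re (\<Sum>i\<in>I. \<Sum>j\<in>I. hess i j z * v i * cnj (v j))"
      using levi[of "\<chi> i. if i \<in> I then v i else 0"] by simp
  qed simp
  then show ?thesis by (simp add: lee_divergence_eq[OF z n])
qed

lemma smooth_lee_divergence:
  assumes n: "CARD('n) \<ge> 2"
  shows "smooth_on S (lee_divergence G)"
proof -
  have "smooth_on S (\<lambda>z. \<Sum>k\<in>UNIV. \<Sum>l\<in>UNIV. h z k l * hess k l z)"
    by (intro smooth_rules)
  moreover have "smooth_on S (lee_divergence G) \<longleftrightarrow> smooth_on S (\<lambda>z. \<Sum>k\<in>UNIV. \<Sum>l\<in>UNIV. h z k l * hess k l z)"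
    by (rule smooth_on_cong[OF S]) (rule lee_divergence_eq[OF _ n])
  ultimately show ?thesis by blast
qed

end

section \<open>Constant mixed curvature in a chart\<close>

locale constant_mixed_chart = lck_chart S G u
  for S :: "(complex^'n::finite) set" and G u +
  fixes \<alpha> \<beta> c :: real
  assumes const: "\<And>z X. z \<in> S \<Longrightarrow> X \<noteq> 0 \<Longrightarrow> mixed_curvature \<alpha> \<beta> G z X = complex_of_real c"
    and n2: "CARD('n) \<ge> 2"
begin

abbreviation "aC \<equiv> complex_of_real \<alpha>"
abbreviation "bC \<equiv> complex_of_real \<beta>"
abbreviation "cC \<equiv> complex_of_real c"
abbreviation "D \<equiv> lee_divergence G"

text \<open>The factor of the metric in the polarised identity after one contraction. It contains
  the Chern scalar curvature, which \<open>mu_lee_divergence\<close> eliminates.\<close>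

definition mu :: "complex^'n \<Rightarrow> complex" where
  "mu z = 2 * cC * (of_nat CARD('n) + 1) + bC * D z
     - aC * (\<Sum>k\<in>UNIV. \<Sum>l\<in>UNIV. h z k l * chern_ricci G z k l)"

text \<open>Multiplying the curvature condition by the fourth power of the norm of \<open>X\<close>
  makes it a polynomial identity of bidegree (2,2), ready for polarisation.\<close>

lemma quartic_zero:
  assumes z: "z \<in> S"
  shows "quartic_form (\<lambda>i j k l. aC * chern_ricci G z i j * G z $ k $ l
      + bC * chern_curvature G z i j k l - cC * G z $ i $ j * G z $ k $ l) X X X X = 0"
proof (cases "X = 0")
  case True
  then show ?thesis by (simp add: quartic_form_def)
next
  case False
  have N0: "norm_sq (G z) X \<noteq> 0" using hermitian_pd_pos[OF pd[OF z] False] by auto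
  define R where "R = quartic_form (chern_curvature G z) X X X X"
  have "aC / norm_sq (G z) X * ricci_form_at G z X + bC * (R / (norm_sq (G z) X)\<^sup>2) = cC"
    using const[OF z False]
    by (simp add: mixed_curvature_def holomorphic_sectional_curvature_def R_def quartic_form_def)
  then have eq: "aC * (ricci_form_at G z X * norm_sq (G z) X) + bC * R
      - cC * (norm_sq (G z) X * norm_sq (G z) X) = 0"
    using N0 by (simp add: field_simps power2_eq_square)
  have "quartic_form (\<lambda>i j k l. aC * chern_ricci G z i j * G z $ k $ l
      + bC * chern_curvature G z i j k l - cC * G z $ i $ j * G z $ k $ l) X X X X
    = aC * quartic_form (\<lambda>i j k l. chern_ricci G z i j * G z $ k $ l) X X X X + bC * R
      - cC * quartic_form (\<lambda>i j k l. G z $ i $ j * G z $ k $ l) X X X X"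
    unfolding R_def quartic_form_def
    by (simp add: sum_distrib_left sum.distrib sum_subtractf algebra_simps)
  then show ?thesis
    using eq unfolding ricci_form_at_def norm_sq_def product_of_sesquilinear_sums by simp
qed

lemma
  assumes z: "z \<in> S"
  shows ricci_hess_eq: "(4 * bC + (of_nat CARD('n) + 2) * aC) * chern_ricci G z i j + (3 * of_nat CARD('n) - 2) * bC * hess i j z
      = mu z * G z $ i $ j"
    and ricci_hess_trace: "(4 * bC + (of_nat CARD('n) + 2) * aC) * (\<Sum>k\<in>UNIV. \<Sum>l\<in>UNIV. h z k l * chern_ricci G z k l)
        + (3 * of_nat CARD('n) - 2) * bC * D z = of_nat CARD('n) * mu z"
proof -
  note * = mixed_curvature_contraction[where g = "\<lambda>i j. G z $ i $ j" and h = "\<lambda>i j. h z i j"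
      and U = "\<lambda>i j. hess i j z" and Ric = "chern_ricci G z" and R = "chern_curvature G z"
      and \<alpha> = aC and \<beta> = bC and c = cC,
      OF inverse_metric_right[OF pd[OF z]] inverse_metric_left[OF pd[OF z]] chern_ricci_def
      curvature_swap_holomorphic[OF z] curvature_swap_antiholomorphic[OF z]
      quartic_form_polarisation[OF quartic_zero[OF z]]]
  show "(4 * bC + (of_nat CARD('n) + 2) * aC) * chern_ricci G z i j + (3 * of_nat CARD('n) - 2) * bC * hess i j z
      = mu z * G z $ i $ j"
    using *(1) unfolding mu_def lee_divergence_eq[OF z n2] .
  show "(4 * bC + (of_nat CARD('n) + 2) * aC) * (\<Sum>k\<in>UNIV. \<Sum>l\<in>UNIV. h z k l * chern_ricci G z k l)
        + (3 * of_nat CARD('n) - 2) * bC * D z = of_nat CARD('n) * mu z"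
    using *(2) unfolding mu_def lee_divergence_eq[OF z n2] .
qed

text \<open>Combining \<alpha> times the traced identity with (n+2)\<alpha> + 4\<beta> times the
  definition of \<open>mu\<close> cancels the Chern scalar curvature. Nothing is divided by \<alpha>
  or by the factor on the left, so degenerate parameters are covered.\<close>

lemma mu_lee_divergence:
  assumes z: "z \<in> S"
  shows "(2 * bC + (of_nat CARD('n) + 1) * aC) * mu z
    = cC * (of_nat CARD('n) + 1) * ((of_nat CARD('n) + 2) * aC + 4 * bC) + 2 * (of_nat CARD('n) * aC + bC) * bC * D z"
  using ricci_hess_trace[OF z] unfolding mu_def by algebra

lemma smooth_mu: "smooth_on S mu"
  unfolding mu_def[abs_def]
  by (intro smooth_rules smooth_lee_divergence[OF n2] smooth_chern_ricci)

text \<open>The Ricci form and the complex Hessian of \<open>u\<close> are closed. Differentiating the traced curvature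
  identity and antisymmetrising therefore shows that \<open>mu * exp u\<close> is locally constant.\<close>

lemma dz_mu:
  assumes z: "z \<in> S"
  shows "dz k mu z = - mu z * dz k u z"
proof -
  have d: "f differentiable (at z)" if "smooth_on S f" for f :: "complex^'n \<Rightarrow> complex"
    using diff[OF that z] .
  have "dz k (\<lambda>w. (4 * bC + (of_nat CARD('n) + 2) * aC) * chern_ricci G w i j + (3 * of_nat CARD('n) - 2) * bC * hess i j w) z
      = dz k (\<lambda>w. mu w * G w $ i $ j) z" for i j k
    by (rule dz_cong_open[OF S z]) (rule ricci_hess_eq)
  then have eq: "(4 * bC + (of_nat CARD('n) + 2) * aC) * dz k (\<lambda>w. chern_ricci G w i j) z
      + (3 * of_nat CARD('n) - 2) * bC * dz k (dz i (dzbar j u)) z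
      = mu z * dz k (\<lambda>w. G w $ i $ j) z + dz k mu z * G z $ i $ j" for i j k
    by (simp add: dz_add dz_mult dz_const d smooth_rules smooth_chern_ricci smooth_mu)
  have "(dz k mu z + mu z * dz k u z) * G z $ i $ j = (dz i mu z + mu z * dz i u z) * G z $ k $ j" for i j k
    using eq[of k i j] eq[of i k j] lck[OF z, of k i j] dz_chern_ricci_commute[OF z, of k i j]
      dz_dz_commute[OF smooth_on_dzbar[OF S u] S z, of k i j] by algebra
  from proportional_covector_zero[OF z n2, of "\<lambda>k. dz k mu z + mu z * dz k u z", OF this]
  have "dz k mu z + mu z * dz k u z = 0" .
  then show ?thesis by algebra
qed

text \<open>\<open>q\<close> is chosen so that \<open>mu_lee_divergence\<close> reads (2\<beta> +
  (n+1)\<alpha>) mu = 2(n\<alpha> + \<beta>)\<beta> (D - q). Together with \<open>dz_mu\<close> this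
  makes the derivative of \<open>D\<close> equal to -(D - q) times that of \<open>u\<close>. The
  ball supplies the connectedness that turns a zero derivative into constancy.\<close>

lemma lee_divergence_times_exp_constant:
  fixes q :: real
  assumes ab: "real CARD('n) * \<alpha> + \<beta> \<noteq> 0" "\<beta> \<noteq> 0"
    and q: "q = - c * (real CARD('n) + 1) * ((real CARD('n) + 2) * \<alpha> + 4 * \<beta>)
        / (2 * (real CARD('n) * \<alpha> + \<beta>) * \<beta>)"
    and ball: "ball z r \<subseteq> S" "w \<in> ball z r"
  shows "(D w - of_real q) * exp (u w) = (D z - of_real q) * exp (u z)"
proof -
  let ?Q = "2 * (of_nat CARD('n) * aC + bC) * bC"
  have "?Q = complex_of_real (2 * (real CARD('n) * \<alpha> + \<beta>) * \<beta>)" by simp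
  then have Q0: "?Q \<noteq> 0" using ab by (metis mult_eq_0_iff of_real_eq_0_iff zero_neq_numeral)
  have "2 * (real CARD('n) * \<alpha> + \<beta>) * \<beta> * q
      = - c * (real CARD('n) + 1) * ((real CARD('n) + 2) * \<alpha> + 4 * \<beta>)"
    unfolding q using ab by simp
  from arg_cong[OF this, of complex_of_real]
  have Qq: "?Q * of_real q = - (cC * (of_nat CARD('n) + 1) * ((of_nat CARD('n) + 2) * aC + 4 * bC))" by simp
  define E where "E = (\<lambda>w. (D w - of_real q) * exp (u w))"
  have zero: "frechet_derivative E (at y) v = 0" and dE: "E differentiable (at y)" if y: "y \<in> S" for y v
  proof -
    have dD: "D differentiable (at y)" and du: "u differentiable (at y)" and dm: "mu differentiable (at y)"
      using diff[OF smooth_lee_divergence[OF n2] y] diff[OF u y] diff[OF smooth_mu y] by auto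
    have dq: "(\<lambda>w. D w - of_real q) differentiable (at y)" using dD by simp
    note ex = frechet_derivative_exp[OF du]
    show dE: "E differentiable (at y)" unfolding E_def using dq ex(1) by simp
    have dzE: "dz k E y = 0" for k
    proof -
      have "dz k (\<lambda>w. ?Q * D w) y = dz k (\<lambda>w. (2 * bC + (of_nat CARD('n) + 1) * aC) * mu w - cC * (of_nat CARD('n) + 1) * ((of_nat CARD('n) + 2) * aC + 4 * bC)) y"
        by (rule dz_cong_open[OF S y]) (simp add: mu_lee_divergence)
      then have "?Q * dz k D y = (2 * bC + (of_nat CARD('n) + 1) * aC) * dz k mu y"
        using dD dm by (simp only: dz_cmult dz_diff dz_const differentiable_mult differentiable_const) simp
      then have "?Q * dz k D y = - (?Q * (D y - of_real q)) * dz k u y"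
        unfolding dz_mu[OF y] using mu_lee_divergence[OF y] Qq by algebra
      then have "?Q * (dz k D y + (D y - of_real q) * dz k u y) = 0" by algebra
      then have *: "dz k D y + (D y - of_real q) * dz k u y = 0" using Q0 by simp
      have "dz k (\<lambda>w. exp (u w)) y = exp (u y) * dz k u y"
        unfolding dz_def ex(2) by (simp add: algebra_simps)
      then have "dz k E y = (D y - of_real q) * (exp (u y) * dz k u y) + dz k D y * exp (u y)"
        unfolding E_def using dz_mult[OF dq ex(1), of k] dz_diff[OF dD, of "\<lambda>w. of_real q" k]
        by (simp add: dz_const)
      then show ?thesis using * by algebra
    qed
    \<comment> \<open>\<open>E\<close> is real-valued, so its antiholomorphic derivatives vanish
      with the holomorphic ones.\<close>
    have "dzbar k E y = cnj (dz k E y)" for k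
    proof -
      have "dzbar k E y = dzbar k (\<lambda>w. cnj (E w)) y"
        by (rule dzbar_cong_open[OF S y])
          (simp add: E_def lee_divergence_real n2 exp_cnj u_real)
      then show ?thesis by (simp add: dzbar_cnj[OF dE])
    qed
    then show "frechet_derivative E (at y) v = 0"
      by (simp add: frechet_derivative_eq_dz_dzbar[OF dE] dzE)
  qed
  have "(E has_derivative (\<lambda>v. 0)) (at y within ball z r)" if "y \<in> ball z r" for y
  proof -
    have "y \<in> S" using that ball by blast
    moreover have "frechet_derivative E (at y) = (\<lambda>v. 0)" using zero[OF \<open>y \<in> S\<close>] by auto
    ultimately show ?thesis
      using dE by (metis frechet_derivative_works has_derivative_at_withinI)
  qed
  from has_derivative_zero_constant[OF convex_ball this]
  obtain k where "\<forall>x\<in>ball z r. E x = k" by blast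
  moreover have "z \<in> ball z r" using ball(2) by (metis centre_in_ball empty_iff ball_eq_empty not_le)
  ultimately show ?thesis using ball(2) unfolding E_def by metis
qed

lemma lee_divergence_nonneg_at_min:
  fixes q :: real
  assumes ab: "real CARD('n) * \<alpha> + \<beta> \<noteq> 0" "\<beta> \<noteq> 0"
    and q: "q = - c * (real CARD('n) + 1) * ((real CARD('n) + 2) * \<alpha> + 4 * \<beta>)
        / (2 * (real CARD('n) * \<alpha> + \<beta>) * \<beta>)" "q \<ge> 0"
    and z: "z \<in> S" and min: "\<And>w. w \<in> S \<Longrightarrow> Re (D z) \<le> Re (D w)"
  shows "0 \<le> Re (D z)"
proof (rule ccontr)
  assume neg: "\<not> 0 \<le> Re (D z)"
  obtain r where r: "r > 0" "ball z r \<subseteq> S" using S z openE by blast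
  have ureal: "u w = of_real (Re (u w))" if "w \<in> S" for w
    using u_real[OF that] by (simp add: complex_eq_iff)
  have Dreal: "D w = of_real (Re (D w))" if "w \<in> S" for w
    using lee_divergence_real[OF that n2] by (simp add: complex_eq_iff)
  \<comment> \<open>\<open>D - q\<close> is a negative constant times \<open>exp (- u)\<close> near \<open>z\<close>, so \<open>u\<close> has a local minimum at \<open>z\<close>.\<close>
  have "Re (u z) \<le> Re (u w)" if w: "w \<in> ball z r" for w
  proof -
    have wS: "w \<in> S" using w r by blast
    have "complex_of_real ((Re (D w) - q) * exp (Re (u w))) = (D w - of_real q) * exp (u w)"
      by (subst Dreal[OF wS], subst ureal[OF wS]) (simp add: exp_of_real)
    also have "\<dots> = (D z - of_real q) * exp (u z)"
      by (rule lee_divergence_times_exp_constant[OF ab q(1) r(2) w])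
    also have "\<dots> = complex_of_real ((Re (D z) - q) * exp (Re (u z)))"
      by (subst Dreal[OF z], subst ureal[OF z]) (simp add: exp_of_real)
    finally have eq: "(Re (D w) - q) * exp (Re (u w)) = (Re (D z) - q) * exp (Re (u z))"
      by (simp only: of_real_eq_iff)
    have "(q - Re (D w)) * exp (Re (u w)) \<le> (q - Re (D z)) * exp (Re (u w))"
      using min[OF wS] by (intro mult_right_mono) auto
    moreover have "(q - Re (D w)) * exp (Re (u w)) = (q - Re (D z)) * exp (Re (u z))"
      using eq by (simp add: algebra_simps)
    ultimately have "(q - Re (D z)) * exp (Re (u z)) \<le> (q - Re (D z)) * exp (Re (u w))"
      by (simp only:)
    moreover have "q - Re (D z) > 0" using neg q(2) by simp
    ultimately show ?thesis by simp
  qed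
  then have "0 \<le> Re (D z)"
    using r z by (intro lee_divergence_nonneg_at_local_min[OF z n2, of "ball z r"]) auto
  with neg show False by simp
qed

end

section \<open>Determinants of real-linear maps\<close>

text \<open>\<open>Basis\<close> is a bare set; enumerating it by a type of the right size turns
  endomorphisms into square matrices that have a determinant.\<close>

definition basis_enum :: "'m::finite \<Rightarrow> 'v::euclidean_space" where
  "basis_enum = (SOME e. bij_betw e UNIV Basis)"

definition real_matrix :: "('v::euclidean_space \<Rightarrow> 'v) \<Rightarrow> real^'m^'m" where
  "real_matrix L = (\<chi> i j. L (basis_enum j) \<bullet> basis_enum i)"

lemma bij_basis_enum:
  assumes "CARD('m::finite) = DIM('v::euclidean_space)"
  shows "bij_betw (basis_enum :: 'm \<Rightarrow> 'v) UNIV Basis"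
proof -
  have "\<exists>e :: 'm \<Rightarrow> 'v. bij_betw e UNIV Basis"
    using assms by (intro finite_same_card_bij) auto
  then show ?thesis unfolding basis_enum_def by (rule someI_ex)
qed

lemma sum_basis_enum:
  assumes "CARD('m::finite) = DIM('v::euclidean_space)"
  shows "(\<Sum>i\<in>UNIV. f (basis_enum (i::'m) :: 'v)) = (\<Sum>b\<in>Basis. f b)"
  using sum.reindex_bij_betw[OF bij_basis_enum[OF assms], of f] .

lemma basis_enum_inner:
  assumes "CARD('m::finite) = DIM('v::euclidean_space)"
  shows "(basis_enum (i::'m) :: 'v) \<bullet> basis_enum j = (if i = j then 1 else 0)"
proof -
  have "(basis_enum i :: 'v) \<in> Basis" "(basis_enum j :: 'v) \<in> Basis"
    "(basis_enum i :: 'v) = basis_enum j \<longleftrightarrow> i = j"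
    using bij_basis_enum[OF assms] by (auto simp: bij_betw_def inj_on_def)
  then show ?thesis by (simp add: inner_Basis)
qed

lemma real_matrix_compose:
  fixes L M :: "'v::euclidean_space \<Rightarrow> 'v"
  assumes card: "CARD('m::finite) = DIM('v)" and L: "linear L"
  shows "(real_matrix (\<lambda>x. L (M x)) :: real^'m^'m) = real_matrix L ** real_matrix M"
proof -
  have "L (M (basis_enum j)) \<bullet> basis_enum i = (\<Sum>k\<in>UNIV. (L (basis_enum (k::'m)) \<bullet> basis_enum i)
      * (M (basis_enum j) \<bullet> basis_enum k))" for i j :: 'm
  proof -
    have "L (M (basis_enum j)) = L (\<Sum>b\<in>Basis. (M (basis_enum j) \<bullet> b) *\<^sub>R b)"
      by (simp add: euclidean_representation)
    also have "\<dots> = (\<Sum>b\<in>Basis. (M (basis_enum j) \<bullet> b) *\<^sub>R L b)"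
      by (simp add: linear_sum[OF L] linear_cmul[OF L])
    finally show ?thesis
      unfolding sum_basis_enum[OF card, of "\<lambda>b. (L b \<bullet> basis_enum i) * (M (basis_enum j) \<bullet> b)"]
      by (simp add: inner_sum_left mult.commute)
  qed
  then show ?thesis by (simp add: real_matrix_def matrix_matrix_mult_def vec_eq_iff)
qed

lemma real_matrix_id:
  assumes "CARD('m::finite) = DIM('v::euclidean_space)"
  shows "(real_matrix (\<lambda>x::'v. x) :: real^'m^'m) = mat 1"
  by (simp add: real_matrix_def mat_def vec_eq_iff basis_enum_inner[OF assms])

lemma trace_real_matrix:
  fixes L :: "'v::euclidean_space \<Rightarrow> 'v"
  assumes "CARD('m::finite) = DIM('v)"
  shows "trace (real_matrix L :: real^'m^'m) = (\<Sum>b\<in>Basis. L b \<bullet> b)"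
  using sum_basis_enum[OF assms, of "\<lambda>b. L b \<bullet> b"] by (simp add: trace_def real_matrix_def)

lemma real_matrix_adjoint:
  assumes "\<And>x y. L x \<bullet> y = x \<bullet> L' y"
  shows "real_matrix L' = transpose (real_matrix L)"
  by (simp add: real_matrix_def transpose_def vec_eq_iff assms) (simp add: inner_commute)

text \<open>A permutation other than the identity moves at least two indices. Differentiating one
  factor of its Leibniz product at the identity matrix leaves a vanishing off-diagonal factor at
  another moved index, so only the identity permutation contributes, and it gives the trace.\<close>

lemma has_derivative_det_at_mat_1:
  "((\<lambda>X::real^'m^'m. det X) has_derivative trace) (at (mat 1))"
proof -
  have "((\<lambda>X::real^'m^'m. \<Sum>p\<in>{p. p permutes (UNIV::'m set)}. of_int (sign p) * (\<Prod>i\<in>UNIV. X $ i $ p i))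
      has_derivative (\<lambda>E. \<Sum>p\<in>{p. p permutes (UNIV::'m set)}. of_int (sign p) *
        (\<Sum>i\<in>UNIV. E $ i $ p i * (\<Prod>j\<in>UNIV - {i}. mat 1 $ j $ p j)))) (at (mat 1))"
    by (intro has_derivative_sum has_derivative_mult_right has_derivative_prod
        bounded_linear_imp_has_derivative bounded_linear_compose[OF bounded_linear_vec_nth bounded_linear_vec_nth])
  moreover have "(\<Sum>p\<in>{p. p permutes (UNIV::'m set)}. of_int (sign p) *
        (\<Sum>i\<in>UNIV. E $ i $ p i * (\<Prod>j\<in>UNIV - {i}. mat 1 $ j $ p j))) = trace E" for E :: "real^'m^'m"
  proof -
    have prod0: "(\<Prod>j\<in>UNIV - {i}. (mat 1 :: real^'m^'m) $ j $ p j) = 0"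
      if p: "p permutes UNIV" "p \<noteq> id" for p i
    proof -
      have "\<exists>j. j \<noteq> i \<and> p j \<noteq> j"
      proof (rule ccontr)
        assume "\<not> ?thesis"
        then have fixed: "p j = j" if "j \<noteq> i" for j using that by auto
        have "p i = i"
        proof (rule ccontr)
          assume "p i \<noteq> i"
          then have "p (p i) = p i" using fixed by auto
          then show False using permutes_inj[OF p(1)] \<open>p i \<noteq> i\<close> by (auto dest: injD)
        qed
        then have "p x = x" for x using fixed by (cases "x = i") auto
        then have "p = id" by auto
        then show False using p by simp
      qed
      then obtain j where j: "j \<noteq> i" "p j \<noteq> j" by blast
      then show ?thesis by (intro prod_zero bexI[of _ j]) (auto simp: mat_def)
    qed
    have "of_int (sign p) * (\<Sum>i\<in>UNIV. E $ i $ p i * (\<Prod>j\<in>UNIV - {i}. (mat 1 :: real^'m^'m) $ j $ p j)) = 0"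
      if "p \<in> {p. p permutes (UNIV::'m set)} - {id}" for p
    proof -
      have "p permutes UNIV" "p \<noteq> id" using that by auto
      note p0 = prod0[OF this]
      have "(\<Sum>i\<in>UNIV. E $ i $ p i * (\<Prod>j\<in>UNIV - {i}. (mat 1 :: real^'m^'m) $ j $ p j)) = 0"
        by (rule sum.neutral, rule ballI, subst p0) simp
      then show ?thesis by simp
    qed
    then have "(\<Sum>p\<in>{p. p permutes (UNIV::'m set)}. of_int (sign p) *
        (\<Sum>i\<in>UNIV. E $ i $ p i * (\<Prod>j\<in>UNIV - {i}. mat 1 $ j $ p j)))
      = (\<Sum>p\<in>{id}. of_int (sign p) *
        (\<Sum>i\<in>UNIV. E $ i $ p i * (\<Prod>j\<in>UNIV - {i}. (mat 1 :: real^'m^'m) $ j $ p j)))"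
      by (intro sum.mono_neutral_right ballI)
        (simp_all only: finite_permutations finite permutes_id insert_subset empty_subsetI mem_Collect_eq simp_thms)
    then show ?thesis by (simp add: trace_def mat_def sign_id)
  qed
  ultimately show ?thesis unfolding det_def[abs_def] by simp
qed

text \<open>Jacobi's formula, reduced to the identity matrix by writing the determinant of
  \<open>B w\<close> as that of \<open>B z\<close> times that of \<open>C ** B w\<close>.\<close>

lemma has_derivative_det:
  fixes B :: "'a::real_normed_vector \<Rightarrow> real^'m^'m"
  assumes B: "(B has_derivative B') (at z)" and inv: "C ** B z = mat 1" "B z ** C = mat 1"
  shows "((\<lambda>w. det (B w)) has_derivative (\<lambda>v. det (B z) * trace (C ** B' v))) (at z)"
proof -
  have bl: "bounded_linear (\<lambda>X. C ** X)"
    by (rule linear_conv_bounded_linear[THEN iffD1], rule linearI)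
       (simp_all add: matrix_add_ldistrib scalar_matrix_assoc matrix_scalar_ac vec_eq_iff matrix_matrix_mult_def sum_distrib_left mult_ac distrib_left sum.distrib)
  have "((\<lambda>w. C ** B w) has_derivative (\<lambda>v. C ** B' v)) (at z)"
    by (rule bounded_linear.has_derivative[OF bl B])
  moreover have "((\<lambda>X::real^'m^'m. det X) has_derivative trace) (at (C ** B z))"
    unfolding inv by (rule has_derivative_det_at_mat_1)
  ultimately have "((\<lambda>w. det (C ** B w)) has_derivative (\<lambda>v. trace (C ** B' v))) (at z)"
    by (rule has_derivative_compose)
  then have "((\<lambda>w. det (B z) * det (C ** B w)) has_derivative (\<lambda>v. det (B z) * trace (C ** B' v))) (at z)"
    by (rule has_derivative_mult_right)
  moreover have "det (B z) * det (C ** B w) = det (B w)" for w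
    by (metis det_mul inv(2) matrix_mul_assoc matrix_mul_lid)
  ultimately show ?thesis by simp
qed

section \<open>The volume density of a Hermitian metric\<close>

lemma card_bit0_eq_DIM: "CARD('n::finite bit0) = DIM(complex^'n)"
  by simp

text \<open>The index type \<open>'n bit0\<close> has \<open>2 * CARD('n)\<close> elements and is well-ordered, as the library's
  change-of-variables theorem requires. The real determinant of a metric is the square of its
  complex determinant, so the density below is the determinant of the metric; the square inside
  the fourth root makes the choice of a sign unnecessary.\<close>

definition real_det :: "complex^'n^'n \<Rightarrow> real" where
  "real_det M = det (real_matrix (\<lambda>v. M *v v) :: real^('n bit0)^('n bit0))"

definition vol_density :: "complex^'n^'n \<Rightarrow> real" where
  "vol_density M = ((real_det M)\<^sup>2) powr (1/4)"

lemma real_linear_matrix_vector_mult: "linear (\<lambda>v::complex^'n. (M::complex^'n^'m) *v v)"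
  by (rule linearI) (simp_all add: vec_eq_iff matrix_vector_mult_def distrib_left sum.distrib
      scaleR_sum_right)

lemma real_det_mult: "real_det (M ** M') = real_det M * real_det M'"
  unfolding real_det_def matrix_vector_mul_assoc[symmetric]
  by (subst real_matrix_compose[OF card_bit0_eq_DIM real_linear_matrix_vector_mult]) (rule det_mul)

text \<open>Conjugating the entries of \<open>M\<close> amounts to conjugating the map by the
  real-linear involution \<open>K\<close>, whose determinant has square 1.\<close>

lemma real_det_conjugate:
  fixes M :: "complex^'n^'n"
  shows "real_det (\<chi> i j. cnj (M $ i $ j)) = real_det M"
proof -
  define K :: "complex^'n \<Rightarrow> complex^'n" where "K v = (\<chi> i. cnj (v $ i))" for v
  have K: "linear K" by (rule linearI) (simp_all add: K_def vec_eq_iff)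
  let ?k = "real_matrix K :: real^('n bit0)^('n bit0)"
  let ?m = "real_matrix (\<lambda>v. M *v v) :: real^('n bit0)^('n bit0)"
  have KK: "K (K v) = v" for v by (simp add: K_def vec_eq_iff)
  have "?k ** ?k = mat 1"
    using real_matrix_compose[OF card_bit0_eq_DIM K, of K, symmetric]
    by (simp add: KK real_matrix_id[OF card_bit0_eq_DIM])
  then have kk: "det ?k * det ?k = 1" by (metis det_I det_mul)
  have "(\<lambda>v. (\<chi> i j. cnj (M $ i $ j)) *v v) = (\<lambda>v. K (M *v K v))"
    by (simp add: fun_eq_iff K_def vec_eq_iff matrix_vector_mult_def)
  then have "real_det (\<chi> i j. cnj (M $ i $ j)) = det (?k ** (?m ** ?k))"
    unfolding real_det_def
    using real_matrix_compose[OF card_bit0_eq_DIM K, of "\<lambda>v. M *v K v"]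
      real_matrix_compose[OF card_bit0_eq_DIM real_linear_matrix_vector_mult, of M K] by simp
  also have "\<dots> = (det ?k * det ?k) * real_det M"
    unfolding det_mul real_det_def by (simp only: mult_ac)
  finally show ?thesis by (simp add: kk)
qed

text \<open>The conjugate transpose is the adjoint for the real inner product, so its real matrix is
  the transpose.\<close>

lemma real_det_adjoint:
  fixes M :: "complex^'n^'n"
  shows "real_det (\<chi> i j. cnj (M $ j $ i)) = real_det M"
proof -
  have "(M *v x) \<bullet> y = x \<bullet> ((\<chi> i j. cnj (M $ j $ i)) *v y)" for x y
  proof -
    have in_eq: "a \<bullet> b = Re (a * cnj b)" for a b :: complex by (simp add: inner_complex_def)
    have "(M *v x) \<bullet> y = Re (\<Sum>i\<in>UNIV. \<Sum>j\<in>UNIV. M $ i $ j * x $ j * cnj (y $ i))"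
      by (simp add: inner_vec_def in_eq matrix_vector_mult_def sum_distrib_right)
    also have "\<dots> = Re (\<Sum>j\<in>UNIV. \<Sum>i\<in>UNIV. M $ i $ j * x $ j * cnj (y $ i))"
      by (subst sum.swap) simp
    also have "\<dots> = x \<bullet> ((\<chi> i j. cnj (M $ j $ i)) *v y)"
      by (simp add: inner_vec_def in_eq matrix_vector_mult_def sum_distrib_left mult_ac)
    finally show ?thesis .
  qed
  then have "real_matrix (\<lambda>v. (\<chi> i j. cnj (M $ j $ i)) *v v)
      = transpose (real_matrix (\<lambda>v. M *v v) :: real^('n bit0)^('n bit0))"
    by (rule real_matrix_adjoint)
  then show ?thesis unfolding real_det_def by (simp add: det_transpose)
qed

text \<open>\<open>M'\<close> is the transpose of \<open>A\<close> times \<open>M\<close> times the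
  conjugate of \<open>A\<close>, hence \<open>real_det\<close> changes by the square of
  \<open>real_det A\<close>. Squaring and taking the fourth root leaves the absolute value, which is
  the Jacobian factor of a real change of variables.\<close>

lemma vol_density_pullback:
  fixes M :: "complex^'n^'n" and A :: "complex^'n^'n"
  assumes "\<And>i j. M' $ i $ j = (\<Sum>k\<in>UNIV. \<Sum>l\<in>UNIV. M $ k $ l * A $ k $ i * cnj (A $ l $ j))"
  shows "vol_density M' = vol_density M * \<bar>real_det A\<bar>"
proof -
  let ?cA = "(\<chi> i j. cnj (A $ i $ j)) :: complex^'n^'n"
  let ?tA = "(\<chi> i j. cnj (?cA $ j $ i)) :: complex^'n^'n"
  have "M' = ?tA ** (M ** ?cA)"
    by (simp add: vec_eq_iff assms matrix_matrix_mult_def sum_distrib_left mult_ac)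
  then have "real_det M' = real_det A * real_det M * real_det A"
    by (simp only: real_det_mult real_det_adjoint real_det_conjugate mult_ac)
  then have "(real_det M')\<^sup>2 = (real_det M)\<^sup>2 * (\<bar>real_det A\<bar> ^ 4)"
    by (simp add: power2_eq_square power4_eq_xxxx)
  moreover have "(\<bar>real_det A\<bar> ^ 4) powr (1/4) = \<bar>real_det A\<bar>"
    by (simp add: powr_powr flip: powr_numeral)
  ultimately show ?thesis by (simp add: vol_density_def powr_mult)
qed

text \<open>A diagonal entry m contributes Re m in each of the two real directions 1 and
  \<i>.\<close>

lemma trace_real_matrix_complex:
  fixes M :: "complex^'n^'n"
  shows "trace (real_matrix (\<lambda>v. M *v v) :: real^('n bit0)^('n bit0)) = 2 * Re (trace M)"
proof -
  have "trace (real_matrix (\<lambda>v. M *v v) :: real^('n bit0)^('n bit0)) = (\<Sum>b\<in>Basis. (M *v b) \<bullet> b)"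
    by (rule trace_real_matrix[OF card_bit0_eq_DIM])
  also have "\<dots> = (\<Sum>i\<in>UNIV. (M *v axis i 1) \<bullet> axis i 1 + (M *v axis i \<i>) \<bullet> axis i \<i>)"
  proof -
    have B: "(Basis :: (complex^'n) set) = (\<Union>i\<in>UNIV. {axis i 1, axis i \<i>})"
      by (auto simp: Basis_vec_def Basis_complex_def)
    have ne: "axis i 1 \<noteq> (axis i \<i> :: complex^'n)" for i by (simp add: axis_eq_axis)
    show ?thesis unfolding B
      by (subst sum.UNION_disjoint) (auto simp: ne axis_eq_axis)
  qed
  also have "\<dots> = (\<Sum>i\<in>UNIV. 2 * Re (M $ i $ i))"
  proof -
    have "(M *v axis i a) $ i = M $ i $ i * a" for i a
      by (simp add: matrix_vector_mult_def axis_def if_distrib cong: if_cong)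
    then show ?thesis by (simp add: inner_axis inner_complex_def)
  qed
  finally show ?thesis by (simp add: trace_def sum_distrib_left)
qed

context lck_chart
begin

lemma
  assumes z: "z \<in> S"
  shows vol_density_pos: "vol_density (G z) > 0"
    and vol_density_differentiable: "(\<lambda>w. complex_of_real (vol_density (G w))) differentiable (at z)"
    and dz_vol_density: "dz k (\<lambda>w. complex_of_real (vol_density (G w))) z
      = of_real (vol_density (G z)) * (\<Sum>i\<in>UNIV. \<Sum>j\<in>UNIV. h z i j * dz k (\<lambda>w. G w $ i $ j) z)"
proof -
  define B where "B M = (real_matrix (\<lambda>v. M *v v) :: real^('n bit0)^('n bit0))" for M :: "complex^'n^'n"
  note inv = matrix_inv_inverse[OF hermitian_pd_det_nonzero[OF pd[OF z]]]
  have Bmult: "B (M ** M') = B M ** B M'" for M M'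
    unfolding B_def matrix_vector_mul_assoc[symmetric]
    by (rule real_matrix_compose[OF card_bit0_eq_DIM real_linear_matrix_vector_mult])
  have B1: "B (mat 1) = mat 1"
    by (simp add: B_def matrix_vector_mul_lid real_matrix_id)
  have invB: "B (matrix_inv (G z)) ** B (G z) = mat 1" "B (G z) ** B (matrix_inv (G z)) = mat 1"
    unfolding Bmult[symmetric] inv B1 by auto
  have detB: "det (B (G z)) \<noteq> 0"
    using invB by (metis det_I det_mul mult_zero_right zero_neq_one)
  then have pos: "(real_det (G z))\<^sup>2 > 0" by (simp add: real_det_def B_def)
  show vp: "vol_density (G z) > 0" using pos by (simp add: vol_density_def)
  define G' where "G' = frechet_derivative G (at z)"
  have dG: "(G has_derivative G') (at z)"
    using smooth_on_imp_differentiable[OF G z] unfolding G'_def frechet_derivative_works .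
  have sc: "(r *\<^sub>R M) *v x = r *\<^sub>R (M *v x)" for r and M :: "complex^'n^'n" and x
    by (simp add: vec_eq_iff matrix_vector_mult_def scaleR_sum_right)
  have "linear B"
    by (rule linearI) (simp_all add: B_def real_matrix_def vec_eq_iff matrix_vector_mult_add_rdistrib
        inner_add_left sc)
  then have "((\<lambda>w. B (G w)) has_derivative (\<lambda>v. B (G' v))) (at z)"
    by (intro bounded_linear.has_derivative[OF _ dG]) (simp add: linear_conv_bounded_linear)
  from has_derivative_det[OF this invB]
  have dd: "((\<lambda>w. real_det (G w)) has_derivative
      (\<lambda>v. real_det (G z) * trace (B (matrix_inv (G z)) ** B (G' v)))) (at z)"
    by (simp add: real_det_def B_def)
  define tr where "tr v = Re (\<Sum>i\<in>UNIV. \<Sum>j\<in>UNIV. h z i j * G' v $ i $ j)" for v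
  have tr: "trace (B (matrix_inv (G z)) ** B (G' v)) = 2 * tr v" for v
    unfolding Bmult[symmetric] unfolding B_def trace_real_matrix_complex tr_def
    by (subst sum.swap) (simp add: trace_def matrix_matrix_mult_def inverse_metric_def)
  have "((\<lambda>w. ((real_det (G w))\<^sup>2) powr (1/4)) has_derivative
      (\<lambda>v. vol_density (G z) * tr v)) (at z)"
  proof -
    have d2: "((\<lambda>w. (real_det (G w))\<^sup>2) has_derivative (\<lambda>v. 4 * (real_det (G z))\<^sup>2 * tr v)) (at z)"
      using has_derivative_power[OF dd[unfolded tr], of 2] by (simp add: power2_eq_square mult_ac)
    have "((\<lambda>x. x powr (1/4)) has_real_derivative (1/4) * ((real_det (G z))\<^sup>2) powr (1/4 - 1)) (at ((real_det (G z))\<^sup>2))"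
      by (rule has_real_derivative_powr[OF pos])
    then have d1: "((\<lambda>x. x powr (1/4)) has_derivative (*) ((1/4) * ((real_det (G z))\<^sup>2) powr (1/4 - 1))) (at ((real_det (G z))\<^sup>2))"
      by (simp add: has_field_derivative_def)
    have teq: "(1/4) * ((real_det (G z))\<^sup>2) powr (1/4 - 1) * (4 * (real_det (G z))\<^sup>2 * t)
        = vol_density (G z) * t" for t
    proof -
      have "((real_det (G z))\<^sup>2) powr (1/4 - 1) = vol_density (G z) / (real_det (G z))\<^sup>2"
        using powr_diff[of "(real_det (G z))\<^sup>2" "1/4" 1] powr_one[of "(real_det (G z))\<^sup>2"] pos
        by (simp add: vol_density_def)
      then show ?thesis using pos by simp
    qed
    show ?thesis using has_derivative_compose[OF d2 d1] unfolding teq .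
  qed
  then have dv: "((\<lambda>w. vol_density (G w)) has_derivative (\<lambda>v. vol_density (G z) * tr v)) (at z)"
    by (simp add: vol_density_def)
  from has_derivative_of_real[OF this]
  have dc: "((\<lambda>w. complex_of_real (vol_density (G w))) has_derivative
      (\<lambda>v. complex_of_real (vol_density (G z) * tr v))) (at z)" .
  then show "(\<lambda>w. complex_of_real (vol_density (G w))) differentiable (at z)"
    by (rule differentiableI)
  have G'nth: "frechet_derivative (\<lambda>w. G w $ i $ j) (at z) v = G' v $ i $ j" for i j v
    using frechet_derivative_linear[OF bounded_linear_compose[OF bounded_linear_vec_nth bounded_linear_vec_nth],
      OF smooth_on_imp_differentiable[OF G z]] unfolding G'_def by blast
  have G'c: "cnj (G' v $ i $ j) = G' v $ j $ i" for v i j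
    unfolding G'nth[symmetric]
    using frechet_derivative_linear[OF bounded_linear_cnj smooth_on_imp_differentiable[OF smooth_G z]]
      frechet_derivative_cong_open[OF S z, of "\<lambda>w. cnj (G w $ i $ j)" "\<lambda>w. G w $ j $ i"] G_cnj by metis
  have trc: "complex_of_real (tr v) = (\<Sum>i\<in>UNIV. \<Sum>j\<in>UNIV. h z i j * G' v $ i $ j)" for v
  proof -
    have "cnj (\<Sum>i\<in>UNIV. \<Sum>j\<in>UNIV. h z i j * G' v $ i $ j) = (\<Sum>i\<in>UNIV. \<Sum>j\<in>UNIV. h z i j * G' v $ i $ j)"
      by (subst (2) sum.swap) (simp add: G'c inverse_metric_hermitian[OF pd[OF z]])
    moreover have "complex_of_real (Re w) = w" if "cnj w = w" for w
      using that by (simp add: complex_eq_iff)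
    ultimately show ?thesis unfolding tr_def by blast
  qed
  show "dz k (\<lambda>w. complex_of_real (vol_density (G w))) z
      = of_real (vol_density (G z)) * (\<Sum>i\<in>UNIV. \<Sum>j\<in>UNIV. h z i j * dz k (\<lambda>w. G w $ i $ j) z)"
    unfolding dz_def frechet_derivative_eqI[OF dc] G'nth of_real_mult trc
    by (simp add: sum_distrib_left sum_subtractf sum_divide_distrib algebra_simps diff_divide_distrib)
qed

lemma vol_density_continuous: "continuous_on S (\<lambda>w. vol_density (G w))"
proof -
  have "continuous_on S (\<lambda>w. Re (complex_of_real (vol_density (G w))))"
    using vol_density_differentiable
    by (intro continuous_on_Re continuous_at_imp_continuous_on) (auto dest: differentiable_imp_continuous_within)
  then show ?thesis by simp
qed

text \<open>The field is the metric dual of the (0,1)-derivative of \<open>u\<close>. For a Kaehler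
  metric the derivatives of the density and of the inverse metric would cancel; here the torsion
  given by \<open>lck\<close> survives and contributes n - 1 times the squared norm of the
  derivative of \<open>u\<close>.\<close>

lemma divergence_lee_field:
  assumes z: "z \<in> S"
  shows "(\<Sum>k\<in>UNIV. dz k (\<lambda>w. of_real (vol_density (G w)) * (\<Sum>l\<in>UNIV. h w k l * dzbar l u w)) z)
    = of_real (vol_density (G z)) * ((of_nat CARD('n) - 1) *
        (\<Sum>k\<in>UNIV. \<Sum>l\<in>UNIV. h z k l * dz k u z * dzbar l u z) + (\<Sum>k\<in>UNIV. \<Sum>l\<in>UNIV. h z k l * hess k l z))"
proof -
  have d: "f differentiable (at z)" if "smooth_on S f" for f :: "complex^'n \<Rightarrow> complex"
    using diff[OF that z] .
  let ?v = "complex_of_real (vol_density (G z))"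
  define a where "a k = (\<Sum>i\<in>UNIV. \<Sum>j\<in>UNIV. h z i j * dz k (\<lambda>w. G w $ i $ j) z)" for k
  have smf: "smooth_on S (\<lambda>w. \<Sum>l\<in>UNIV. h w k l * dzbar l u w)" for k by (intro smooth_rules)
  have "(\<Sum>k\<in>UNIV. dz k (\<lambda>w. of_real (vol_density (G w)) * (\<Sum>l\<in>UNIV. h w k l * dzbar l u w)) z)
    = (\<Sum>k\<in>UNIV. ?v * (\<Sum>l\<in>UNIV. h z k l * hess k l z + dz k (\<lambda>w. h w k l) z * dzbar l u z)
        + ?v * a k * (\<Sum>l\<in>UNIV. h z k l * dzbar l u z))"
    by (simp add: dz_mult[OF vol_density_differentiable[OF z] d[OF smf]] dz_vol_density[OF z] a_def)
       (simp add: dz_sum dz_mult d smooth_rules)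
  also have "\<dots> = ?v * ((\<Sum>k\<in>UNIV. \<Sum>l\<in>UNIV. h z k l * hess k l z)
       + (\<Sum>l\<in>UNIV. (\<Sum>k\<in>UNIV. dz k (\<lambda>w. h w k l) z) * dzbar l u z)
       + (\<Sum>l\<in>UNIV. (\<Sum>k\<in>UNIV. a k * h z k l) * dzbar l u z))"
  proof -
    have "(\<Sum>l\<in>UNIV. (\<Sum>k\<in>UNIV. dz k (\<lambda>w. h w k l) z) * dzbar l u z)
      = (\<Sum>k\<in>UNIV. \<Sum>l\<in>UNIV. dz k (\<lambda>w. h w k l) z * dzbar l u z)"
      "(\<Sum>l\<in>UNIV. (\<Sum>k\<in>UNIV. a k * h z k l) * dzbar l u z)
      = (\<Sum>k\<in>UNIV. a k * (\<Sum>l\<in>UNIV. h z k l * dzbar l u z))"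
      by (simp add: sum_distrib_right, rule sum.swap)
         (simp add: sum_distrib_right sum_distrib_left mult.assoc, rule sum.swap)
    then show ?thesis by (simp add: sum.distrib sum_distrib_left distrib_left mult.assoc)
  qed
  finally have e1: "(\<Sum>k\<in>UNIV. dz k (\<lambda>w. of_real (vol_density (G w)) * (\<Sum>l\<in>UNIV. h w k l * dzbar l u w)) z)
    = ?v * ((\<Sum>k\<in>UNIV. \<Sum>l\<in>UNIV. h z k l * hess k l z)
       + (\<Sum>l\<in>UNIV. (\<Sum>k\<in>UNIV. dz k (\<lambda>w. h w k l) z) * dzbar l u z)
       + (\<Sum>l\<in>UNIV. (\<Sum>k\<in>UNIV. a k * h z k l) * dzbar l u z))" .
  \<comment> \<open>Exchanging \<open>k\<close> and \<open>m\<close> in the derivative of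
    \<open>G\<close> by \<open>lck\<close> replaces the contraction by \<open>a m\<close>, which
    later cancels the derivative of the density, and by n - 1 copies of
    \<open>dz m u\<close>.\<close>
  have dzh: "(\<Sum>k\<in>UNIV. dz k (\<lambda>w. h w k l) z) = (\<Sum>m\<in>UNIV. - (a m - (of_nat CARD('n) - 1) * dz m u z) * h z m l)" for l
  proof -
    have con: "(\<Sum>k\<in>UNIV. \<Sum>q\<in>UNIV. h z k q * dz k (\<lambda>w. G w $ m $ q) z) = a m - (of_nat CARD('n) - 1) * dz m u z" for m
    proof -
      have "dz k (\<lambda>w. G w $ m $ q) z = dz m (\<lambda>w. G w $ k $ q) z + dz k u z * G z $ m $ q - dz m u z * G z $ k $ q" for k q
        using lck[OF z, of k m q] by algebra
      then have "(\<Sum>k\<in>UNIV. \<Sum>q\<in>UNIV. h z k q * dz k (\<lambda>w. G w $ m $ q) z)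
        = (\<Sum>k\<in>UNIV. \<Sum>q\<in>UNIV. h z k q * (dz m (\<lambda>w. G w $ k $ q) z + dz k u z * G z $ m $ q - dz m u z * G z $ k $ q))"
        by (intro sum.cong refl arg_cong2[where f = "(*)"])
      also have "\<dots> = a m + (\<Sum>k\<in>UNIV. \<Sum>q\<in>UNIV. h z k q * (dz k u z * G z $ m $ q)) - dz m u z * (\<Sum>k\<in>UNIV. \<Sum>q\<in>UNIV. h z k q * G z $ k $ q)"
        by (simp add: a_def sum.distrib sum_subtractf sum_distrib_left algebra_simps)
      finally show ?thesis unfolding contract_G[OF z] contract_G_left[OF z] by (simp add: algebra_simps)
    qed
    have "(\<Sum>k\<in>UNIV. dz k (\<lambda>w. h w k l) z) = - (\<Sum>k\<in>UNIV. \<Sum>m\<in>UNIV. \<Sum>q\<in>UNIV. h z k q * dz k (\<lambda>w. G w $ m $ q) z * h z m l)"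
      unfolding dz_h[OF z] by (simp add: sum_negf)
    also have "\<dots> = - (\<Sum>m\<in>UNIV. (\<Sum>k\<in>UNIV. \<Sum>q\<in>UNIV. h z k q * dz k (\<lambda>w. G w $ m $ q) z) * h z m l)"
      by (subst sum.swap) (simp add: sum_distrib_right)
    finally show ?thesis unfolding con sum_negf[symmetric] minus_mult_left .
  qed
  have e2: "(\<Sum>k\<in>UNIV. \<Sum>l\<in>UNIV. h z k l * hess k l z)
       + (\<Sum>l\<in>UNIV. (\<Sum>m\<in>UNIV. - (a m - (of_nat CARD('n) - 1) * dz m u z) * h z m l) * dzbar l u z)
       + (\<Sum>l\<in>UNIV. (\<Sum>k\<in>UNIV. a k * h z k l) * dzbar l u z)
      = (\<Sum>k\<in>UNIV. \<Sum>l\<in>UNIV. h z k l * hess k l z)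
       + (\<Sum>l\<in>UNIV. \<Sum>m\<in>UNIV. (of_nat CARD('n) - 1) * (h z m l * dz m u z * dzbar l u z))"
    unfolding sum_distrib_right add.assoc sum.distrib[symmetric]
    by (intro arg_cong2[where f = "(+)"] refl sum.cong) (simp add: algebra_simps)
  have e3: "(\<Sum>l\<in>UNIV. \<Sum>m\<in>UNIV. (of_nat CARD('n) - 1) * (h z m l * dz m u z * dzbar l u z))
      = (of_nat CARD('n) - 1) * (\<Sum>k\<in>UNIV. \<Sum>l\<in>UNIV. h z k l * dz k u z * dzbar l u z)"
    by (subst sum.swap) (simp add: sum_distrib_left)
  show ?thesis unfolding e1 dzh e2 e3 by (simp add: add.commute)
qed

end

section \<open>Holomorphic functions of several variables\<close>

text \<open>Only real differentiability and the Cauchy-Riemann equations are demanded, which is what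
  \<open>complex_atlas\<close> supplies for transition maps. Continuity and holomorphy of the
  derivatives are deduced below from Cauchy's formula.\<close>

definition holomorphic_vec :: "(complex^'n) set \<Rightarrow> (complex^'n \<Rightarrow> complex) \<Rightarrow> bool" where
  "holomorphic_vec S f \<longleftrightarrow> (\<forall>z\<in>S. f differentiable (at z) \<and> (\<forall>k. dzbar k f z = 0))"

lemma holomorphic_vec_frechet_derivative:
  assumes "holomorphic_vec S f" "z \<in> S"
  shows "frechet_derivative f (at z) v = (\<Sum>k\<in>UNIV. v $ k * dz k f z)"
  using assms frechet_derivative_eq_dz_dzbar[of f z v] by (simp add: holomorphic_vec_def)

lemma axis_add: "axis i (a + b) = axis i a + (axis i b :: 'a::monoid_add^'n)"
  by (simp add: vec_eq_iff axis_def)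

lemma norm_axis_complex: "norm (axis i a :: complex^'n) = norm a"
proof -
  have "(norm ((axis i a :: complex^'n) $ j))\<^sup>2 = (if j = i then (norm a)\<^sup>2 else 0)" for j
    by (simp add: axis_def)
  then show ?thesis by (simp add: norm_vec_def L2_set_def)
qed

lemma holomorphic_vec_slice:
  fixes f :: "complex^'n \<Rightarrow> complex"
  assumes f: "holomorphic_vec S f" and z: "z + axis l \<zeta> \<in> S"
  shows "((\<lambda>\<zeta>. f (z + axis l \<zeta>)) has_field_derivative dz l f (z + axis l \<zeta>)) (at \<zeta>)"
proof -
  have bl: "bounded_linear (\<lambda>\<zeta>. axis l \<zeta> :: complex^'n)"
    by (rule bounded_linear_intro[of _ 1]) (simp_all add: axis_add norm_axis_complex, simp add: vec_eq_iff axis_def)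
  have "((\<lambda>\<zeta>. z + axis l \<zeta>) has_derivative axis l) (at \<zeta>)"
    using bounded_linear_imp_has_derivative[OF bl] by (auto intro!: derivative_eq_intros)
  moreover have "(f has_derivative frechet_derivative f (at (z + axis l \<zeta>))) (at (z + axis l \<zeta>))"
    using f z by (simp add: holomorphic_vec_def frechet_derivative_works)
  ultimately have "((\<lambda>\<zeta>. f (z + axis l \<zeta>)) has_derivative
      (\<lambda>h. frechet_derivative f (at (z + axis l \<zeta>)) (axis l h))) (at \<zeta>)"
    by (rule has_derivative_compose)
  moreover have "(\<lambda>h. frechet_derivative f (at (z + axis l \<zeta>)) (axis l h)) = (*) (dz l f (z + axis l \<zeta>))"
    unfolding holomorphic_vec_frechet_derivative[OF f z]
    by (auto simp: axis_def if_distrib if_distribR fun_eq_iff mult.commute cong: if_cong)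
  ultimately show ?thesis by (simp add: has_field_derivative_def)
qed

text \<open>The kernel of Cauchy's formula for the derivative at the centre of a circle, pulled back
  to the parameter interval.\<close>

definition circle_kernel :: "real \<Rightarrow> real \<Rightarrow> complex" where
  "circle_kernel r t = 1 / (2 * of_real pi * \<i>) * (vector_derivative (circlepath 0 r) (at t) / (circlepath 0 r t)\<^sup>2)"

lemma circle_kernel_continuous: "r > 0 \<Longrightarrow> continuous_on T (circle_kernel r)"
  unfolding circle_kernel_def[abs_def] vector_derivative_circlepath unfolding circlepath
  by (intro continuous_intros) auto

lemma circlepath_continuous: "continuous_on T (circlepath 0 r)"
  unfolding circlepath[abs_def] by (intro continuous_intros)

lemma norm_circlepath: "r > 0 \<Longrightarrow> norm (circlepath 0 r t) = r"
  by (simp add: circlepath norm_mult)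

text \<open>The one-variable formula on the complex line through \<open>z\<close> in direction
  \<open>l\<close>. Its right-hand side contains \<open>f\<close> undifferentiated, so regularity of
  \<open>f\<close> in \<open>z\<close> passes to \<open>dz l f\<close>.\<close>

lemma holomorphic_vec_cauchy:
  assumes f: "holomorphic_vec S f" and r: "r > 0" "cball z r \<subseteq> S"
  shows "dz l f z = integral (cbox 0 1) (\<lambda>t. circle_kernel r t * f (z + axis l (circlepath 0 r t)))"
proof -
  define g where "g \<zeta> = f (z + axis l \<zeta>)" for \<zeta>
  have mem: "z + axis l \<zeta> \<in> S" if "\<zeta> \<in> cball 0 r" for \<zeta>
    using r(2) that by (auto simp: subset_iff dist_norm norm_axis_complex norm_minus_commute)
  have dg: "(g has_field_derivative dz l f (z + axis l \<zeta>)) (at \<zeta>)" if "\<zeta> \<in> cball 0 r" for \<zeta>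
    unfolding g_def using holomorphic_vec_slice[OF f mem[OF that]] .
  have "continuous_on (cball 0 r) g"
    using dg by (meson DERIV_isCont continuous_at_imp_continuous_on)
  moreover have "g holomorphic_on ball 0 r"
    unfolding holomorphic_on_def field_differentiable_def
    using dg by (meson ball_subset_cball has_field_derivative_at_within subsetD)
  ultimately have "(g has_field_derivative (1 / (2 * of_real pi * \<i>) *
      contour_integral (circlepath 0 r) (\<lambda>u. g u / (u - 0)^2))) (at 0)"
    using r by (intro Cauchy_derivative_integral_circlepath(2)) auto
  moreover have "(g has_field_derivative dz l f z) (at 0)"
    using dg[of 0] r by (simp add: axis_def flip: zero_vec_def)
  ultimately have "dz l f z = 1 / (2 * of_real pi * \<i>) * contour_integral (circlepath 0 r) (\<lambda>u. g u / (u - 0)^2)"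
    using DERIV_unique by blast
  also have "\<dots> = 1 / (2 * of_real pi * \<i>) * integral {0..1}
      (\<lambda>t. g (circlepath 0 r t) / (circlepath 0 r t)\<^sup>2 * vector_derivative (circlepath 0 r) (at t))"
    by (simp add: contour_integral_integral)
  also have "\<dots> = integral {0..1} (\<lambda>t. 1 / (2 * of_real pi * \<i>) *
      (g (circlepath 0 r t) / (circlepath 0 r t)\<^sup>2 * vector_derivative (circlepath 0 r) (at t)))"
    by (rule integral_mult_right[symmetric])
  also have "\<dots> = integral (cbox 0 1) (\<lambda>t. circle_kernel r t * f (z + axis l (circlepath 0 r t)))"
    by (simp add: circle_kernel_def g_def mult_ac)
  finally show ?thesis .
qed

lemma axis_circlepath_continuous: "continuous_on T (\<lambda>t. axis l (circlepath 0 r t) :: complex^'n)"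
proof -
  have "continuous_on T (\<lambda>t. if j = l then circlepath 0 r t else 0)" for j
    using circlepath_continuous by (cases "j = l") auto
  then show ?thesis unfolding axis_def by (intro continuous_on_vec_lambda)
qed

text \<open>Centres in a ball of radius \<open>r\<close> and circles of radius \<open>r\<close>
  around them need room \<open>2 * r\<close>; with the radius fixed, the centre can vary under the
  integral.\<close>

lemma shift_axis_circlepath:
  assumes "r > 0" "cball z0 (2 * r) \<subseteq> S" "z \<in> ball z0 r"
  shows "z + axis l (circlepath 0 r t) \<in> S" "cball z r \<subseteq> S"
proof -
  have *: "dist z0 (z + v) \<le> 2 * r" if "norm v \<le> r" for v
  proof -
    have "dist z0 (z + v) \<le> dist z0 z + norm v"
      by (metis add_diff_cancel_left' dist_norm dist_triangle norm_minus_commute)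
    then show ?thesis using assms(3) that by simp
  qed
  show "z + axis l (circlepath 0 r t) \<in> S"
    using *[of "axis l (circlepath 0 r t)"] assms(1,2) by (auto simp: norm_axis_complex norm_circlepath)
  show "cball z r \<subseteq> S"
  proof
    fix y assume "y \<in> cball z r"
    then have "dist z0 (z + (y - z)) \<le> 2 * r" by (intro *) (simp add: dist_norm norm_minus_commute)
    then show "y \<in> S" using assms(2) by auto
  qed
qed

lemma holomorphic_vec_dz_continuous:
  assumes f: "holomorphic_vec S f" and S: "open S"
  shows "continuous_on S (dz l f)"
proof -
  have "isCont (dz l f) z0" if z0: "z0 \<in> S" for z0
  proof -
    obtain e where e: "e > 0" "cball z0 e \<subseteq> S" using S z0 open_contains_cball by blast
    define r where "r = e / 2"
    have r: "r > 0" "cball z0 (2 * r) \<subseteq> S" using e by (auto simp: r_def)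
    note sh = shift_axis_circlepath[OF r]
    have cf: "continuous_on S f"
      using f unfolding holomorphic_vec_def
      by (intro continuous_at_imp_continuous_on ballI differentiable_imp_continuous_within) auto
    have "continuous_on (ball z0 r \<times> cbox 0 1) (\<lambda>p. circle_kernel r (snd p) * f (fst p + axis l (circlepath 0 r (snd p))))"
    proof (intro continuous_on_mult)
      show "continuous_on (ball z0 r \<times> cbox 0 1) (\<lambda>p. circle_kernel r (snd p))"
        by (rule continuous_on_compose2[OF circle_kernel_continuous[OF r(1), of UNIV]]) (auto intro: continuous_intros)
      show "continuous_on (ball z0 r \<times> cbox 0 1) (\<lambda>p. f (fst p + axis l (circlepath 0 r (snd p))))"
        by (rule continuous_on_compose2[OF cf])
           (auto intro!: continuous_intros continuous_on_compose2[OF axis_circlepath_continuous[of UNIV]] sh(1))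
    qed
    then have "continuous_on (ball z0 r) (\<lambda>z. integral (cbox 0 1)
        (\<lambda>t. circle_kernel r t * f (z + axis l (circlepath 0 r t))))"
      by (intro integral_continuous_on_param) (simp add: split_beta)
    then have "continuous_on (ball z0 r) (dz l f)"
      using holomorphic_vec_cauchy[OF f r(1) sh(2)] by (subst continuous_on_cong[OF refl]) auto
    then show ?thesis using r(1) by (simp add: continuous_on_eq_continuous_at)
  qed
  then show ?thesis by (simp add: continuous_at_imp_continuous_on)
qed

text \<open>Cauchy's formula is differentiated under the integral sign. The derivative of the
  integrand is complex linear, hence so is that of the integral, and the Cauchy-Riemann equations
  follow. This is used to differentiate the Jacobian of a transition map when Lee divergences are
  compared.\<close>

lemma holomorphic_vec_dz:
  fixes f :: "complex^'n \<Rightarrow> complex"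
  assumes f: "holomorphic_vec S f" and S: "open S"
  shows "holomorphic_vec S (dz l f)"
  unfolding holomorphic_vec_def
proof
  fix z0 assume z0: "z0 \<in> S"
  obtain e where e: "e > 0" "cball z0 e \<subseteq> S" using S z0 open_contains_cball by blast
  define r where "r = e / 2"
  have r: "r > 0" "cball z0 (2 * r) \<subseteq> S" using e by (auto simp: r_def)
  note sh = shift_axis_circlepath[OF r]
  \<comment> \<open>Leibniz's rule takes the derivative as a continuous map into a Banach space of
    bounded linear maps, so that of the integrand is assembled from the coordinate
    functionals.\<close>
  define B :: "'n \<Rightarrow> (complex^'n) \<Rightarrow>\<^sub>L complex" where "B j = Blinfun (\<lambda>v. v $ j)" for j
  have B: "blinfun_apply (B j) v = v $ j" for j v
    unfolding B_def by (simp add: bounded_linear_Blinfun_apply bounded_linear_vec_nth)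
  define F where "F z t = (\<Sum>j\<in>UNIV. blinfun_mult_right (circle_kernel r t * dz j f (z + axis l (circlepath 0 r t))) o\<^sub>L B j)" for z t
  have F: "blinfun_apply (F z t) v = (\<Sum>j\<in>UNIV. circle_kernel r t * dz j f (z + axis l (circlepath 0 r t)) * v $ j)" for z t v
    by (simp add: F_def blinfun.sum_left B)
  have cont: "continuous_on (ball z0 r \<times> cbox 0 1) (\<lambda>p. F (fst p) (snd p))"
    unfolding F_def
  proof (intro continuous_on_sum bounded_bilinear.continuous_on[OF bounded_bilinear_blinfun_compose]
      bounded_linear.continuous_on[OF bounded_linear_blinfun_mult_right] continuous_on_mult continuous_on_const)
    show "continuous_on (ball z0 r \<times> cbox 0 1) (\<lambda>p. circle_kernel r (snd p))"
      by (rule continuous_on_compose2[OF circle_kernel_continuous[OF r(1), of UNIV]]) (auto intro: continuous_intros)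
    show "continuous_on (ball z0 r \<times> cbox 0 1) (\<lambda>p. dz j f (fst p + axis l (circlepath 0 r (snd p))))" for j
      by (rule continuous_on_compose2[OF holomorphic_vec_dz_continuous[OF f S]])
         (auto intro!: continuous_intros continuous_on_compose2[OF axis_circlepath_continuous[of UNIV]] sh(1))
  qed
  have df: "((\<lambda>z. circle_kernel r t * f (z + axis l (circlepath 0 r t))) has_derivative blinfun_apply (F z t)) (at z within ball z0 r)"
    if z: "z \<in> ball z0 r" for z t
  proof -
    let ?w = "z + axis l (circlepath 0 r t)"
    have df: "(f has_derivative frechet_derivative f (at ?w)) (at ?w)"
      using f sh(1)[OF z] by (simp add: holomorphic_vec_def frechet_derivative_works)
    have shift: "((\<lambda>z. z + axis l (circlepath 0 r t)) has_derivative (\<lambda>v. v)) (at z)"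
      by (rule has_derivative_eq_rhs[OF has_derivative_add[OF has_derivative_ident has_derivative_const]]) simp
    have "((\<lambda>z. f (z + axis l (circlepath 0 r t))) has_derivative frechet_derivative f (at ?w)) (at z)"
      using has_derivative_compose[OF shift df] .
    then have "((\<lambda>z. circle_kernel r t * f (z + axis l (circlepath 0 r t))) has_derivative
        (\<lambda>v. circle_kernel r t * frechet_derivative f (at ?w) v)) (at z)"
      by (rule has_derivative_mult_right)
    moreover have "(\<lambda>v. circle_kernel r t * frechet_derivative f (at ?w) v) = blinfun_apply (F z t)"
      unfolding holomorphic_vec_frechet_derivative[OF f sh(1)[OF z]] fun_eq_iff F
      by (simp add: sum_distrib_left mult_ac)
    ultimately show ?thesis by (simp add: has_derivative_at_withinI)
  qed
  have ci: "continuous_on (cbox 0 1) (\<lambda>t. F z0 t)"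
  proof -
    have pc: "continuous_on (cbox 0 1) (\<lambda>t::real. (z0, t))"
      by (intro continuous_on_Pair continuous_on_const continuous_on_id)
    have "continuous_on (cbox 0 1) (\<lambda>t. F (fst (z0, t)) (snd (z0, t)))"
      by (rule continuous_on_compose2[OF cont pc]) (use r in auto)
    then show ?thesis by simp
  qed
  have "((\<lambda>z. integral (cbox 0 1) (\<lambda>t. circle_kernel r t * f (z + axis l (circlepath 0 r t))))
      has_derivative blinfun_apply (integral (cbox 0 1) (F z0))) (at z0 within ball z0 r)"
  proof (rule leibniz_rule[where f = "\<lambda>z t. circle_kernel r t * f (z + axis l (circlepath 0 r t))"
        and fx = F and U = "ball z0 r"])
    show "((\<lambda>z. circle_kernel r t * f (z + axis l (circlepath 0 r t))) has_derivative blinfun_apply (F z t)) (at z within ball z0 r)"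
      if "z \<in> ball z0 r" for z t
      using df[OF that] .
    show "continuous_on (ball z0 r \<times> cbox 0 1) (\<lambda>(x, t). F x t)"
      using cont unfolding split_beta .
    show "(\<lambda>t. circle_kernel r t * f (z + axis l (circlepath 0 r t))) integrable_on cbox 0 1" if "z \<in> ball z0 r" for z
    proof (intro integrable_continuous continuous_on_mult circle_kernel_continuous r)
      have "continuous_on S f"
        using f unfolding holomorphic_vec_def
        by (intro continuous_at_imp_continuous_on ballI differentiable_imp_continuous_within) auto
      then show "continuous_on (cbox 0 1) (\<lambda>t. f (z + axis l (circlepath 0 r t)))"
        by (rule continuous_on_compose2)
          (auto intro!: continuous_intros axis_circlepath_continuous sh(1)[OF that])
    qed
    show "z0 \<in> ball z0 r" using r(1) by simp
    show "convex (ball z0 r)" by simp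
  qed
  then have "((\<lambda>z. integral (cbox 0 1) (\<lambda>t. circle_kernel r t * f (z + axis l (circlepath 0 r t))))
      has_derivative blinfun_apply (integral (cbox 0 1) (F z0))) (at z0)"
    using r(1) by (simp only: at_within_open[OF _ open_ball] centre_in_ball)
  then have d: "(dz l f has_derivative blinfun_apply (integral (cbox 0 1) (F z0))) (at z0)"
    by (rule has_derivative_transform_within_open[of _ _ _ _ "ball z0 r"])
      (use r(1) holomorphic_vec_cauchy[OF f r(1) sh(2)] in auto)
  have lin: "blinfun_apply (integral (cbox 0 1) (F z0)) (axis k \<i>) = \<i> * blinfun_apply (integral (cbox 0 1) (F z0)) (axis k 1)" for k
  proof -
    have int: "blinfun_apply (integral (cbox 0 1) (F z0)) v = integral (cbox 0 1) (\<lambda>t. blinfun_apply (F z0 t) v)" for v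
      using integral_linear[OF integrable_continuous[OF ci] bounded_bilinear.bounded_linear_left[OF bounded_bilinear_blinfun_apply, of v]] by (simp add: o_def)
    have "blinfun_apply (F z0 t) (axis k \<i>) = \<i> * blinfun_apply (F z0 t) (axis k 1)" for t
      unfolding F by (simp add: axis_def if_distrib cong: if_cong)
    then show ?thesis unfolding int by simp
  qed
  have "dzbar k (dz l f) z0 = 0" for k
    unfolding dzbar_def frechet_derivative_eqI[OF d] lin by simp
  then show "dz l f differentiable at z0 \<and> (\<forall>k. dzbar k (dz l f) z0 = 0)"
    using d differentiableI by blast
qed

section \<open>Holomorphic changes of coordinates\<close>

lemma derivative_compose_holomorphic:
  fixes f :: "complex^'m \<Rightarrow> complex" and T :: "complex^'n \<Rightarrow> complex^'m"
  assumes f: "f differentiable (at (T z))" and T: "T differentiable (at z)"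
    and hol: "\<And>p k. dzbar k (\<lambda>w. T w $ p) z = 0"
  shows "(\<lambda>w. f (T w)) differentiable (at z)"
    and "dz k (\<lambda>w. f (T w)) z = (\<Sum>p\<in>UNIV. dz p f (T z) * dz k (\<lambda>w. T w $ p) z)"
    and "dzbar k (\<lambda>w. f (T w)) z = (\<Sum>p\<in>UNIV. dzbar p f (T z) * cnj (dz k (\<lambda>w. T w $ p) z))"
proof -
  have d: "((\<lambda>w. f (T w)) has_derivative (\<lambda>v. frechet_derivative f (at (T z)) (frechet_derivative T (at z) v))) (at z)"
    using has_derivative_compose[OF T[unfolded frechet_derivative_works] f[unfolded frechet_derivative_works]] .
  then show "(\<lambda>w. f (T w)) differentiable (at z)" by (rule differentiableI)
  define a where "a k p = dz k (\<lambda>w. T w $ p) z" for k p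
  have "frechet_derivative T (at z) v $ p = frechet_derivative (\<lambda>w. T w $ p) (at z) v" for v p
    using frechet_derivative_linear[OF bounded_linear_vec_nth T] by metis
  moreover have "(\<lambda>w. T w $ p) differentiable (at z)" for p
    using bounded_linear.has_derivative[OF bounded_linear_vec_nth] T unfolding differentiable_def by blast
  ultimately have Tv: "frechet_derivative T (at z) v $ p = (\<Sum>j\<in>UNIV. v $ j * a j p)" for v p
    using frechet_derivative_eq_dz_dzbar[of "\<lambda>w. T w $ p" z v] hol by (simp add: a_def)
  have Ta: "frechet_derivative T (at z) (axis k b) $ p = b * a k p" for k b p
    unfolding Tv by (simp add: axis_def if_distrib if_distribR cong: if_cong)
  have fd: "frechet_derivative (\<lambda>w. f (T w)) (at z) (axis k b)
    = (\<Sum>p\<in>UNIV. b * a k p * dz p f (T z) + cnj (b * a k p) * dzbar p f (T z))" for b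
    unfolding frechet_derivative_eqI[OF d] frechet_derivative_eq_dz_dzbar[OF f] Ta ..
  show "dz k (\<lambda>w. f (T w)) z = (\<Sum>p\<in>UNIV. dz p f (T z) * dz k (\<lambda>w. T w $ p) z)"
    unfolding dz_def[of k "\<lambda>w. f (T w)"] fd a_def[symmetric] sum_distrib_left sum_subtractf[symmetric] sum_divide_distrib
    by (intro sum.cong refl) (simp add: algebra_simps)
  show "dzbar k (\<lambda>w. f (T w)) z = (\<Sum>p\<in>UNIV. dzbar p f (T z) * cnj (dz k (\<lambda>w. T w $ p) z))"
    unfolding dzbar_def[of k "\<lambda>w. f (T w)"] fd a_def[symmetric] sum_distrib_left sum.distrib[symmetric] sum_divide_distrib
    by (intro sum.cong refl) (simp add: algebra_simps)
qed

text \<open>Inverting the matrix form of the transformation law shows that the conjugate of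
  \<open>A\<close>, times the inverse of \<open>M'\<close>, times the transpose of \<open>A\<close>,
  is the inverse of \<open>M\<close>. The sums in the conclusion are the entries of this
  product.\<close>

lemma inverse_metric_pullback:
  fixes M M' A :: "complex^'n^'n"
  assumes M': "\<And>i j. M' $ i $ j = (\<Sum>k\<in>UNIV. \<Sum>l\<in>UNIV. M $ k $ l * A $ k $ i * cnj (A $ l $ j))"
    and det: "det M' \<noteq> 0"
  shows "det A \<noteq> 0"
    and "(\<Sum>i\<in>UNIV. \<Sum>j\<in>UNIV. inverse_metric M' i j * (A $ q $ i * cnj (A $ p $ j))) = inverse_metric M q p"
proof -
  let ?B = "(\<chi> i j. cnj (A $ i $ j)) :: complex^'n^'n"
  have eq: "M' = transpose A ** (M ** ?B)"
    by (simp add: vec_eq_iff M' matrix_matrix_mult_def transpose_def sum_distrib_left mult_ac)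
  then have dAM: "det A \<noteq> 0 \<and> det M \<noteq> 0" using det by (auto simp: det_mul det_transpose)
  then show dA: "det A \<noteq> 0" by simp
  have dM: "det M \<noteq> 0" using dAM by simp
  define X where "X = ?B ** matrix_inv M' ** transpose A"
  have dT: "det (transpose A) \<noteq> 0" using dA by (simp add: det_transpose)
  have "transpose A ** (M ** X) = (transpose A ** (M ** ?B)) ** matrix_inv M' ** transpose A"
    by (simp add: X_def matrix_mul_assoc)
  also have "\<dots> = transpose A" unfolding eq[symmetric] matrix_inv_inverse[OF det] by simp
  finally have "matrix_inv (transpose A) ** (transpose A ** (M ** X)) = matrix_inv (transpose A) ** transpose A" by simp
  then have "M ** X = mat 1"
    unfolding matrix_mul_assoc matrix_inv_inverse[OF dT] by simp
  then have "matrix_inv M ** (M ** X) = matrix_inv M" by simp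
  then have X: "X = matrix_inv M"
    unfolding matrix_mul_assoc matrix_inv_inverse[OF dM] by simp
  have "X $ p $ q = (\<Sum>i\<in>UNIV. \<Sum>j\<in>UNIV. inverse_metric M' i j * (A $ q $ i * cnj (A $ p $ j)))"
    by (simp add: X_def matrix_matrix_mult_def transpose_def inverse_metric_def sum_distrib_right sum_distrib_left mult_ac)
  then show "(\<Sum>i\<in>UNIV. \<Sum>j\<in>UNIV. inverse_metric M' i j * (A $ q $ i * cnj (A $ p $ j))) = inverse_metric M q p"
    by (simp add: X inverse_metric_def)
qed

lemma contraction_pullback:
  fixes M M' A :: "complex^'n^'n"
  assumes M': "\<And>i j. M' $ i $ j = (\<Sum>k\<in>UNIV. \<Sum>l\<in>UNIV. M $ k $ l * A $ k $ i * cnj (A $ l $ j))"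
    and det: "det M' \<noteq> 0"
    and W: "\<And>i j. W' i j = (\<Sum>q\<in>UNIV. \<Sum>p\<in>UNIV. W q p * (A $ q $ i * cnj (A $ p $ j)))"
  shows "(\<Sum>i\<in>UNIV. \<Sum>j\<in>UNIV. inverse_metric M' i j * W' i j) = (\<Sum>q\<in>UNIV. \<Sum>p\<in>UNIV. inverse_metric M q p * W q p)"
proof -
  have "(\<Sum>i\<in>UNIV. \<Sum>j\<in>UNIV. inverse_metric M' i j * W' i j)
    = (\<Sum>i\<in>UNIV. \<Sum>j\<in>UNIV. \<Sum>q\<in>UNIV. \<Sum>p\<in>UNIV. W q p * (inverse_metric M' i j * (A $ q $ i * cnj (A $ p $ j))))"
    unfolding W by (simp add: sum_distrib_left mult_ac)
  also have "\<dots> = (\<Sum>i\<in>UNIV. \<Sum>q\<in>UNIV. \<Sum>j\<in>UNIV. \<Sum>p\<in>UNIV. W q p * (inverse_metric M' i j * (A $ q $ i * cnj (A $ p $ j))))"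
    by (intro sum.cong refl sum.swap)
  also have "\<dots> = (\<Sum>q\<in>UNIV. \<Sum>i\<in>UNIV. \<Sum>p\<in>UNIV. \<Sum>j\<in>UNIV. W q p * (inverse_metric M' i j * (A $ q $ i * cnj (A $ p $ j))))"
    by (subst sum.swap) (intro sum.cong refl sum.swap)
  also have "\<dots> = (\<Sum>q\<in>UNIV. \<Sum>p\<in>UNIV. \<Sum>i\<in>UNIV. \<Sum>j\<in>UNIV. W q p * (inverse_metric M' i j * (A $ q $ i * cnj (A $ p $ j))))"
    by (intro sum.cong refl sum.swap)
  finally show ?thesis by (simp add: sum_distrib_left[symmetric] inverse_metric_pullback(2)[OF M' det] mult.commute)
qed

section \<open>Integration\<close>

lemma lborel_integral_translate:
  fixes F :: "'v::euclidean_space \<Rightarrow> 'b::euclidean_space"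
  assumes "F \<in> borel_measurable borel"
  shows "(\<integral>x. F (a + x) \<partial>lborel) = (\<integral>x. F x \<partial>lborel)"
proof -
  have "(\<integral>x. F x \<partial>lborel) = (\<integral>x. F x \<partial>distr lborel borel ((+) a))" by (simp only: lborel_distr_plus)
  also have "\<dots> = (\<integral>x. F (a + x) \<partial>lborel)"
    using assms by (intro integral_distr) auto
  finally show ?thesis by simp
qed

lemma norm_difference_along_line:
  fixes F :: "'v::real_normed_vector \<Rightarrow> complex"
  assumes d: "\<And>x. F differentiable (at x)" and C: "\<And>x. norm (frechet_derivative F (at x) v) \<le> C" and s: "s > 0"
  shows "norm (F (x + s *\<^sub>R v) - F x) \<le> s * C"
proof -
  have der: "((\<lambda>t. F (x + t *\<^sub>R v)) has_derivative (\<lambda>h. frechet_derivative F (at (x + t *\<^sub>R v)) (h *\<^sub>R v))) (at t)" for t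
  proof -
    have "((\<lambda>t. x + t *\<^sub>R v) has_derivative (\<lambda>h. h *\<^sub>R v)) (at t)" by (auto intro!: derivative_eq_intros)
    from has_derivative_compose[OF this d[unfolded frechet_derivative_works]] show ?thesis .
  qed
  have cont: "continuous_on {0..s} (\<lambda>t. F (x + t *\<^sub>R v))"
    using der by (intro continuous_at_imp_continuous_on) (blast dest: has_derivative_continuous)
  obtain t where "norm (F (x + s *\<^sub>R v) - F (x + 0 *\<^sub>R v)) \<le> norm (frechet_derivative F (at (x + t *\<^sub>R v)) ((s - 0) *\<^sub>R v))"
    using mvt_general[OF s cont der] by blast
  also have "\<dots> = s * norm (frechet_derivative F (at (x + t *\<^sub>R v)) v)"
    using linear_cmul[OF linear_frechet_derivative[OF d]] s by simp
  also have "\<dots> \<le> s * C" using C s by (intro mult_left_mono) auto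
  finally show ?thesis by simp
qed

text \<open>Difference quotients have integral zero by translation invariance; dominated convergence passes
  to the limit.\<close>

lemma integral_directional_derivative_zero:
  fixes F :: "'v::euclidean_space \<Rightarrow> complex"
  assumes d: "\<And>x. F differentiable (at x)"
    and cont: "continuous_on UNIV (\<lambda>x. frechet_derivative F (at x) v)"
    and K: "compact K" "\<And>x. x \<notin> K \<Longrightarrow> F x = 0"
  shows "integrable lborel (\<lambda>x. frechet_derivative F (at x) v)"
    and "(\<integral>x. frechet_derivative F (at x) v \<partial>lborel) = 0"
proof -
  define F' where "F' x = frechet_derivative F (at x) v" for x
  have Fc: "continuous_on UNIV F"
    using d by (intro continuous_at_imp_continuous_on ballI differentiable_imp_continuous_within) auto
  have F'0: "F' x = 0" if "x \<notin> K" for x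
  proof -
    have "frechet_derivative F (at x) = frechet_derivative (\<lambda>x. 0) (at x)"
      using that K by (intro frechet_derivative_cong_open[of "- K"]) (auto simp: compact_imp_closed open_Compl)
    then show ?thesis by (simp add: F'_def)
  qed
  have int_supp: "integrable lborel H" if "continuous_on UNIV H" "compact L" "\<And>x. x \<notin> L \<Longrightarrow> H x = 0" for H :: "'v \<Rightarrow> complex" and L
  proof -
    have "(\<lambda>x. indicator L x *\<^sub>R H x) = H" using that(3) by (auto simp: indicator_def fun_eq_iff)
    then show ?thesis
      using borel_integrable_compact[OF that(2) continuous_on_subset[OF that(1)]] by simp
  qed
  have iF': "integrable lborel F'"
    unfolding F'_def[abs_def] by (rule int_supp[OF cont K(1) F'0[unfolded F'_def]])
  then show "integrable lborel (\<lambda>x. frechet_derivative F (at x) v)" unfolding F'_def[abs_def] .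
  have "bounded (F' ` K)"
    using K(1) cont by (intro compact_imp_bounded compact_continuous_image) (auto simp: F'_def intro: continuous_on_subset)
  then obtain C0 where C0: "\<And>x. x \<in> K \<Longrightarrow> norm (F' x) \<le> C0" by (auto simp: bounded_iff)
  define C where "C = max C0 0"
  have C: "norm (F' x) \<le> C" for x
    using C0[of x] F'0[of x] by (cases "x \<in> K") (auto simp: C_def)
  define s :: "nat \<Rightarrow> real" where "s n = 1 / real (Suc n)" for n
  have s: "s n > 0" "s n \<le> 1" for n by (auto simp: s_def)
  \<comment> \<open>All difference quotients in direction \<open>v\<close> with step at most 1
    vanish off \<open>K'\<close>, so a multiple of its indicator dominates them.\<close>
  define K' where "K' = (\<lambda>p. fst p - snd p *\<^sub>R v) ` (K \<times> {0..1::real})"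
  have K': "compact K'"
    unfolding K'_def using K(1) by (intro compact_continuous_image compact_Times) (auto intro!: continuous_intros)
  define D where "D n x = (F (x + s n *\<^sub>R v) - F x) /\<^sub>R s n" for n x
  have D0: "D n x = 0" if "x \<notin> K'" for n x
  proof -
    have "x \<notin> K"
    proof
      assume "x \<in> K"
      then have "(x, 0) \<in> K \<times> {0..1::real}" by simp
      then have "fst (x, 0::real) - snd (x, 0::real) *\<^sub>R v \<in> K'" unfolding K'_def by (rule imageI)
      then show False using that by simp
    qed
    moreover have "x + s n *\<^sub>R v \<notin> K"
    proof
      assume "x + s n *\<^sub>R v \<in> K"
      then have "(x + s n *\<^sub>R v, s n) \<in> K \<times> {0..1::real}" using s[of n] by simp
      then have "fst (x + s n *\<^sub>R v, s n) - snd (x + s n *\<^sub>R v, s n) *\<^sub>R v \<in> K'" unfolding K'_def by (rule imageI)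
      then show False using that by simp
    qed
    ultimately show ?thesis using K(2) by (simp add: D_def)
  qed
  have Dbound: "norm (D n x) \<le> indicator K' x * C" for n x
  proof (cases "x \<in> K'")
    case True
    have "norm (F (x + s n *\<^sub>R v) - F x) \<le> s n * C"
      using norm_difference_along_line[OF d C[unfolded F'_def] s(1)] .
    then have "norm (F (x + s n *\<^sub>R v) - F x) / s n \<le> C" using s(1)[of n] by (simp add: divide_le_eq mult.commute)
    then show ?thesis using True s(1)[of n] by (simp add: D_def divide_inverse mult.commute)
  qed (simp add: D0)
  have Dlim: "(\<lambda>n. D n x) \<longlonglongrightarrow> F' x" for x
  proof -
    have s0: "filterlim s (at 0) sequentially"
    proof -
      have "s \<longlonglongrightarrow> 0" unfolding s_def[abs_def] by (rule LIMSEQ_Suc[OF lim_inverse_n'])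
      moreover have "eventually (\<lambda>n. s n \<in> UNIV \<and> s n \<noteq> 0) sequentially"
        using s(1) by (intro always_eventually) (auto simp: less_imp_neq[symmetric])
      ultimately show ?thesis unfolding filterlim_at by blast
    qed
    have "(\<lambda>n. h (D n x)) \<longlonglongrightarrow> h (F' x)" if h: "bounded_linear h" for h :: "complex \<Rightarrow> real"
    proof -
      note lin = bounded_linear.linear[OF h]
      have "(\<lambda>x. h (F x)) differentiable (at x)"
        using bounded_linear.has_derivative[OF h d[unfolded frechet_derivative_works]] by (rule differentiableI)
      then have "((\<lambda>t. h (F (x + t *\<^sub>R v))) has_real_derivative h (F' x)) (at 0)"
        using has_real_derivative_along_line[of "\<lambda>x. h (F x)" x 0 v] frechet_derivative_linear[OF h d]
        by (simp add: F'_def)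
      then have "((\<lambda>t. (h (F (x + t *\<^sub>R v)) - h (F (x + 0 *\<^sub>R v))) / (t - 0)) \<longlongrightarrow> h (F' x)) (at 0)"
        by (simp only: has_field_derivative_iff)
      from filterlim_compose[OF this s0]
      have "(\<lambda>n. (h (F (x + s n *\<^sub>R v)) - h (F x)) / s n) \<longlonglongrightarrow> h (F' x)" by simp
      moreover have "(h (F (x + s n *\<^sub>R v)) - h (F x)) / s n = h (D n x)" for n
        by (simp add: D_def linear_cmul[OF lin] linear_diff[OF lin] divide_inverse mult.commute)
      ultimately show ?thesis by simp
    qed
    from this[OF bounded_linear_Re] this[OF bounded_linear_Im] show ?thesis
      by (simp add: tendsto_complex_iff)
  qed
  have Fm: "F \<in> borel_measurable borel" using Fc by (rule borel_measurable_continuous_onI)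
  have "(\<lambda>n. \<integral>x. D n x \<partial>lborel) \<longlonglongrightarrow> (\<integral>x. F' x \<partial>lborel)"
  proof (rule integral_dominated_convergence[where w = "\<lambda>x. indicator K' x * C"])
    show "F' \<in> borel_measurable lborel" using iF' by simp
    show "D n \<in> borel_measurable lborel" for n
    proof -
      have "continuous_on UNIV (D n)"
        unfolding D_def by (intro continuous_intros continuous_on_compose2[OF Fc]) auto
      then show ?thesis by (simp add: borel_measurable_continuous_onI)
    qed
    show "integrable lborel (\<lambda>x. indicator K' x * C)"
      using borel_integrable_compact[OF K', of "\<lambda>x. C"] by simp
  qed (use Dlim Dbound in auto)
  moreover have "(\<integral>x. D n x \<partial>lborel) = 0" for n
  proof -
    have iF: "integrable lborel F" using int_supp[OF Fc K] .
    have "compact ((\<lambda>x. x - s n *\<^sub>R v) ` K)"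
      using K(1) by (intro compact_continuous_image continuous_intros)
    moreover have "F (x + s n *\<^sub>R v) = 0" if "x \<notin> (\<lambda>x. x - s n *\<^sub>R v) ` K" for x
    proof (rule K(2))
      show "x + s n *\<^sub>R v \<notin> K"
      proof
        assume "x + s n *\<^sub>R v \<in> K"
        then have "(x + s n *\<^sub>R v) - s n *\<^sub>R v \<in> (\<lambda>x. x - s n *\<^sub>R v) ` K" by (rule imageI)
        then show False using that by simp
      qed
    qed
    moreover have "continuous_on UNIV (\<lambda>x. F (x + s n *\<^sub>R v))"
      by (intro continuous_on_compose2[OF Fc] continuous_intros) auto
    ultimately have iFs: "integrable lborel (\<lambda>x. F (x + s n *\<^sub>R v))" using int_supp by blast
    have "(\<integral>x. F (x + s n *\<^sub>R v) \<partial>lborel) = (\<integral>x. F x \<partial>lborel)"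
      using lborel_integral_translate[OF Fm, of "s n *\<^sub>R v"] by (simp add: add.commute)
    then show ?thesis unfolding D_def using iF iFs by simp
  qed
  ultimately have "(\<integral>x. F' x \<partial>lborel) = 0" by (simp add: LIMSEQ_const_iff)
  then show "(\<integral>x. frechet_derivative F (at x) v \<partial>lborel) = 0" unfolding F'_def[abs_def] .
qed

section \<open>Real coordinates and change of variables\<close>

definition to_coords :: "'v::euclidean_space \<Rightarrow> real^'m" where
  "to_coords v = (\<chi> i. v \<bullet> basis_enum i)"

definition of_coords :: "real^'m \<Rightarrow> 'v::euclidean_space" where
  "of_coords y = (\<Sum>i\<in>UNIV. (y $ i) *\<^sub>R basis_enum i)"

lemma
  assumes card: "CARD('m::finite) = DIM('v::euclidean_space)"
  shows of_to_coords: "of_coords (to_coords v :: real^'m) = (v :: 'v)"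
    and to_of_coords: "to_coords (of_coords y :: 'v) = (y :: real^'m)"
proof -
  have "of_coords (to_coords v :: real^'m) = (\<Sum>b\<in>Basis. (v \<bullet> b) *\<^sub>R b)"
    using sum_basis_enum[OF card, of "\<lambda>b. (v \<bullet> b) *\<^sub>R b"] by (simp add: of_coords_def to_coords_def)
  then show "of_coords (to_coords v :: real^'m) = v" by (simp add: euclidean_representation)
  show "to_coords (of_coords y :: 'v) = (y :: real^'m)"
    by (simp add: vec_eq_iff to_coords_def of_coords_def inner_sum_left basis_enum_inner[OF card] if_distrib cong: if_cong)
qed

lemma linear_to_coords: "linear (to_coords :: 'v::euclidean_space \<Rightarrow> real^'m)"
  by (rule linearI) (simp_all add: to_coords_def vec_eq_iff inner_add_left)

lemma linear_of_coords: "linear (of_coords :: real^'m \<Rightarrow> 'v::euclidean_space)"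
  by (rule linearI) (simp_all add: of_coords_def scaleR_add_left sum.distrib scaleR_sum_right)

text \<open>Orthonormal coordinates match boxes with boxes of the same side lengths, and Lebesgue
  measure is determined by its values on boxes.\<close>

lemma distr_of_coords:
  assumes card: "CARD('m::finite) = DIM('v::euclidean_space)"
  shows "lborel = distr (lborel :: (real^'m) measure) borel (of_coords :: real^'m \<Rightarrow> 'v)"
proof (rule lborel_eqI)
  have meas: "(of_coords :: real^'m \<Rightarrow> 'v) \<in> borel_measurable lborel"
    using borel_measurable_continuous_onI[OF linear_continuous_on[OF linear_of_coords[unfolded linear_conv_bounded_linear]]]
    by simp
  fix l u :: 'v assume le: "\<And>b. b \<in> Basis \<Longrightarrow> l \<bullet> b \<le> u \<bullet> b"
  let ?e = "basis_enum :: 'm \<Rightarrow> 'v"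
  have eB: "?e i \<in> Basis" for i using bij_basis_enum[OF card] by (auto simp: bij_betw_def)
  have vec_basis: "(Basis :: (real^'m) set) = range (\<lambda>i. axis i 1)"
    by (auto simp: Basis_vec_def)
  have ofc: "of_coords y \<bullet> ?e i = y $ i" for y i
  proof -
    have "(to_coords (of_coords y :: 'v) :: real^'m) $ i = y $ i" by (simp only: to_of_coords[OF card])
    then show ?thesis by (simp add: to_coords_def)
  qed
  have "of_coords -` box l u = box (to_coords l) (to_coords u :: real^'m)"
  proof -
    have "of_coords y \<in> box l u \<longleftrightarrow> (\<forall>i. l \<bullet> ?e i < y $ i \<and> y $ i < u \<bullet> ?e i)" for y
    proof -
      have rB: "(Basis :: 'v set) = range ?e" using bij_betw_imp_surj_on[OF bij_basis_enum[OF card]] by simp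
      show ?thesis by (simp add: mem_box rB ofc)
    qed
    moreover have "y \<in> box (to_coords l) (to_coords u) \<longleftrightarrow> (\<forall>i. l \<bullet> ?e i < y $ i \<and> y $ i < u \<bullet> ?e i)" for y :: "real^'m"
      by (auto simp: mem_box vec_basis inner_axis to_coords_def)
    ultimately show ?thesis by auto
  qed
  then have "emeasure (distr lborel borel (of_coords :: real^'m \<Rightarrow> 'v)) (box l u)
      = emeasure lborel (box (to_coords l) (to_coords u :: real^'m))"
    by (subst emeasure_distr[OF meas]) auto
  also have "\<dots> = (\<Prod>b\<in>(Basis :: (real^'m) set). (to_coords u - to_coords l) \<bullet> b)"
    using le[OF eB] by (intro emeasure_lborel_box) (auto simp: vec_basis inner_axis to_coords_def)
  also have "(\<Prod>b\<in>(Basis :: (real^'m) set). (to_coords u - to_coords l) \<bullet> b) = (\<Prod>i\<in>(UNIV::'m set). (u - l) \<bullet> ?e i)"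
    unfolding vec_basis by (subst prod.reindex) (auto simp: inj_on_def axis_eq_axis inner_axis to_coords_def inner_diff_left)
  also have "\<dots> = (\<Prod>b\<in>Basis. (u - l) \<bullet> b)"
    using prod.reindex_bij_betw[OF bij_basis_enum[OF card], of "\<lambda>b. (u - l) \<bullet> b"] .
  finally show "emeasure (distr lborel borel (of_coords :: real^'m \<Rightarrow> 'v)) (box l u) = (\<Prod>b\<in>Basis. (u - l) \<bullet> b)" .
qed simp

lemma lebesgue_integral_borel_eq:
  fixes F :: "'v::euclidean_space \<Rightarrow> real"
  assumes "F \<in> borel_measurable borel"
  shows "integrable lebesgue F \<longleftrightarrow> integrable lborel F" "integral\<^sup>L lebesgue F = integral\<^sup>L lborel F"
  using assms integrable_completion[of F lborel] integral_completion[of F lborel] by auto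

text \<open>The real theorem is transported by conjugating \<open>g\<close> with the coordinate maps
  \<open>p\<close> and \<open>q\<close>; the matrix of the conjugated derivative is the one in
  \<open>real_det\<close>. \<open>F\<close> and \<open>F0\<close> vanish off the image and off
  \<open>S\<close>, so both integrals can run over the whole space.\<close>

lemma integral_change_of_variables_complex:
  fixes g :: "complex^'n \<Rightarrow> complex^'n" and F F0 :: "complex^'n \<Rightarrow> real"
  assumes S: "open S" and inj: "inj_on g S"
    and der: "\<And>z. z \<in> S \<Longrightarrow> (g has_derivative (\<lambda>v. A z *v v)) (at z)"
    and F: "integrable lborel F" "\<And>z. z \<notin> g ` S \<Longrightarrow> F z = 0"
    and F0: "F0 \<in> borel_measurable borel" "\<And>z. z \<notin> S \<Longrightarrow> F0 z = 0"
      "\<And>z. z \<in> S \<Longrightarrow> F0 z = \<bar>real_det (A z)\<bar> * F (g z)"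
  shows "integral\<^sup>L lborel F0 = integral\<^sup>L lborel F"
proof -
  define p :: "real^('n bit0) \<Rightarrow> complex^'n" where "p = of_coords"
  define q :: "complex^'n \<Rightarrow> real^('n bit0)" where "q = to_coords"
  note card = card_bit0_eq_DIM[where 'n='n]
  have pq: "p (q v) = v" "q (p y) = y" for v y
    unfolding p_def q_def using of_to_coords[OF card] to_of_coords[OF card] by auto
  have lp: "linear p" and lq: "linear q" unfolding p_def q_def by (rule linear_of_coords linear_to_coords)+
  have bp: "bounded_linear p" and bq: "bounded_linear q" using lp lq by (simp_all add: linear_conv_bounded_linear)
  have pm: "p \<in> borel_measurable lborel"
    using borel_measurable_continuous_onI[OF linear_continuous_on[OF bp]] by simp
  have int_p: "integral\<^sup>L lborel H = integral\<^sup>L lborel (\<lambda>y. H (p y))"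
    "integrable lborel H \<longleftrightarrow> integrable lborel (\<lambda>y. H (p y))"
    if "H \<in> borel_measurable borel" for H :: "complex^'n \<Rightarrow> real"
    using that integral_distr[OF pm, of H] integrable_distr_eq[OF pm, of H]
    unfolding distr_of_coords[OF card, folded p_def, symmetric] by auto
  have Fm: "F \<in> borel_measurable borel" using F(1) by (simp add: borel_measurable_integrable)
  have Fpm: "(\<lambda>y. F (p y)) \<in> borel_measurable borel" and F0pm: "(\<lambda>y. F0 (p y)) \<in> borel_measurable borel"
    using measurable_compose[OF pm Fm] measurable_compose[OF pm F0(1)] by simp_all
  define S' where "S' = q ` S"
  define g' where "g' y = q (g (p y))" for y
  have S'iff: "y \<in> S' \<longleftrightarrow> p y \<in> S" for y unfolding S'_def using pq by (metis image_iff)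
  have "S' = p -` S" using S'iff by auto
  then have "open S'" using S linear_continuous_on[OF bp, of UNIV] by (simp add: open_vimage)
  then have S'm: "S' \<in> sets lebesgue" by (metis borel_open sets_completionI_sets sets_lborel)
  have der': "(g' has_derivative (\<lambda>v. q (A (p y) *v p v))) (at y within S')" if "y \<in> S'" for y
  proof -
    have "(p has_derivative p) (at y)" using bounded_linear_imp_has_derivative[OF bp] .
    from has_derivative_compose[OF this der[OF that[unfolded S'iff]]]
    have "((\<lambda>y. g (p y)) has_derivative (\<lambda>v. A (p y) *v p v)) (at y)" .
    from bounded_linear.has_derivative[OF bq this] show ?thesis
      unfolding g'_def by (rule has_derivative_at_withinI)
  qed
  have inj': "inj_on g' S'"
  proof (rule inj_onI)
    fix x y assume xy: "x \<in> S'" "y \<in> S'" "g' x = g' y"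
    then have "g (p x) = g (p y)" unfolding g'_def using pq by metis
    then have "p x = p y" using inj xy S'iff by (auto dest: inj_onD)
    then show "x = y" using pq by metis
  qed
  have mat: "matrix (\<lambda>v. q (A (p y) *v p v)) = real_matrix (\<lambda>v. A (p y) *v v)" for y
  proof -
    have "p (axis j 1) = basis_enum j" for j
      by (simp add: p_def of_coords_def axis_def if_distrib if_distribR cong: if_cong)
    then show ?thesis by (simp add: matrix_def real_matrix_def q_def to_coords_def)
  qed
  \<comment> \<open>The change-of-variables theorem is applied to vector-valued integrands, so the
    scalar one is carried by \<open>real^1\<close>.\<close>
  define G where "G y = (vec (F (p y)) :: real^1)" for y
  have gS: "g' ` S' = q ` (g ` S)" unfolding g'_def S'_def using pq by (force simp: image_iff)
  have Fp0: "F (p y) = 0" if "y \<notin> g' ` S'" for y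
  proof -
    have "p y \<notin> g ` S" using that pq unfolding gS by (metis imageI)
    then show ?thesis by (rule F(2))
  qed
  have ind: "(\<lambda>y. indicator (g' ` S') y *\<^sub>R F (p y)) = (\<lambda>y. F (p y))"
    using Fp0 by (auto simp: indicator_def fun_eq_iff)
  have "integrable lebesgue (\<lambda>y. F (p y))"
    using F(1) int_p(2)[OF Fm] lebesgue_integral_borel_eq(1)[OF Fpm] by simp
  then have ai: "(\<lambda>y. F (p y)) absolutely_integrable_on (g' ` S')"
    unfolding set_integrable_def ind .
  have ival: "integral (g' ` S') (\<lambda>y. F (p y)) = integral\<^sup>L lborel F"
    using set_lebesgue_integral_eq_integral(2)[OF ai] lebesgue_integral_borel_eq(2)[OF Fpm] int_p(1)[OF Fm]
    unfolding set_lebesgue_integral_def ind by simp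
  have "(\<lambda>x. \<bar>det (matrix (\<lambda>v. q (A (p x) *v p v)))\<bar> *\<^sub>R G (g' x)) absolutely_integrable_on S' \<and>
      integral S' (\<lambda>x. \<bar>det (matrix (\<lambda>v. q (A (p x) *v p v)))\<bar> *\<^sub>R G (g' x)) = vec (integral\<^sup>L lborel F)"
    using has_absolute_integral_change_of_variables[OF S'm der' inj', of G "vec (integral\<^sup>L lborel F)"]
      ai ival by (simp add: G_def absolutely_integrable_on_1_iff integral_on_1_eq)
  then have cv: "(\<lambda>x. \<bar>real_det (A (p x))\<bar> * F (g (p x))) absolutely_integrable_on S'"
     "integral S' (\<lambda>x. \<bar>real_det (A (p x))\<bar> * F (g (p x))) = integral\<^sup>L lborel F"
    unfolding mat by (simp_all add: G_def absolutely_integrable_on_1_iff integral_on_1_eq g'_def pq real_det_def)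
  have ind0: "(\<lambda>x. indicator S' x *\<^sub>R (\<bar>real_det (A (p x))\<bar> * F (g (p x)))) = (\<lambda>x. F0 (p x))"
    using F0 S'iff by (auto simp: indicator_def fun_eq_iff)
  have "integral\<^sup>L lebesgue (\<lambda>x. F0 (p x)) = integral\<^sup>L lborel F"
    using set_lebesgue_integral_eq_integral(2)[OF cv(1)] cv(2)
    unfolding set_lebesgue_integral_def ind0 by simp
  then show ?thesis
    using lebesgue_integral_borel_eq(2)[OF F0pm] int_p(1)[OF F0(1)] by simp
qed

section \<open>Continuously differentiable functions\<close>

lemma continuously_differentiable_on_1_iff:
  assumes "open S"
  shows "continuously_differentiable_on 1 S f \<longleftrightarrow>
    (\<forall>x\<in>S. f differentiable (at x) \<and> (\<forall>v. isCont (\<lambda>x. frechet_derivative f (at x) v) x))"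
  using assms by (auto simp: One_nat_def continuous_on_eq_continuous_at)

lemma continuously_differentiable_on_1_local:
  assumes "open S" "\<And>x. x \<in> S \<Longrightarrow> \<exists>T. open T \<and> x \<in> T \<and> continuously_differentiable_on 1 T f"
  shows "continuously_differentiable_on 1 S f"
  using assms continuously_differentiable_on_1_iff by metis

lemma C1_imp_continuous_on: "continuously_differentiable_on 1 S f \<Longrightarrow> continuous_on S f"
  using continuously_differentiable_on_le[of 1 S f 0] by simp

lemma smooth_on_imp_C1: "smooth_on S f \<Longrightarrow> continuously_differentiable_on 1 S f"
  by (simp add: smooth_on_def)

lemma continuously_differentiable_on_1_compose:
  fixes f :: "'v::euclidean_space \<Rightarrow> 'c::real_normed_vector" and g :: "'u::real_normed_vector \<Rightarrow> 'v"
  assumes S: "open S" and T: "open T" and f: "continuously_differentiable_on 1 T f"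
    and g: "continuously_differentiable_on 1 S g" and gS: "g ` S \<subseteq> T"
  shows "continuously_differentiable_on 1 S (\<lambda>x. f (g x))"
proof -
  have fd: "f differentiable (at y)" "continuous_on T (\<lambda>x. frechet_derivative f (at x) v)" if "y \<in> T" for y v
    using f that by (auto simp: One_nat_def)
  have gd: "g differentiable (at x)" "continuous_on S (\<lambda>x. frechet_derivative g (at x) v)" if "x \<in> S" for x v
    using g that by (auto simp: One_nat_def)
  have gc: "continuous_on S g"
    using continuously_differentiable_on_Suc_imp[of 0 S g] g by simp
  have der: "((\<lambda>x. f (g x)) has_derivative (\<lambda>v. frechet_derivative f (at (g x)) (frechet_derivative g (at x) v))) (at x)"
    if x: "x \<in> S" for x
    using has_derivative_compose[OF gd(1)[OF x, unfolded frechet_derivative_works]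
        fd(1)[of "g x", unfolded frechet_derivative_works]] x gS by blast
  have "continuous_on S (\<lambda>x. frechet_derivative (\<lambda>x. f (g x)) (at x) v)" for v
  proof (cases "S = {}")
    case False
    then obtain x0 where x0: "x0 \<in> S" by blast
    \<comment> \<open>Continuity of the derivative of \<open>f\<close> is known for each fixed
      direction only, so the direction moving with \<open>x\<close> is expanded in the
      basis.\<close>
    have "frechet_derivative (\<lambda>x. f (g x)) (at x) v
       = (\<Sum>b\<in>Basis. (frechet_derivative g (at x) v \<bullet> b) *\<^sub>R frechet_derivative f (at (g x)) b)" if x: "x \<in> S" for x
    proof -
      have lin: "linear (frechet_derivative f (at (g x)))"
        using fd(1)[of "g x"] x gS by (intro linear_frechet_derivative) blast
      have "frechet_derivative (\<lambda>x. f (g x)) (at x) v = frechet_derivative f (at (g x)) (\<Sum>b\<in>Basis. (frechet_derivative g (at x) v \<bullet> b) *\<^sub>R b)"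
        unfolding euclidean_representation using frechet_derivative_eqI[OF der[OF x]] .
      then show ?thesis by (simp add: linear_sum[OF lin] linear_cmul[OF lin])
    qed
    moreover have "continuous_on S (\<lambda>x. \<Sum>b\<in>Basis. (frechet_derivative g (at x) v \<bullet> b) *\<^sub>R frechet_derivative f (at (g x)) b)"
      using gd(2)[OF x0, of v] fd(2)[of "g x0"] x0 gS
      by (intro continuous_on_sum continuous_on_scaleR continuous_on_inner continuous_on_const
          continuous_on_compose2[OF fd(2) gc gS]) blast+
    ultimately show ?thesis by (simp cong: continuous_on_cong)
  qed simp
  moreover have "\<forall>x\<in>S. (\<lambda>x. f (g x)) differentiable at x" using der differentiableI by blast
  ultimately show ?thesis by (simp add: One_nat_def)
qed

text \<open>The components of a derivative are combinations of the \<open>dz k\<close>, which are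
  continuous by Cauchy's formula.\<close>

lemma continuously_differentiable_on_1_holomorphic:
  fixes T :: "complex^'n \<Rightarrow> complex^'m"
  assumes S: "open S" and d: "\<And>z. z \<in> S \<Longrightarrow> T differentiable (at z)"
    and hol: "\<And>p. holomorphic_vec S (\<lambda>z. T z $ p)"
  shows "continuously_differentiable_on 1 S T"
proof -
  have "continuous_on S (\<lambda>z. frechet_derivative T (at z) v)" for v
  proof -
    have "frechet_derivative T (at z) v = (\<chi> p. \<Sum>k\<in>UNIV. v $ k * dz k (\<lambda>z. T z $ p) z)" if "z \<in> S" for z
      using frechet_derivative_linear[OF bounded_linear_vec_nth d[OF that]]
        holomorphic_vec_frechet_derivative[OF hol that] by (simp add: vec_eq_iff)
    moreover have "continuous_on S (\<lambda>z. \<chi> p. \<Sum>k\<in>UNIV. v $ k * dz k (\<lambda>z. T z $ p) z)"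
      by (intro continuous_on_vec_lambda continuous_intros holomorphic_vec_dz_continuous[OF hol S])
    ultimately show ?thesis by (simp cong: continuous_on_cong)
  qed
  then show ?thesis using d by (simp add: One_nat_def)
qed

lemma has_real_derivative_max_0_square:
  "((\<lambda>t::real. (max 0 t)\<^sup>2) has_real_derivative 2 * max 0 t) (at t)"
proof -
  consider "t < 0" | "t > 0" | "t = 0" by linarith
  then show ?thesis
  proof cases
    case 1
    have "((\<lambda>t::real. 0) has_real_derivative 2 * max 0 t) (at t)" using 1 by simp
    then show ?thesis
      by (rule has_field_derivative_transform_within_open[of _ _ _ "{..<0}"]) (use 1 in auto)
  next
    case 2
    have "((\<lambda>t::real. t\<^sup>2) has_real_derivative 2 * max 0 t) (at t)"
      using 2 by (auto intro!: derivative_eq_intros)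
    then show ?thesis
      by (rule has_field_derivative_transform_within_open[of _ _ _ "{0<..}"]) (use 2 in auto)
  next
    case 3
    have "((\<lambda>t::real. (max 0 t)\<^sup>2 / t) \<longlongrightarrow> 0) (at 0)"
    proof (rule Lim_null_comparison)
      show "\<forall>\<^sub>F t::real in at 0. norm ((max 0 t)\<^sup>2 / t) \<le> \<bar>t\<bar>"
        by (auto simp: max_def power2_eq_square intro!: always_eventually)
      show "((\<lambda>t::real. \<bar>t\<bar>) \<longlongrightarrow> 0) (at 0)" by (rule tendsto_eq_intros | simp)+
    qed
    then show ?thesis using 3 by (simp add: has_field_derivative_iff)
  qed
qed

text \<open>The squared positive part is once continuously differentiable, which is all that the
  integration by parts asks of a cut-off function.\<close>

definition bump :: "'v::euclidean_space \<Rightarrow> real \<Rightarrow> 'v \<Rightarrow> real" where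
  "bump a r w = (max 0 (r\<^sup>2 - (w - a) \<bullet> (w - a)))\<^sup>2"

lemma C1_bump: "continuously_differentiable_on 1 UNIV (bump a r)"
  unfolding bump_def
proof (rule continuously_differentiable_on_1_compose[where T = UNIV and f = "\<lambda>t::real. (max 0 t)\<^sup>2"])
  have "frechet_derivative (\<lambda>t::real. (max 0 t)\<^sup>2) (at t) v = 2 * max 0 t * v" for t v
    using frechet_derivative_eqI[OF has_real_derivative_max_0_square[of t, unfolded has_field_derivative_def]] .
  then show "continuously_differentiable_on 1 UNIV (\<lambda>t::real. (max 0 t)\<^sup>2)"
    using has_real_derivative_max_0_square
    by (auto simp: One_nat_def has_field_derivative_def intro!: differentiableI continuous_intros)
next
  have der: "((\<lambda>w. r\<^sup>2 - (w - a) \<bullet> (w - a)) has_derivative (\<lambda>v. - (2 * ((w - a) \<bullet> v)))) (at w)" for w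
    by (auto intro!: derivative_eq_intros simp: inner_commute)
  have "frechet_derivative (\<lambda>w. r\<^sup>2 - (w - a) \<bullet> (w - a)) (at w) v = - (2 * ((w - a) \<bullet> v))" for w v
    by (rule frechet_derivative_eqI[OF der])
  then show "continuously_differentiable_on 1 UNIV (\<lambda>w. r\<^sup>2 - (w - a) \<bullet> (w - a))"
    using der by (auto simp: One_nat_def intro!: differentiableI continuous_intros)
qed auto

lemma bump_nonneg: "bump a r w \<ge> 0" by (simp add: bump_def)

lemma bump_pos: "w \<in> ball a r \<Longrightarrow> bump a r w > 0"
proof -
  assume w: "w \<in> ball a r"
  then have "(norm (w - a))\<^sup>2 < r\<^sup>2"
    by (intro power_strict_mono) (auto simp: dist_norm norm_minus_commute)
  then show ?thesis by (simp add: bump_def dot_square_norm)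
qed

lemma bump_zero: "r > 0 \<Longrightarrow> w \<notin> cball a r \<Longrightarrow> bump a r w = 0"
proof -
  assume w: "r > 0" "w \<notin> cball a r"
  then have "r\<^sup>2 \<le> (norm (w - a))\<^sup>2"
    by (intro power_mono) (auto simp: dist_norm norm_minus_commute)
  then show ?thesis by (simp add: bump_def dot_square_norm)
qed

context lck_chart
begin

text \<open>\<open>dz_vol_density\<close> shows that the \<open>dz\<close> derivatives are
  continuous; the density is real, so the \<open>dzbar\<close> derivatives are their
  conjugates.\<close>

lemma C1_vol_density: "continuously_differentiable_on 1 S (\<lambda>w. complex_of_real (vol_density (G w)))"
proof -
  let ?f = "\<lambda>w. complex_of_real (vol_density (G w))"
  have "continuous_on S (\<lambda>w. frechet_derivative ?f (at w) v)" for v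
  proof -
    define a where "a k w = ?f w * (\<Sum>i\<in>UNIV. \<Sum>j\<in>UNIV. h w i j * dz k (\<lambda>w. G w $ i $ j) w)" for k w
    have sm: "smooth_on S (\<lambda>w. \<Sum>i\<in>UNIV. \<Sum>j\<in>UNIV. h w i j * dz k (\<lambda>w. G w $ i $ j) w)" for k
      by (intro smooth_rules)
    have "continuous_on S (a k)" for k
      unfolding a_def[abs_def]
      by (intro continuous_on_mult continuous_on_of_real vol_density_continuous smooth_on_imp_continuous_on[OF sm])
    then have "continuous_on S (\<lambda>w. \<Sum>k\<in>UNIV. v $ k * a k w + cnj (v $ k) * cnj (a k w))"
      by (intro continuous_intros)
    moreover have "frechet_derivative ?f (at w) v = (\<Sum>k\<in>UNIV. v $ k * a k w + cnj (v $ k) * cnj (a k w))" if w: "w \<in> S" for w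
    proof -
      have "dzbar k ?f w = cnj (dz k ?f w)" for k
        using dzbar_cnj[OF vol_density_differentiable[OF w], of k] by simp
      then show ?thesis
        unfolding frechet_derivative_eq_dz_dzbar[OF vol_density_differentiable[OF w]]
        by (simp only: dz_vol_density[OF w] a_def)
    qed
    ultimately show ?thesis by (simp cong: continuous_on_cong)
  qed
  then show ?thesis using vol_density_differentiable by (simp add: One_nat_def)
qed

end

section \<open>The exterior derivative of the fundamental form\<close>

lemma fundamental_form_axis:
  fixes H :: "complex^'n \<Rightarrow> complex^'n^'n"
  shows "fundamental_form H x (axis i s) (axis j t) = \<i> * (H x $ i $ j * (s * cnj t) - H x $ j $ i * (t * cnj s))"
proof -
  have inner: "(\<Sum>b\<in>UNIV. F b * (y * cnj ((axis j t :: complex^'n) $ b))) = F j * (y * cnj t)" for F y j t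
  proof -
    have "(\<Sum>b\<in>UNIV. F b * (y * cnj ((axis j t :: complex^'n) $ b))) = (\<Sum>b\<in>UNIV. if b = j then F b * (y * cnj t) else 0)"
      by (intro sum.cong refl) (simp add: axis_def)
    then show ?thesis by simp
  qed
  have outer: "(\<Sum>a\<in>UNIV. F a * ((axis i s :: complex^'n) $ a * y)) = F i * (s * y)" for F y i s
  proof -
    have "(\<Sum>a\<in>UNIV. F a * ((axis i s :: complex^'n) $ a * y)) = (\<Sum>a\<in>UNIV. if a = i then F a * (s * y) else 0)"
      by (intro sum.cong refl) (simp add: axis_def)
    then show ?thesis by simp
  qed
  have *: "(\<Sum>a\<in>UNIV. \<Sum>b\<in>UNIV. H x $ a $ b * ((axis i s :: complex^'n) $ a * cnj (axis j t $ b)))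
      = H x $ i $ j * (s * cnj t)" for i j s t
    unfolding inner outer ..
  show ?thesis
    unfolding fundamental_form_def right_diff_distrib sum_subtractf * ..
qed

text \<open>Closedness is given on real tangent vectors. Extended complex multilinearly and
  evaluated on two (1,0)-vectors and one (0,1)-vector, it becomes the asserted symmetry.\<close>

lemma closed_fundamental_form_dz:
  fixes H :: "complex^'n \<Rightarrow> complex^'n^'n"
  assumes d: "\<And>i j. (\<lambda>w. H w $ i $ j) differentiable (at z)"
    and closed: "\<And>u v w. exterior_derivative2 (fundamental_form H) z u v w = 0"
  shows "dz k (\<lambda>w. H w $ i $ j) z = dz i (\<lambda>w. H w $ k $ j) z"
proof -
  define P where "P i j k = dz k (\<lambda>w. H w $ i $ j) z" for i j k
  define Q where "Q i j k = dzbar k (\<lambda>w. H w $ i $ j) z" for i j k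
  have fr: "frechet_derivative (\<lambda>w. H w $ i $ j) (at z) (axis k s) = s * P i j k + cnj s * Q i j k" for i j k s
  proof -
    have "frechet_derivative (\<lambda>w. H w $ i $ j) (at z) (axis k s)
      = (\<Sum>a\<in>UNIV. if a = k then s * P i j k + cnj s * Q i j k else 0)"
      unfolding frechet_derivative_eq_dz_dzbar[OF d] P_def Q_def
      by (intro sum.cong refl) (auto simp: axis_def)
    then show ?thesis by simp
  qed
  have fr2: "frechet_derivative (\<lambda>w. \<i> * (H w $ i $ j * a - H w $ j $ i * b)) (at z) (axis k s)
      = \<i> * ((s * P i j k + cnj s * Q i j k) * a - (s * P j i k + cnj s * Q j i k) * b)" for i j k s a b
  proof -
    have "((\<lambda>w. \<i> * (H w $ i $ j * a - H w $ j $ i * b)) has_derivative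
       (\<lambda>v. \<i> * (frechet_derivative (\<lambda>w. H w $ i $ j) (at z) v * a - frechet_derivative (\<lambda>w. H w $ j $ i) (at z) v * b))) (at z)"
      by (intro has_derivative_mult_right has_derivative_diff has_derivative_mult_left d[unfolded frechet_derivative_works])
    from frechet_derivative_eqI[OF this] show ?thesis by (simp only: fr)
  qed
  define E where "E s t r = exterior_derivative2 (fundamental_form H) z (axis k s) (axis i t) (axis j r)" for s t r
  have E: "E s t r = \<i> * ((s * P i j k + cnj s * Q i j k) * (t * cnj r) - (s * P j i k + cnj s * Q j i k) * (r * cnj t))
      - \<i> * ((t * P k j i + cnj t * Q k j i) * (s * cnj r) - (t * P j k i + cnj t * Q j k i) * (r * cnj s))
      + \<i> * ((r * P k i j + cnj r * Q k i j) * (s * cnj t) - (r * P i k j + cnj r * Q i k j) * (t * cnj s))" for s t r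
    unfolding E_def exterior_derivative2_def fundamental_form_axis fr2 ..
  have E0: "E s t r = 0" for s t r unfolding E_def by (rule closed)
  \<comment> \<open>With J for multiplication by \<i>, this applies 1 - \<i> J in the first two
    slots and 1 + \<i> J in the third, expanded into eight real evaluations. The three omitted
    factors 1/2 account for the 8.\<close>
  have "(E 1 1 1 - \<i> * E \<i> 1 1 - \<i> * E 1 \<i> 1 - E \<i> \<i> 1)
      + \<i> * (E 1 1 \<i> - \<i> * E \<i> 1 \<i> - \<i> * E 1 \<i> \<i> - E \<i> \<i> \<i>) = 8 * \<i> * (P i j k - P k j i)"
    unfolding E by (simp add: algebra_simps)
  then have "P i j k = P k j i" unfolding E0 by simp
  then show ?thesis by (simp add: P_def)
qed

text \<open>A 3-form on a space of real dimension 2 vanishes; this is checked in the single complex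
  coordinate.\<close>

lemma exterior_derivative2_one_dimensional:
  fixes H :: "complex^'n \<Rightarrow> complex^'n^'n"
  assumes n: "CARD('n) = 1" and d: "\<And>i j. (\<lambda>w. H w $ i $ j) differentiable (at z)"
  shows "exterior_derivative2 (fundamental_form H) z u v w = 0"
proof -
  obtain o1 :: 'n where o1: "UNIV = {o1}" using n card_1_singletonE by blast
  have ff: "fundamental_form H x u v = \<i> * ((u $ o1 * cnj (v $ o1) - v $ o1 * cnj (u $ o1)) * H x $ o1 $ o1)" for x u v
    by (simp add: fundamental_form_def o1 mult_ac)
  have fr: "frechet_derivative (\<lambda>x. \<i> * (a * H x $ o1 $ o1)) (at z) y
     = \<i> * (a * (y $ o1 * dz o1 (\<lambda>w. H w $ o1 $ o1) z + cnj (y $ o1) * dzbar o1 (\<lambda>w. H w $ o1 $ o1) z))" for a y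
  proof -
    have "((\<lambda>x. \<i> * (a * H x $ o1 $ o1)) has_derivative
      (\<lambda>y. \<i> * (a * frechet_derivative (\<lambda>w. H w $ o1 $ o1) (at z) y))) (at z)"
      by (intro has_derivative_mult_right d[unfolded frechet_derivative_works])
    from frechet_derivative_eqI[OF this] show ?thesis
      by (simp add: frechet_derivative_eq_dz_dzbar[OF d] o1)
  qed
  show ?thesis
    unfolding exterior_derivative2_def ff fr by (simp add: algebra_simps)
qed

text \<open>At a critical point of \<open>f\<close> the product rule has no term in df, and the
  positive factor \<open>exp (f z)\<close> can be cancelled.\<close>

lemma exterior_derivative2_scale:
  fixes H :: "complex^'n \<Rightarrow> complex^'n^'n" and f :: "complex^'n \<Rightarrow> real"
  assumes d: "\<And>i j. (\<lambda>w. H w $ i $ j) differentiable (at z)"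
    and f: "(f has_derivative (\<lambda>v. 0)) (at z)"
    and closed: "exterior_derivative2 (fundamental_form (\<lambda>w. exp (f w) *\<^sub>R H w)) z u v w = 0"
  shows "exterior_derivative2 (fundamental_form H) z u v w = 0"
proof -
  have ff: "fundamental_form (\<lambda>w. exp (f w) *\<^sub>R H w) x u v = exp (f x) *\<^sub>R fundamental_form H x u v" for x u v
    unfolding fundamental_form_def vector_scaleR_component
    by (simp add: scaleR_conv_of_real sum_distrib_left mult_ac)
  have dff: "(\<lambda>x. fundamental_form H x u v) differentiable (at z)" for u v
    unfolding fundamental_form_def using d by (intro differentiable_mult differentiable_sum differentiable_const) auto
  have "((\<lambda>x. exp (f x)) has_derivative (\<lambda>v. 0)) (at z)"
    using has_derivative_compose[OF f, of exp "(*) (exp (f z))"] DERIV_exp[of "f z"]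
    by (simp add: has_field_derivative_def)
  then have "((\<lambda>x. exp (f x) *\<^sub>R fundamental_form H x u v) has_derivative
      (\<lambda>y. exp (f z) *\<^sub>R frechet_derivative (\<lambda>x. fundamental_form H x u v) (at z) y + 0 *\<^sub>R fundamental_form H z u v)) (at z)" for u v
    by (rule has_derivative_scaleR) (rule dff[unfolded frechet_derivative_works])
  from frechet_derivative_eqI[OF this]
  have fr: "frechet_derivative (\<lambda>x. exp (f x) *\<^sub>R fundamental_form H x u v) (at z) y
     = exp (f z) *\<^sub>R frechet_derivative (\<lambda>x. fundamental_form H x u v) (at z) y" for u v y by simp
  have "exp (f z) *\<^sub>R exterior_derivative2 (fundamental_form H) z u v w = 0"
    using closed unfolding exterior_derivative2_def ff fr by (simp add: scaleR_diff_right scaleR_add_right)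
  then show ?thesis by simp
qed

section \<open>Locally conformal Kaehler manifolds\<close>

locale lck_manifold =
  fixes A :: "('a::{t2_space, second_countable_topology}, 'n::finite) chart set" and g :: "('a, 'n) metric"
  assumes atlas: "complex_atlas A" and metric: "hermitian_metric A g"
    and lckm: "locally_conformal_kaehler A g" and n2: "CARD('n) \<ge> 2"
begin

abbreviation "cdom c \<equiv> snd c ` fst c"

lemma
  assumes "c \<in> A"
  shows open_fst: "open (fst c)" and open_dom: "open (cdom c)"
    and homeo: "homeomorphism (fst c) (cdom c) (snd c) (chart_inv c)"
  using atlas assms by (auto simp: complex_atlas_def)

lemma
  assumes "c \<in> A"
  shows inv_chart: "p \<in> fst c \<Longrightarrow> chart_inv c (snd c p) = p"
    and chart_inv: "z \<in> cdom c \<Longrightarrow> snd c (chart_inv c z) = z"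
    and chart_inv_in: "z \<in> cdom c \<Longrightarrow> chart_inv c z \<in> fst c"
    and cont_chart: "continuous_on (fst c) (snd c)"
    and cont_inv: "continuous_on (cdom c) (chart_inv c)"
  using homeo[OF assms] unfolding homeomorphism_def by auto

lemma open_image_chart:
  assumes c: "c \<in> A" and V: "open V"
  shows "open (snd c ` (fst c \<inter> V))"
proof -
  have "openin (top_of_set (fst c)) (fst c \<inter> V)" using V by (simp add: openin_open_Int)
  then have "openin (top_of_set (cdom c)) (snd c ` (fst c \<inter> V))"
    using homeomorphism_imp_open_map[OF homeo[OF c]] by blast
  then show ?thesis using open_dom[OF c] openin_open_trans by blast
qed

lemma image_chart_iff:
  assumes c: "c \<in> A"
  shows "z \<in> snd c ` (fst c \<inter> V) \<longleftrightarrow> z \<in> cdom c \<and> chart_inv c z \<in> V"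
proof
  assume "z \<in> snd c ` (fst c \<inter> V)"
  then show "z \<in> cdom c \<and> chart_inv c z \<in> V" using inv_chart[OF c] by auto
next
  assume "z \<in> cdom c \<and> chart_inv c z \<in> V"
  then have "chart_inv c z \<in> fst c \<inter> V" "z = snd c (chart_inv c z)"
    using chart_inv_in[OF c] chart_inv[OF c] by auto
  then show "z \<in> snd c ` (fst c \<inter> V)" by blast
qed

definition chart_at :: "'a \<Rightarrow> ('a, 'n) chart" where
  "chart_at p = (SOME c. c \<in> A \<and> p \<in> fst c)"

lemma chart_at: "chart_at p \<in> A" "p \<in> fst (chart_at p)"
proof -
  have "\<exists>c. c \<in> A \<and> p \<in> fst c" using atlas unfolding complex_atlas_def by blast
  from someI_ex[OF this] show "chart_at p \<in> A" "p \<in> fst (chart_at p)" by (auto simp: chart_at_def)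
qed

lemma pd: "c \<in> A \<Longrightarrow> z \<in> cdom c \<Longrightarrow> hermitian_pd (g c z)"
  using metric unfolding hermitian_metric_def hermitian_pd_def by blast

lemma smooth_g: "c \<in> A \<Longrightarrow> smooth_on (cdom c) (g c)"
  using metric unfolding hermitian_metric_def by blast

text \<open>The sign appears because \<open>conformal_change\<close> multiplies \<open>g\<close> by
  exp f, while \<open>lck_chart\<close> takes exp (- u) times the metric to be Kaehler. Expanding
  the closedness of the rescaled form by the product rule and cancelling the exponential gives the
  torsion relation.\<close>

lemma local_lck:
  assumes V: "open V" and f: "smooth_function_on A V f" and k: "kaehler_on A V (conformal_change f g)"
    and c: "c \<in> A"
  shows "lck_chart (snd c ` (fst c \<inter> V)) (g c) (\<lambda>z. complex_of_real (- f (chart_inv c z)))"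
proof
  let ?S = "snd c ` (fst c \<inter> V)"
  show S: "open ?S" by (rule open_image_chart[OF c V])
  have sub: "?S \<subseteq> cdom c" by blast
  show G: "smooth_on ?S (g c)" by (rule smooth_on_subset[OF smooth_g[OF c] sub])
  show "hermitian_pd (g c z)" if "z \<in> ?S" for z using pd[OF c] that by blast
  have sf: "smooth_on ?S (\<lambda>z. f (chart_inv c z))"
    using f c unfolding smooth_function_on_def by (simp add: o_def)
  show "smooth_on ?S (\<lambda>z. complex_of_real (- f (chart_inv c z)))"
    by (rule smooth_on_linear[OF bounded_linear_of_real S smooth_on_minus[OF S sf]])
  show "cnj (complex_of_real (- f (chart_inv c z))) = complex_of_real (- f (chart_inv c z))" for z by simp
  fix z i j k' assume z: "z \<in> ?S"
  define F where "F = (\<lambda>z. complex_of_real (f (chart_inv c z)))"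
  have Fd: "F differentiable (at z)"
    unfolding F_def using smooth_on_imp_differentiable[OF smooth_on_linear[OF bounded_linear_of_real S sf] z] .
  note eF = frechet_derivative_exp[OF Fd]
  have Gd: "(\<lambda>w. g c w $ i $ j) differentiable (at z)" for i j
    using smooth_on_imp_differentiable[OF smooth_on_vec_nth[OF S smooth_on_vec_nth[OF S G]] z] .
  define H where "H = (\<lambda>w. exp (f (chart_inv c w)) *\<^sub>R g c w)"
  have Hij: "(\<lambda>w. H w $ i $ j) = (\<lambda>w. exp (F w) * g c w $ i $ j)" for i j
    unfolding H_def F_def vector_scaleR_component by (simp add: exp_of_real scaleR_conv_of_real)
  have Hd: "(\<lambda>w. H w $ i $ j) differentiable (at z)" for i j
    unfolding Hij using eF(1) Gd by simp
  have closed: "exterior_derivative2 (fundamental_form H) z u v w = 0" for u v w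
    using k c z unfolding kaehler_on_def conformal_change_def H_def by blast
  have dzeF: "dz k (\<lambda>w. exp (F w)) z = exp (F z) * dz k F z" for k
    unfolding dz_def eF(2) by (simp add: algebra_simps)
  have "dz k' (\<lambda>w. H w $ i $ j) z = dz i (\<lambda>w. H w $ k' $ j) z"
    by (rule closed_fundamental_form_dz[OF Hd closed])
  then have "exp (F z) * (dz k' (\<lambda>w. g c w $ i $ j) z + dz k' F z * g c z $ i $ j)
     = exp (F z) * (dz i (\<lambda>w. g c w $ k' $ j) z + dz i F z * g c z $ k' $ j)"
    unfolding Hij dz_mult[OF eF(1) Gd] dzeF by (simp add: algebra_simps)
  then have "dz k' (\<lambda>w. g c w $ i $ j) z + dz k' F z * g c z $ i $ j
     = dz i (\<lambda>w. g c w $ k' $ j) z + dz i F z * g c z $ k' $ j" by simp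
  moreover have "dz k (\<lambda>z. complex_of_real (- f (chart_inv c z))) z = - dz k F z" for k
    using dz_minus[OF Fd] by (simp add: F_def)
  ultimately show "dz k' (\<lambda>w. g c w $ i $ j) z - dz i (\<lambda>w. g c w $ k' $ j) z
     = dz k' (\<lambda>z. complex_of_real (- f (chart_inv c z))) z * g c z $ i $ j
       - dz i (\<lambda>z. complex_of_real (- f (chart_inv c z))) z * g c z $ k' $ j"
    by (simp add: algebra_simps)
qed

lemma local_conformal:
  obtains V f where "open V" "p \<in> V" "\<And>c. c \<in> A \<Longrightarrow> smooth_on (snd c ` (fst c \<inter> V)) (\<lambda>z. f (chart_inv c z))"
    "kaehler_on A V (conformal_change f g)"
    "\<And>c. c \<in> A \<Longrightarrow> lck_chart (snd c ` (fst c \<inter> V)) (g c) (\<lambda>z. complex_of_real (- f (chart_inv c z)))"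
proof -
  obtain V f where *: "open V" "p \<in> V" "smooth_function_on A V f" "kaehler_on A V (conformal_change f g)"
    using lckm unfolding locally_conformal_kaehler_def by blast
  have "smooth_on (snd c ` (fst c \<inter> V)) (\<lambda>z. f (chart_inv c z))" if "c \<in> A" for c
    using *(3) that unfolding smooth_function_on_def o_def by blast
  from that[OF *(1,2) this *(4) local_lck[OF *(1,3,4)]] show ?thesis .
qed

text \<open>A single \<open>f\<close> on the manifold serves all charts, which makes the Lee forms
  of two charts comparable.\<close>

lemma local_lck_function:
  "\<exists>V f. open V \<and> p \<in> V \<and> (\<forall>c\<in>A. lck_chart (snd c ` (fst c \<inter> V)) (g c) (\<lambda>z. complex_of_real (- f (chart_inv c z))))"
proof (rule local_conformal[of p])
  fix V f assume V: "open V" "p \<in> V"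
    and lk: "\<And>c. c \<in> A \<Longrightarrow> lck_chart (snd c ` (fst c \<inter> V)) (g c) (\<lambda>z. complex_of_real (- f (chart_inv c z)))"
  show ?thesis by (rule exI[of _ V], rule exI[of _ f]) (intro conjI ballI V lk)
qed

lemma local_chart:
  assumes c: "c \<in> A" and z: "z \<in> cdom c"
  obtains S u where "z \<in> S" "S \<subseteq> cdom c" "lck_chart S (g c) u"
proof -
  obtain V f where V: "open V" "chart_inv c z \<in> V"
    "\<And>c. c \<in> A \<Longrightarrow> lck_chart (snd c ` (fst c \<inter> V)) (g c) (\<lambda>z. complex_of_real (- f (chart_inv c z)))"
    using local_lck_function[of "chart_inv c z"] by blast
  have "z \<in> snd c ` (fst c \<inter> V)" using image_chart_iff[OF c] z V(2) by blast
  then show ?thesis using that[OF _ _ V(3)[OF c]] by blast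
qed

text \<open>Regularity is a local matter, and locally the Lee form is the derivative of a smooth
  function.\<close>

lemma lee_smooth: "c \<in> A \<Longrightarrow> continuously_differentiable_on 1 (cdom c) (\<lambda>w. lee_form (g c) w k)"
proof (rule continuously_differentiable_on_1_local[OF open_dom])
  fix z assume c: "c \<in> A" and z: "z \<in> cdom c"
  obtain S u where S: "z \<in> S" "S \<subseteq> cdom c" "lck_chart S (g c) u" using local_chart[OF c z] .
  have "smooth_on S (\<lambda>w. lee_form (g c) w k) \<longleftrightarrow> smooth_on S (dz k u)"
    by (rule smooth_on_cong[OF lck_chart.S[OF S(3)]]) (rule lck_chart.lee_form_eq[OF S(3) _ n2])
  moreover have "smooth_on S (dz k u)"
    by (rule smooth_on_dz[OF lck_chart.S[OF S(3)] lck_chart.u[OF S(3)]])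
  ultimately show "\<exists>T. open T \<and> z \<in> T \<and> continuously_differentiable_on 1 T (\<lambda>w. lee_form (g c) w k)"
    using S(1) lck_chart.S[OF S(3)] smooth_on_imp_C1 by blast
qed

lemma lee_continuous: "c \<in> A \<Longrightarrow> continuous_on (cdom c) (\<lambda>w. lee_form (g c) w k)"
  by (rule C1_imp_continuous_on[OF lee_smooth])

lemma lee_differentiable: "c \<in> A \<Longrightarrow> z \<in> cdom c \<Longrightarrow> (\<lambda>w. lee_form (g c) w k) differentiable (at z)"
  using lee_smooth[of c k] by (auto simp: One_nat_def)

lemma lee_divergence_continuous: "c \<in> A \<Longrightarrow> continuous_on (cdom c) (lee_divergence (g c))"
proof -
  assume c: "c \<in> A"
  have "isCont (lee_divergence (g c)) z" if z: "z \<in> cdom c" for z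
  proof -
    obtain S u where S: "z \<in> S" "S \<subseteq> cdom c" "lck_chart S (g c) u" using local_chart[OF c z] .
    from smooth_on_imp_continuous_on[OF lck_chart.smooth_lee_divergence[OF S(3) n2]]
    show ?thesis using S(1) lck_chart.S[OF S(3)] by (simp add: continuous_on_eq_continuous_at)
  qed
  then show ?thesis by (simp add: continuous_at_imp_continuous_on)
qed

lemma inverse_metric_continuous: "c \<in> A \<Longrightarrow> continuous_on (cdom c) (\<lambda>w. inverse_metric (g c w) p q)"
proof -
  assume c: "c \<in> A"
  have "smooth_on (cdom c) (\<lambda>w. matrix_inv (g c w) $ q $ p)"
    by (rule smooth_on_matrix_inv[OF open_dom[OF c]])
      (use smooth_on_vec_nth[OF open_dom[OF c] smooth_on_vec_nth[OF open_dom[OF c] smooth_g[OF c]]]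
        hermitian_pd_det_nonzero[OF pd[OF c]] in auto)
  then show ?thesis unfolding inverse_metric_def by (rule smooth_on_imp_continuous_on)
qed

lemma vol_density_C1: "c \<in> A \<Longrightarrow> continuously_differentiable_on 1 (cdom c) (\<lambda>w. complex_of_real (vol_density (g c w)))"
proof (rule continuously_differentiable_on_1_local[OF open_dom])
  fix z assume c: "c \<in> A" and z: "z \<in> cdom c"
  obtain S u where S: "z \<in> S" "S \<subseteq> cdom c" "lck_chart S (g c) u" using local_chart[OF c z] .
  show "\<exists>T. open T \<and> z \<in> T \<and> continuously_differentiable_on 1 T (\<lambda>w. complex_of_real (vol_density (g c w)))"
    using S(1) lck_chart.S[OF S(3)] lck_chart.C1_vol_density[OF S(3)] by blast
qed

lemma vol_density_continuous: "c \<in> A \<Longrightarrow> continuous_on (cdom c) (\<lambda>w. vol_density (g c w))"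
proof -
  assume c: "c \<in> A"
  have "continuous_on (cdom c) (\<lambda>w. Re (complex_of_real (vol_density (g c w))))"
    by (rule continuous_on_Re[OF C1_imp_continuous_on[OF vol_density_C1[OF c]]])
  then show ?thesis by simp
qed

lemma vol_density_pos: "c \<in> A \<Longrightarrow> z \<in> cdom c \<Longrightarrow> vol_density (g c z) > 0"
  using local_chart lck_chart.vol_density_pos by metis

section \<open>Transition maps and transformation laws\<close>

definition overlap :: "('a, 'n) chart \<Rightarrow> ('a, 'n) chart \<Rightarrow> (complex^'n) set" where
  "overlap c c' = snd c ` (fst c \<inter> fst c')"

definition jac :: "('a, 'n) chart \<Rightarrow> ('a, 'n) chart \<Rightarrow> complex^'n \<Rightarrow> complex^'n^'n" where
  "jac c c' z = (\<chi> p k. dz k (\<lambda>w. transition c c' w $ p) z)"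

context
  fixes c c' assumes c: "c \<in> A" and c': "c' \<in> A"
begin

lemma open_overlap: "open (overlap c c')"
  unfolding overlap_def by (rule open_image_chart[OF c open_fst[OF c']])

lemma overlap_iff: "z \<in> overlap c c' \<longleftrightarrow> z \<in> cdom c \<and> chart_inv c z \<in> fst c'"
  unfolding overlap_def by (rule image_chart_iff[OF c])

lemma transition_in: "z \<in> overlap c c' \<Longrightarrow> transition c c' z \<in> overlap c' c"
  unfolding overlap_def transition_def using inv_chart[OF c] by auto

lemma transition_in_dom: "z \<in> overlap c c' \<Longrightarrow> transition c c' z \<in> cdom c'"
  using transition_in unfolding overlap_def by blast

lemma inv_transition: "z \<in> overlap c c' \<Longrightarrow> chart_inv c' (transition c c' z) = chart_inv c z"
  using overlap_iff inv_chart[OF c'] by (simp add: transition_def)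

lemma transition_derivative:
  assumes z: "z \<in> overlap c c'"
  shows "(transition c c' has_derivative (\<lambda>v. jac c c' z *v v)) (at z)"
    and "dzbar k (\<lambda>w. transition c c' w $ p) z = 0"
proof -
  obtain M :: "complex^'n^'n" where M: "(transition c c' has_derivative (\<lambda>v. M *v v)) (at z)"
    using atlas c c' z unfolding complex_atlas_def holomorphic_map_on_def overlap_def by blast
  have "((\<lambda>w. transition c c' w $ p) has_derivative (\<lambda>v. (M *v v) $ p)) (at z)" for p
    by (rule bounded_linear.has_derivative[OF bounded_linear_vec_nth M])
  then have fr: "frechet_derivative (\<lambda>w. transition c c' w $ p) (at z) v = (M *v v) $ p" for p v
    by (rule frechet_derivative_eqI)
  have ax: "(M *v axis k b) $ p = M $ p $ k * b" for k p b
    by (simp add: matrix_vector_mult_def axis_def if_distrib cong: if_cong)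
  have ii: "\<i> * (x * \<i>) = - x" for x :: complex by (simp add: complex_eq_iff)
  show "dzbar k (\<lambda>w. transition c c' w $ p) z = 0"
    unfolding dzbar_def fr ax ii by simp
  have "jac c c' z = M"
    unfolding jac_def dz_def fr ax ii by (simp add: vec_eq_iff)
  then show "(transition c c' has_derivative (\<lambda>v. jac c c' z *v v)) (at z)" using M by simp
qed

lemma transition_holomorphic: "holomorphic_vec (overlap c c') (\<lambda>w. transition c c' w $ p)"
  unfolding holomorphic_vec_def
  using bounded_linear.has_derivative[OF bounded_linear_vec_nth transition_derivative(1)] transition_derivative(2)
  by (blast intro: differentiableI)

lemma metric_transform:
  assumes "z \<in> overlap c c'"
  shows "g c z $ i $ j = (\<Sum>k\<in>UNIV. \<Sum>l\<in>UNIV. g c' (transition c c' z) $ k $ l * jac c c' z $ k $ i * cnj (jac c c' z $ l $ j))"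
proof -
  have "\<forall>c\<in>A. \<forall>c'\<in>A. \<forall>z\<in>snd c ` (fst c \<inter> fst c'). \<forall>i j. g c z $ i $ j =
      (\<Sum>k\<in>UNIV. \<Sum>l\<in>UNIV. g c' (transition c c' z) $ k $ l * dz i (\<lambda>w. transition c c' w $ k) z
        * cnj (dz j (\<lambda>w. transition c c' w $ l) z))"
    using metric unfolding hermitian_metric_def by blast
  from this[rule_format, OF c c' assms[unfolded overlap_def]] show ?thesis by (simp only: jac_def vec_lambda_beta)
qed

lemma vol_density_transform:
  "z \<in> overlap c c' \<Longrightarrow> vol_density (g c z) = vol_density (g c' (transition c c' z)) * \<bar>real_det (jac c c' z)\<bar>"
  by (rule vol_density_pullback) (rule metric_transform)

lemma dz_transform:
  assumes z: "z \<in> overlap c c'" and f: "f differentiable (at (transition c c' z))"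
    and eq: "\<And>w. w \<in> T \<Longrightarrow> F w = f (transition c c' w)" and T: "open T" "z \<in> T"
  shows "dz k F z = (\<Sum>p\<in>UNIV. dz p f (transition c c' z) * jac c c' z $ p $ k)"
proof -
  have "dz k F z = dz k (\<lambda>w. f (transition c c' w)) z"
    by (rule dz_cong_open[OF T eq])
  also have "\<dots> = (\<Sum>p\<in>UNIV. dz p f (transition c c' z) * dz k (\<lambda>w. transition c c' w $ p) z)"
    by (rule derivative_compose_holomorphic(2)[OF f differentiableI[OF transition_derivative(1)[OF z]] transition_derivative(2)[OF z]])
  finally show ?thesis by (simp add: jac_def)
qed

text \<open>In both charts the Lee form is the (1,0)-derivative of one and the same function on the
  manifold, so the chain rule for the holomorphic transition applies.\<close>

lemma lee_transform:
  assumes z: "z \<in> overlap c c'"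
  shows "lee_form (g c) z k = (\<Sum>q\<in>UNIV. lee_form (g c') (transition c c' z) q * jac c c' z $ q $ k)"
proof -
  obtain V f where V: "open V" "chart_inv c z \<in> V"
    and lk0: "\<forall>c\<in>A. lck_chart (snd c ` (fst c \<inter> V)) (g c) (\<lambda>z. complex_of_real (- f (chart_inv c z)))"
    using local_lck_function[of "chart_inv c z"] by blast
  note lk = lk0[rule_format]
  let ?S = "snd c ` (fst c \<inter> V)" and ?S' = "snd c' ` (fst c' \<inter> V)"
  let ?Tz = "transition c c' z"
  have zS: "z \<in> ?S" unfolding image_chart_iff[OF c] using z V(2) by (simp add: overlap_iff)
  have TzS: "?Tz \<in> ?S'"
    unfolding image_chart_iff[OF c'] using V(2) by (simp only: inv_transition[OF z] transition_in_dom[OF z] simp_thms)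
  have "lee_form (g c) z k = dz k (\<lambda>z. complex_of_real (- f (chart_inv c z))) z"
    by (rule lck_chart.lee_form_eq[OF lk[OF c] zS n2])
  also have "\<dots> = (\<Sum>q\<in>UNIV. dz q (\<lambda>z. complex_of_real (- f (chart_inv c' z))) ?Tz * jac c c' z $ q $ k)"
    by (rule dz_transform[OF z _ _ open_overlap z])
      (use smooth_on_imp_differentiable[OF lck_chart.u[OF lk[OF c']] TzS] inv_transition in auto)
  finally show ?thesis
    unfolding lck_chart.lee_form_eq[OF lk[OF c'] TzS n2] .
qed

text \<open>The conjugated Jacobian is antiholomorphic, so \<open>dz k\<close> annihilates it and no
  second derivative of the transition remains. That the Jacobian can be differentiated at all is
  \<open>holomorphic_vec_dz\<close>.\<close>

lemma lee_divergence_transform: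
  assumes z: "z \<in> overlap c c'"
  shows "lee_divergence (g c) z = lee_divergence (g c') (transition c c' z)"
proof -
  let ?T = "transition c c'"
  define F where "F q w = cnj (lee_form (g c') w q)" for q w
  have Fd: "F q differentiable (at (?T z))" for q
    unfolding F_def[abs_def]
    using bounded_linear.has_derivative[OF bounded_linear_cnj lee_differentiable[OF c' transition_in_dom[OF z], unfolded frechet_derivative_works]]
    by (rule differentiableI)
  have Td: "?T differentiable (at z)" using differentiableI[OF transition_derivative(1)[OF z]] .
  have FTd: "(\<lambda>w. F q (?T w)) differentiable (at z)" for q
    by (rule derivative_compose_holomorphic(1)[OF Fd Td transition_derivative(2)[OF z]])
  have hol: "holomorphic_vec (overlap c c') (dz l (\<lambda>w. ?T w $ q))" for l q
    by (rule holomorphic_vec_dz[OF transition_holomorphic open_overlap])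
  have jd: "(\<lambda>w. jac c c' w $ q $ l) differentiable (at z)" "dzbar k (\<lambda>w. jac c c' w $ q $ l) z = 0" for q l k
    using hol[of l q] z unfolding holomorphic_vec_def jac_def by auto
  have cjd: "(\<lambda>w. cnj (jac c c' w $ q $ l)) differentiable (at z)" for q l
    using bounded_linear.has_derivative[OF bounded_linear_cnj jd(1)[unfolded frechet_derivative_works]]
    by (rule differentiableI)
  have "dz k (\<lambda>w. cnj (lee_form (g c) w l)) z
     = (\<Sum>q\<in>UNIV. \<Sum>p\<in>UNIV. dz q (F p) (?T z) * (jac c c' z $ q $ k * cnj (jac c c' z $ p $ l)))" for k l
  proof -
    have "dz k (\<lambda>w. cnj (lee_form (g c) w l)) z = dz k (\<lambda>w. \<Sum>p\<in>UNIV. F p (?T w) * cnj (jac c c' w $ p $ l)) z"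
      by (rule dz_cong_open[OF open_overlap z]) (simp add: lee_transform F_def)
    also have "\<dots> = (\<Sum>p\<in>UNIV. F p (?T z) * dz k (\<lambda>w. cnj (jac c c' w $ p $ l)) z + dz k (\<lambda>w. F p (?T w)) z * cnj (jac c c' z $ p $ l))"
      by (simp add: dz_sum dz_mult FTd cjd)
    also have "\<dots> = (\<Sum>p\<in>UNIV. (\<Sum>q\<in>UNIV. dz q (F p) (?T z) * jac c c' z $ q $ k) * cnj (jac c c' z $ p $ l))"
      by (simp add: dz_cnj[OF jd(1)] jd(2) dz_transform[OF z Fd _ open_overlap z])
    also have "\<dots> = (\<Sum>p\<in>UNIV. \<Sum>q\<in>UNIV. dz q (F p) (?T z) * (jac c c' z $ q $ k * cnj (jac c c' z $ p $ l)))"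
      by (simp add: sum_distrib_right mult.assoc)
    finally show ?thesis by (subst sum.swap)
  qed
  then show ?thesis
    unfolding lee_divergence_def
    by (intro contraction_pullback[OF metric_transform[OF z] hermitian_pd_det_nonzero[OF pd[OF c]],
          where W = "\<lambda>q p. dz q (F p) (?T z)", unfolded F_def[abs_def]])
       (use z overlap_iff in \<open>auto simp: F_def[abs_def]\<close>)
qed

end

section \<open>Functions on the manifold from chart expressions\<close>

definition chart_invariant :: "(('a, 'n) chart \<Rightarrow> complex^'n \<Rightarrow> real) \<Rightarrow> bool" where
  "chart_invariant F \<longleftrightarrow> (\<forall>c\<in>A. \<forall>c'\<in>A. \<forall>z\<in>overlap c c'. F c z = F c' (transition c c' z))"

definition glob :: "(('a, 'n) chart \<Rightarrow> complex^'n \<Rightarrow> real) \<Rightarrow> 'a \<Rightarrow> real" where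
  "glob F p = F (chart_at p) (snd (chart_at p) p)"

lemma glob_chart_inv:
  assumes F: "chart_invariant F" and c: "c \<in> A" and z: "z \<in> cdom c"
  shows "glob F (chart_inv c z) = F c z"
proof -
  let ?p = "chart_inv c z"
  have "z \<in> overlap c (chart_at ?p)"
    unfolding overlap_iff[OF c chart_at(1)] using z chart_at(2) by blast
  then have "F c z = F (chart_at ?p) (transition c (chart_at ?p) z)"
    using F c chart_at(1) unfolding chart_invariant_def by blast
  then show ?thesis by (simp add: glob_def transition_def)
qed

lemma continuous_on_charts:
  fixes f :: "'a \<Rightarrow> 'b::topological_space"
  assumes "\<And>c. c \<in> A \<Longrightarrow> continuous_on (cdom c) (\<lambda>z. f (chart_inv c z))"
  shows "continuous_on UNIV f"
proof -
  have "isCont f p" for p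
  proof -
    note c = chart_at(1)[of p]
    have "continuous_on (fst (chart_at p)) (\<lambda>q. f (chart_inv (chart_at p) (snd (chart_at p) q)))"
      by (rule continuous_on_compose2[OF assms[OF c] cont_chart[OF c]]) blast
    then have "continuous_on (fst (chart_at p)) f"
      by (rule continuous_on_eq) (simp add: inv_chart[OF c])
    then show ?thesis using open_fst[OF c] chart_at(2)[of p] by (simp add: continuous_on_eq_continuous_at)
  qed
  then show ?thesis by (simp add: continuous_at_imp_continuous_on)
qed

lemma glob_continuous_on:
  assumes F: "chart_invariant F" and "\<And>c. c \<in> A \<Longrightarrow> continuous_on (cdom c) (F c)"
  shows "continuous_on UNIV (glob F)"
proof (rule continuous_on_charts)
  fix c assume c: "c \<in> A"
  show "continuous_on (cdom c) (\<lambda>z. glob F (chart_inv c z))"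
    by (rule continuous_on_eq[OF assms(2)[OF c]]) (simp add: glob_chart_inv[OF F c])
qed

definition C1_function :: "('a \<Rightarrow> real) \<Rightarrow> bool" where
  "C1_function \<rho> \<longleftrightarrow> (\<forall>c\<in>A. continuously_differentiable_on 1 (cdom c) (\<lambda>w. complex_of_real (\<rho> (chart_inv c w))))"

lemma C1_function_D:
  assumes "C1_function \<rho>" "c \<in> A"
  shows "continuously_differentiable_on 1 (cdom c) (\<lambda>w. complex_of_real (\<rho> (chart_inv c w)))"
    and "z \<in> cdom c \<Longrightarrow> (\<lambda>w. complex_of_real (\<rho> (chart_inv c w))) differentiable (at z)"
    and "continuous_on (cdom c) (\<lambda>z. frechet_derivative (\<lambda>w. complex_of_real (\<rho> (chart_inv c w))) (at z) v)"
  using assms by (auto simp: C1_function_def One_nat_def)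

lemma C1_function_continuous:
  assumes "C1_function \<rho>"
  shows "continuous_on UNIV \<rho>"
proof (rule continuous_on_charts)
  fix c assume c: "c \<in> A"
  have "continuous_on (cdom c) (\<lambda>w. Re (complex_of_real (\<rho> (chart_inv c w))))"
    by (rule continuous_on_Re[OF C1_imp_continuous_on[OF C1_function_D(1)[OF assms c]]])
  then show "continuous_on (cdom c) (\<lambda>z. \<rho> (chart_inv c z))" by simp
qed

definition lee_norm_sq :: "('a, 'n) chart \<Rightarrow> complex^'n \<Rightarrow> real" where
  "lee_norm_sq c z = Re (\<Sum>k\<in>UNIV. \<Sum>l\<in>UNIV. inverse_metric (g c z) k l * (lee_form (g c) z k * cnj (lee_form (g c) z l)))"

definition lee_trace :: "('a, 'n) chart \<Rightarrow> complex^'n \<Rightarrow> real" where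
  "lee_trace c z = Re (lee_divergence (g c) z)"

text \<open>The pairing of the (1,0)-derivative of \<rho> with the Lee form: the term that a cut-off
  function adds when the Lee field is integrated by parts.\<close>

definition lee_derivative :: "('a \<Rightarrow> real) \<Rightarrow> ('a, 'n) chart \<Rightarrow> complex^'n \<Rightarrow> real" where
  "lee_derivative \<rho> c z = Re (\<Sum>k\<in>UNIV. \<Sum>l\<in>UNIV. inverse_metric (g c z) k l
     * (dz k (\<lambda>w. complex_of_real (\<rho> (chart_inv c w))) z * cnj (lee_form (g c) z l)))"

lemma contraction_transform:
  assumes c: "c \<in> A" and c': "c' \<in> A" and z: "z \<in> overlap c c'"
    and x: "\<And>k. x k = (\<Sum>q\<in>UNIV. x' q * jac c c' z $ q $ k)"
    and y: "\<And>k. y k = (\<Sum>q\<in>UNIV. y' q * jac c c' z $ q $ k)"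
  shows "(\<Sum>k\<in>UNIV. \<Sum>l\<in>UNIV. inverse_metric (g c z) k l * (x k * cnj (y l)))
    = (\<Sum>k\<in>UNIV. \<Sum>l\<in>UNIV. inverse_metric (g c' (transition c c' z)) k l * (x' k * cnj (y' l)))"
proof (rule contraction_pullback[OF metric_transform[OF c c' z]])
  have "z \<in> cdom c" using z unfolding overlap_def by blast
  then show "det (g c z) \<noteq> 0" by (rule hermitian_pd_det_nonzero[OF pd[OF c]])
  show "x i * cnj (y j) = (\<Sum>q\<in>UNIV. \<Sum>p\<in>UNIV. x' q * cnj (y' p) * (jac c c' z $ q $ i * cnj (jac c c' z $ p $ j)))" for i j
    unfolding x y cnj_sum sum_product by (simp add: mult_ac)
qed

lemma chart_invariant_lee_norm_sq: "chart_invariant lee_norm_sq"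
  unfolding chart_invariant_def lee_norm_sq_def
  by (intro ballI arg_cong[of _ _ Re] contraction_transform lee_transform)

lemma chart_invariant_lee_trace: "chart_invariant lee_trace"
  unfolding chart_invariant_def lee_trace_def by (intro ballI arg_cong[of _ _ Re] lee_divergence_transform)

lemma chart_invariant_lee_derivative:
  assumes "C1_function \<rho>"
  shows "chart_invariant (lee_derivative \<rho>)"
  unfolding chart_invariant_def lee_derivative_def
proof (intro ballI arg_cong[of _ _ Re] contraction_transform lee_transform)
  fix c c' z k assume c: "c \<in> A" and c': "c' \<in> A" and z: "z \<in> overlap c c'"
  show "dz k (\<lambda>w. complex_of_real (\<rho> (chart_inv c w))) z
    = (\<Sum>q\<in>UNIV. dz q (\<lambda>w. complex_of_real (\<rho> (chart_inv c' w))) (transition c c' z) * jac c c' z $ q $ k)"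
    by (rule dz_transform[OF c c' z C1_function_D(2)[OF assms c' transition_in_dom[OF c c' z]] _ open_overlap[OF c c'] z])
      (simp add: inv_transition[OF c c'])
qed

lemma lee_norm_sq_continuous: "c \<in> A \<Longrightarrow> continuous_on (cdom c) (lee_norm_sq c)"
  unfolding lee_norm_sq_def[abs_def]
  by (intro continuous_on_Re continuous_on_sum continuous_on_mult continuous_on_cnj
      inverse_metric_continuous lee_continuous)

lemma lee_trace_continuous: "c \<in> A \<Longrightarrow> continuous_on (cdom c) (lee_trace c)"
  unfolding lee_trace_def[abs_def] by (intro continuous_on_Re lee_divergence_continuous)

lemma lee_derivative_continuous:
  assumes "C1_function \<rho>" "c \<in> A"
  shows "continuous_on (cdom c) (lee_derivative \<rho> c)"
proof -
  have "continuous_on (cdom c) (dz k (\<lambda>w. complex_of_real (\<rho> (chart_inv c w))))" for k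
    unfolding dz_def[abs_def] by (intro continuous_intros C1_function_D(3)[OF assms]) auto
  then show ?thesis
    unfolding lee_derivative_def[abs_def]
    by (intro continuous_on_Re continuous_on_sum continuous_on_mult continuous_on_cnj
        inverse_metric_continuous[OF assms(2)] lee_continuous[OF assms(2)])
qed

lemma lee_norm_sq_zero_imp:
  assumes c: "c \<in> A" and z: "z \<in> cdom c"
  shows "0 \<le> lee_norm_sq c z" and "lee_norm_sq c z = 0 \<Longrightarrow> lee_form (g c) z k = 0"
proof -
  let ?Y = "(\<chi> k. lee_form (g c) z k) :: complex^'n"
  have pos: "lee_norm_sq c z > 0" if "?Y \<noteq> 0"
    using inverse_metric_pos[OF pd[OF c z] that] by (simp add: lee_norm_sq_def mult.assoc)
  have zero: "lee_form (g c) z k = 0" if "?Y = 0" for k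
    using arg_cong[OF that, of "\<lambda>v. v $ k"] by simp
  show "0 \<le> lee_norm_sq c z"
    using pos zero by (cases "?Y = 0") (auto simp: lee_norm_sq_def)
  show "lee_form (g c) z k = 0" if "lee_norm_sq c z = 0"
    using pos zero that by (cases "?Y = 0") auto
qed

section \<open>Integration in charts\<close>

definition chart_integrand :: "('a, 'n) chart \<Rightarrow> ('a \<Rightarrow> real) \<Rightarrow> complex^'n \<Rightarrow> real" where
  "chart_integrand c f z = (if z \<in> cdom c then f (chart_inv c z) * vol_density (g c z) else 0)"

definition chart_integral :: "('a, 'n) chart \<Rightarrow> ('a \<Rightarrow> real) \<Rightarrow> real" where
  "chart_integral c f = integral\<^sup>L lborel (chart_integrand c f)"

lemma compact_chart_image:
  assumes c: "c \<in> A" and K: "compact K" "K \<subseteq> fst c"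
  shows "compact (snd c ` K)" "snd c ` K \<subseteq> cdom c"
  using K compact_continuous_image[OF continuous_on_subset[OF cont_chart[OF c] K(2)] K(1)] by auto

lemma chart_inv_notin: "c \<in> A \<Longrightarrow> z \<in> cdom c \<Longrightarrow> z \<notin> snd c ` K \<Longrightarrow> chart_inv c z \<notin> K"
  using chart_inv by (metis imageI)

text \<open>The integrand is continuous on the open chart image and zero on the open complement of
  the compact image of \<open>K\<close>. These two sets cover the space, so extension by zero
  preserves continuity.\<close>

lemma
  assumes c: "c \<in> A" and K: "compact K" "K \<subseteq> fst c" and f: "continuous_on UNIV f" "\<And>x. x \<notin> K \<Longrightarrow> f x = 0"
  shows chart_integrand_continuous: "continuous_on UNIV (chart_integrand c f)"
    and chart_integrand_integrable: "integrable lborel (chart_integrand c f)"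
proof -
  note L = compact_chart_image[OF c K]
  have zero: "chart_integrand c f z = 0" if "z \<notin> snd c ` K" for z
    using chart_inv_notin[OF c _ that] f(2) by (simp add: chart_integrand_def)
  have "continuous_on (cdom c) (\<lambda>z. f (chart_inv c z) * vol_density (g c z))"
    by (intro continuous_on_mult vol_density_continuous[OF c] continuous_on_compose2[OF f(1) cont_inv[OF c]]) auto
  then have c1: "continuous_on (cdom c) (chart_integrand c f)"
    by (rule continuous_on_eq) (simp add: chart_integrand_def)
  have c2: "continuous_on (- (snd c ` K)) (chart_integrand c f)"
    by (rule continuous_on_eq[OF continuous_on_const[of _ 0]]) (simp add: zero)
  have "open (- (snd c ` K))" using L(1) by (simp add: compact_imp_closed open_Compl)
  note cont_Un = continuous_on_open_Un[OF open_dom[OF c] this c1 c2]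
  have "cdom c \<union> - (snd c ` K) = UNIV" using L(2) by blast
  then show cont: "continuous_on UNIV (chart_integrand c f)" using cont_Un by metis
  have "(\<lambda>z. indicator (snd c ` K) z *\<^sub>R chart_integrand c f z) = chart_integrand c f"
    using zero by (auto simp: indicator_def fun_eq_iff)
  then show "integrable lborel (chart_integrand c f)"
    using borel_integrable_compact[OF L(1) continuous_on_subset[OF cont]] by simp
qed

text \<open>The density changes by the real Jacobian of the transition, which is the factor in the
  change of variables. A support inside both chart domains makes both integrands vanish off the
  overlap.\<close>

lemma chart_integral_transform:
  assumes c: "c \<in> A" and c': "c' \<in> A" and K: "compact K" "K \<subseteq> fst c" "K \<subseteq> fst c'"
    and f: "continuous_on UNIV f" "\<And>x. x \<notin> K \<Longrightarrow> f x = 0"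
  shows "chart_integral c f = chart_integral c' f"
  unfolding chart_integral_def
proof (rule integral_change_of_variables_complex[OF open_overlap[OF c c'] _ transition_derivative(1)[OF c c']])
  show "inj_on (transition c c') (overlap c c')"
  proof (rule inj_onI)
    fix x y assume xy: "x \<in> overlap c c'" "y \<in> overlap c c'" "transition c c' x = transition c c' y"
    then have "chart_inv c x = chart_inv c y" using inv_transition[OF c c'] by metis
    then show "x = y" using chart_inv[OF c] xy(1,2) overlap_iff[OF c c'] by metis
  qed
  show "integrable lborel (chart_integrand c' f)" by (rule chart_integrand_integrable[OF c' K(1,3) f])
  show "chart_integrand c f \<in> borel_measurable borel"
    by (rule borel_measurable_continuous_onI[OF chart_integrand_continuous[OF c K(1,2) f]])
  show "chart_integrand c f z = 0" if "z \<notin> overlap c c'" for z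
    using that f(2)[of "chart_inv c z"] K(3) unfolding overlap_iff[OF c c'] by (auto simp: chart_integrand_def)
  show "chart_integrand c' f z = 0" if z: "z \<notin> transition c c' ` overlap c c'" for z
  proof (cases "z \<in> cdom c'")
    case True
    have "chart_inv c' z \<notin> K"
    proof
      assume k: "chart_inv c' z \<in> K"
      then have "snd c (chart_inv c' z) \<in> overlap c c'"
        using K chart_inv_in[OF c' True] unfolding overlap_def by blast
      moreover have "transition c c' (snd c (chart_inv c' z)) = z"
        using k K inv_chart[OF c] chart_inv[OF c' True] by (auto simp: transition_def)
      ultimately show False using z by (metis imageI)
    qed
    then show ?thesis using f(2) by (simp add: chart_integrand_def)
  qed (simp add: chart_integrand_def)
  show "chart_integrand c f z = \<bar>real_det (jac c c' z)\<bar> * chart_integrand c' f (transition c c' z)"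
    if z: "z \<in> overlap c c'" for z
    using z overlap_iff[OF c c', of z] transition_in_dom[OF c c' z] inv_transition[OF c c' z]
      vol_density_transform[OF c c' z] by (simp add: chart_integrand_def)
qed

lemma chart_integral_add:
  assumes "integrable lborel (chart_integrand c f)" "integrable lborel (chart_integrand c f')"
  shows "chart_integral c (\<lambda>x. f x + f' x) = chart_integral c f + chart_integral c f'"
proof -
  have "chart_integrand c (\<lambda>x. f x + f' x) = (\<lambda>z. chart_integrand c f z + chart_integrand c f' z)"
    by (auto simp: chart_integrand_def fun_eq_iff distrib_right)
  then show ?thesis unfolding chart_integral_def using assms by simp
qed

lemma chart_integral_sum:
  assumes "\<And>i. i \<in> I \<Longrightarrow> integrable lborel (chart_integrand c (f i))"
  shows "chart_integral c (\<lambda>x. \<Sum>i\<in>I. f i x) = (\<Sum>i\<in>I. chart_integral c (f i))"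
proof -
  have "chart_integrand c (\<lambda>x. \<Sum>i\<in>I. f i x) = (\<lambda>z. \<Sum>i\<in>I. chart_integrand c (f i) z)"
    by (auto simp: chart_integrand_def fun_eq_iff sum_distrib_right)
  then show ?thesis unfolding chart_integral_def using assms by simp
qed

text \<open>The divergence theorem for \<rho> times the Lee field:
  \<open>divergence_lee_field\<close> yields the part without derivatives of \<rho>, the derivative
  of \<rho> yields the rest. The total is the real part of a sum of derivatives of compactly
  supported functions, so it integrates to zero.\<close>

lemma chart_integration_by_parts:
  assumes c: "c \<in> A" and K: "compact K" "K \<subseteq> fst c" and \<rho>: "C1_function \<rho>" "\<And>x. x \<notin> K \<Longrightarrow> \<rho> x = 0"
  shows "chart_integral c (\<lambda>x. \<rho> x * ((real CARD('n) - 1) * glob lee_norm_sq x + glob lee_trace x)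
      + glob (lee_derivative \<rho>) x) = 0"
proof -
  note L = compact_chart_image[OF c K]
  define R where "R = (\<lambda>w. complex_of_real (\<rho> (chart_inv c w)))"
  define V where "V k w = complex_of_real (vol_density (g c w)) * (\<Sum>l\<in>UNIV. inverse_metric (g c w) k l * cnj (lee_form (g c) w l))" for k w
  \<comment> \<open>The extension by zero is C1 on the whole space because \<rho> vanishes off a
    compact subset of the chart domain.\<close>
  define F where "F k z = (if z \<in> cdom c then R z * V k z else 0)" for k z
  have RC1: "continuously_differentiable_on 1 (cdom c) R" unfolding R_def by (rule C1_function_D(1)[OF \<rho>(1) c])
  have VC1: "continuously_differentiable_on 1 (cdom c) (V k)" for k
  proof -
    have h: "continuously_differentiable_on 1 (cdom c) (\<lambda>w. inverse_metric (g c w) k l)" for l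
      unfolding inverse_metric_def
      by (rule smooth_on_imp_C1[OF smooth_on_matrix_inv[OF open_dom[OF c]]])
        (use smooth_on_vec_nth[OF open_dom[OF c] smooth_on_vec_nth[OF open_dom[OF c] smooth_g[OF c]]]
          hermitian_pd_det_nonzero[OF pd[OF c]] in auto)
    have summand: "continuously_differentiable_on 1 (cdom c) (\<lambda>w. inverse_metric (g c w) k l * cnj (lee_form (g c) w l))" for l
      by (rule continuously_differentiable_on_bilinear[OF bounded_bilinear_mult open_dom[OF c] h
          continuously_differentiable_on_linear[OF bounded_linear_cnj open_dom[OF c] lee_smooth[OF c]]])
    have "continuously_differentiable_on 1 (cdom c) (\<lambda>w. \<Sum>l\<in>UNIV. inverse_metric (g c w) k l * cnj (lee_form (g c) w l))"
      by (rule continuously_differentiable_on_sum[OF open_dom[OF c] summand])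
    then show ?thesis unfolding V_def[abs_def]
      by (rule continuously_differentiable_on_bilinear[OF bounded_bilinear_mult open_dom[OF c] vol_density_C1[OF c]])
  qed
  have F0: "F k z = 0" if "z \<notin> snd c ` K" for k z
    using chart_inv_notin[OF c _ that] \<rho>(2) by (simp add: F_def R_def)
  have oL: "open (- (snd c ` K))" using L(1) by (simp add: compact_imp_closed open_Compl)
  have FC1: "continuously_differentiable_on 1 UNIV (F k)" for k
  proof (rule continuously_differentiable_on_1_local[OF open_UNIV])
    fix z :: "complex^'n"
    show "\<exists>T. open T \<and> z \<in> T \<and> continuously_differentiable_on 1 T (F k)"
    proof (cases "z \<in> cdom c")
      case True
      have "continuously_differentiable_on 1 (cdom c) (F k)"
        by (rule continuously_differentiable_on_transfer[OF open_dom[OF c]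
            continuously_differentiable_on_bilinear[OF bounded_bilinear_mult open_dom[OF c] RC1 VC1[of k]]])
          (simp add: F_def)
      then show ?thesis using True open_dom[OF c] by blast
    next
      case False
      then have "z \<in> - (snd c ` K)" using L(2) by blast
      moreover have "continuously_differentiable_on 1 (- (snd c ` K)) (F k)"
        by (rule continuously_differentiable_on_transfer[OF oL continuously_differentiable_on_const[of _ _ 0]]) (simp add: F0)
      ultimately show ?thesis using oL by blast
    qed
  qed
  have Fd: "F k differentiable (at z)" "continuous_on UNIV (\<lambda>z. frechet_derivative (F k) (at z) v)" for k z v
    using FC1[of k] by (auto simp: One_nat_def)
  have int: "integrable lborel (\<lambda>z. frechet_derivative (F k) (at z) v)" "(\<integral>z. frechet_derivative (F k) (at z) v \<partial>lborel) = 0" for k v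
    using integral_directional_derivative_zero[OF Fd L(1) F0] by auto
  have int_dz: "integrable lborel (dz k (F k))" "(\<integral>z. dz k (F k) z \<partial>lborel) = 0" for k
    unfolding dz_def[abs_def] using int[of k] by auto
  have tot: "integrable lborel (\<lambda>z. \<Sum>k\<in>UNIV. dz k (F k) z)" "(\<integral>z. (\<Sum>k\<in>UNIV. dz k (F k) z) \<partial>lborel) = 0"
    using int_dz by auto
  have "chart_integrand c (\<lambda>x. \<rho> x * ((real CARD('n) - 1) * glob lee_norm_sq x + glob lee_trace x) + glob (lee_derivative \<rho>) x) z
      = Re (\<Sum>k\<in>UNIV. dz k (F k) z)" for z
  proof (cases "z \<in> cdom c")
    case False
    then have "z \<in> - (snd c ` K)" using L(2) by blast
    then have "dz k (F k) z = 0" for k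
      using dz_cong_open[OF oL, of z "F k" "\<lambda>_. 0" k] F0 by (simp add: dz_const)
    then show ?thesis using False by (simp add: chart_integrand_def)
  next
    case True
    have dV: "V k differentiable (at z)" and dR: "R differentiable (at z)" for k
      using VC1[of k] RC1 True by (auto simp: One_nat_def)
    obtain S u where S: "z \<in> S" "S \<subseteq> cdom c" "lck_chart S (g c) u" using local_chart[OF c True] .
    note Sopen = lck_chart.S[OF S(3)]
    let ?v = "complex_of_real (vol_density (g c z))"
    have lee_bar: "cnj (lee_form (g c) w l) = dzbar l u w" if "w \<in> S" for w l
      using lck_chart.lee_form_eq[OF S(3) that n2] lck_chart.dzbar_u[OF S(3) that] by simp
    have div: "(\<Sum>k\<in>UNIV. dz k (V k) z) = ?v * ((of_nat CARD('n) - 1) *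
        (\<Sum>k\<in>UNIV. \<Sum>l\<in>UNIV. inverse_metric (g c z) k l * (lee_form (g c) z k * cnj (lee_form (g c) z l))) + lee_divergence (g c) z)"
    proof -
      have "dz k (V k) z = dz k (\<lambda>w. of_real (vol_density (g c w)) * (\<Sum>l\<in>UNIV. inverse_metric (g c w) k l * dzbar l u w)) z" for k
        by (rule dz_cong_open[OF Sopen S(1)]) (simp add: V_def lee_bar)
      then show ?thesis
        unfolding lck_chart.lee_divergence_eq[OF S(3,1) n2] using lck_chart.divergence_lee_field[OF S(3,1)]
        by (simp add: lck_chart.dzbar_u[OF S(3,1)] lck_chart.lee_form_eq[OF S(3,1) n2] mult.assoc)
    qed
    have "dz k (F k) z = R z * dz k (V k) z + dz k R z * V k z" for k
      using dz_cong_open[OF open_dom[OF c] True, of "F k" "\<lambda>w. R w * V k w" k] dz_mult[OF dR dV] by (simp add: F_def)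
    then have "(\<Sum>k\<in>UNIV. dz k (F k) z) = R z * (\<Sum>k\<in>UNIV. dz k (V k) z) + (\<Sum>k\<in>UNIV. dz k R z * V k z)"
      by (simp add: sum.distrib sum_distrib_left)
    also have "(\<Sum>k\<in>UNIV. dz k R z * V k z) = ?v * (\<Sum>k\<in>UNIV. \<Sum>l\<in>UNIV. inverse_metric (g c z) k l * (dz k R z * cnj (lee_form (g c) z l)))"
      by (simp add: V_def sum_distrib_left mult_ac)
    finally have eq: "(\<Sum>k\<in>UNIV. dz k (F k) z) = complex_of_real (\<rho> (chart_inv c z) * vol_density (g c z)) * (complex_of_real (real CARD('n) - 1) *
        (\<Sum>k\<in>UNIV. \<Sum>l\<in>UNIV. inverse_metric (g c z) k l * (lee_form (g c) z k * cnj (lee_form (g c) z l))) + lee_divergence (g c) z)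
      + ?v * (\<Sum>k\<in>UNIV. \<Sum>l\<in>UNIV. inverse_metric (g c z) k l * (dz k R z * cnj (lee_form (g c) z l)))"
      unfolding div by (simp add: R_def)
    have "Re (\<Sum>k\<in>UNIV. dz k (F k) z) = \<rho> (chart_inv c z) * vol_density (g c z) * ((real CARD('n) - 1) * lee_norm_sq c z + lee_trace c z)
      + vol_density (g c z) * lee_derivative \<rho> c z"
      unfolding eq lee_norm_sq_def lee_trace_def lee_derivative_def R_def plus_complex.sel
      by (simp only: Re_complex_of_real Im_complex_of_real times_complex.sel mult_zero_left diff_zero plus_complex.sel)
    then show ?thesis
      using True glob_chart_inv[OF chart_invariant_lee_norm_sq c True] glob_chart_inv[OF chart_invariant_lee_trace c True]
        glob_chart_inv[OF chart_invariant_lee_derivative[OF \<rho>(1)] c True]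
      by (simp add: chart_integrand_def algebra_simps)
  qed
  then have "chart_integral c (\<lambda>x. \<rho> x * ((real CARD('n) - 1) * glob lee_norm_sq x + glob lee_trace x) + glob (lee_derivative \<rho>) x)
     = (\<integral>z. Re (\<Sum>k\<in>UNIV. dz k (F k) z) \<partial>lborel)"
    unfolding chart_integral_def by presburger
  also have "\<dots> = 0" using integral_Re[OF tot(1)] tot(2) by simp
  finally show ?thesis .
qed

text \<open>Regularity is tested in an arbitrary chart \<open>c'\<close>. Over the domain of
  \<open>c\<close> it follows from the transition map being C1; any other point avoids the support,
  which is compact and hence closed in a Hausdorff space.\<close>

lemma C1_function_bump:
  assumes c: "c \<in> A" and r: "r > 0" "cball a r \<subseteq> cdom c"
  defines "\<phi> \<equiv> \<lambda>x. if x \<in> fst c then bump a r (snd c x) else 0"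
  shows "C1_function \<phi>" "compact (chart_inv c ` cball a r)" "x \<notin> chart_inv c ` cball a r \<Longrightarrow> \<phi> x = 0"
proof -
  let ?K = "chart_inv c ` cball a r"
  show K: "compact ?K"
    by (rule compact_continuous_image[OF continuous_on_subset[OF cont_inv[OF c] r(2)] compact_cball])
  show zero: "\<phi> x = 0" if "x \<notin> ?K" for x
  proof (cases "x \<in> fst c")
    case True
    have "snd c x \<notin> cball a r" using that inv_chart[OF c True] by (metis imageI)
    from bump_zero[OF r(1) this] show ?thesis by (simp add: \<phi>_def)
  qed (simp add: \<phi>_def)
  show "C1_function \<phi>"
    unfolding C1_function_def
  proof (intro ballI continuously_differentiable_on_1_local open_dom)
    fix c' z assume c': "c' \<in> A" and z: "z \<in> cdom c'"
    show "\<exists>T. open T \<and> z \<in> T \<and> continuously_differentiable_on 1 T (\<lambda>w. complex_of_real (\<phi> (chart_inv c' w)))"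
    proof (cases "chart_inv c' z \<in> fst c")
      case True
      have o: "open (overlap c' c)" by (rule open_overlap[OF c' c])
      have T: "continuously_differentiable_on 1 (overlap c' c) (transition c' c)"
        using differentiableI[OF transition_derivative(1)[OF c' c]] transition_holomorphic[OF c' c]
        by (intro continuously_differentiable_on_1_holomorphic[OF o]) auto
      have "continuously_differentiable_on 1 (overlap c' c) (\<lambda>w. complex_of_real (bump a r (transition c' c w)))"
        by (intro continuously_differentiable_on_linear[OF bounded_linear_of_real o]
            continuously_differentiable_on_1_compose[OF o open_UNIV C1_bump T]) auto
      then have "continuously_differentiable_on 1 (overlap c' c) (\<lambda>w. complex_of_real (\<phi> (chart_inv c' w)))"
        by (rule continuously_differentiable_on_transfer[OF o])
          (simp add: \<phi>_def overlap_iff[OF c' c] transition_def)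
      moreover have "z \<in> overlap c' c" using True z by (simp add: overlap_iff[OF c' c])
      ultimately show ?thesis using o by blast
    next
      case False
      let ?T = "snd c' ` (fst c' \<inter> - ?K)"
      have o: "open ?T" using K by (intro open_image_chart[OF c']) (simp add: compact_imp_closed open_Compl)
      have "?K \<subseteq> fst c" using r(2) chart_inv_in[OF c] by blast
      then have "z \<in> ?T" unfolding image_chart_iff[OF c'] using z False by blast
      moreover have "continuously_differentiable_on 1 ?T (\<lambda>w. complex_of_real (\<phi> (chart_inv c' w)))"
      proof (rule continuously_differentiable_on_transfer[OF o continuously_differentiable_on_const[of _ _ 0]])
        fix w assume "w \<in> ?T"
        then have "chart_inv c' w \<notin> ?K" unfolding image_chart_iff[OF c'] by blast
        then show "complex_of_real (\<phi> (chart_inv c' w)) = 0" using zero by simp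
      qed
      ultimately show ?thesis using o by blast
    qed
  qed
qed

end

text \<open>By continuity \<open>F\<close> is nonzero on an open set, and a nonempty open set is not
  negligible.\<close>

lemma integral_zero_imp_zero:
  fixes F :: "'v::euclidean_space \<Rightarrow> real"
  assumes cont: "continuous_on UNIV F" and int: "integrable lborel F" and nonneg: "\<And>z. F z \<ge> 0"
    and zero: "integral\<^sup>L lborel F = 0"
  shows "F z = 0"
proof -
  have "AE z in lborel. F z = 0"
    using integral_nonneg_eq_0_iff_AE[OF int] nonneg zero by simp
  moreover have op: "open {z. F z \<noteq> 0}"
  proof -
    have "{z. F z \<noteq> 0} = F -` (- {0})" by auto
    then show ?thesis using cont by (simp add: open_vimage open_Compl)
  qed
  ultimately have "{z. F z \<noteq> 0} \<in> null_sets lborel"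
    using AE_iff_null_sets[of "{z. F z \<noteq> 0}" lborel] by (simp add: borel_open)
  then have "negligible {z. F z \<noteq> 0}"
    unfolding negligible_iff_null_sets by (rule null_sets_completionI)
  then have "{z. F z \<noteq> 0} = {}"
    using op open_not_negligible by blast
  then show ?thesis by blast
qed

section \<open>Partition of unity and vanishing of the Lee form\<close>

context lck_manifold
begin

text \<open>Compactness selects finitely many bumps whose positivity sets cover the manifold, so
  their sum is positive everywhere and can be divided by. Each quotient keeps the compact support of
  its bump inside one chart.\<close>

lemma partition_of_unity:
  assumes comp: "compact (UNIV :: 'a set)"
  shows "\<exists>P \<rho> K. finite P \<and> (\<forall>p\<in>P. C1_function (\<rho> p) \<and> compact (K p) \<and> K p \<subseteq> fst (chart_at p)
    \<and> (\<forall>x. 0 \<le> \<rho> p x) \<and> (\<forall>x. x \<notin> K p \<longrightarrow> \<rho> p x = 0)) \<and> (\<forall>x::'a. (\<Sum>p\<in>P. \<rho> p x) = 1)"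
proof -
  define co where "co p = snd (chart_at p) p" for p
  have "\<exists>r>0. cball (co p) r \<subseteq> cdom (chart_at p)" for p
  proof -
    have "co p \<in> cdom (chart_at p)" unfolding co_def using chart_at(2) by blast
    then show ?thesis using open_dom[OF chart_at(1)] open_contains_cball by blast
  qed
  then obtain r where r: "\<And>p. r p > 0" "\<And>p. cball (co p) (r p) \<subseteq> cdom (chart_at p)" by metis
  define \<phi> where "\<phi> p = (\<lambda>x. if x \<in> fst (chart_at p) then bump (co p) (r p) (snd (chart_at p) x) else 0)" for p
  define K where "K p = chart_inv (chart_at p) ` cball (co p) (r p)" for p
  note bumpK = C1_function_bump[OF chart_at(1) r, folded \<phi>_def K_def]
  have supp: "\<phi> p x = 0" if "x \<notin> K p" for p x
    using C1_function_bump(3)[OF chart_at(1) r that[unfolded K_def]] unfolding \<phi>_def .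
  define U where "U p = {x. \<phi> p x > 0}" for p
  have U: "open (U p)" "p \<in> U p" for p
  proof -
    have "U p = \<phi> p -` {0<..}" by (auto simp: U_def)
    then show "open (U p)" using C1_function_continuous[OF bumpK(1)] by (simp add: open_vimage)
    have "bump (co p) (r p) (co p) > 0" using r(1) by (intro bump_pos) simp
    then show "p \<in> U p" using chart_at(2)[of p] by (simp add: U_def \<phi>_def co_def)
  qed
  obtain P where P: "finite P" "UNIV \<subseteq> (\<Union>p\<in>P. U p)"
    using compactE_image[OF comp, of UNIV U] U by (metis UNIV_I UN_iff subsetI)
  have \<phi>0: "\<phi> p x \<ge> 0" for p x by (simp add: \<phi>_def bump_nonneg)
  define \<psi> where "\<psi> x = (\<Sum>p\<in>P. \<phi> p x)" for x
  have \<psi>: "\<psi> x > 0" for x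
  proof -
    obtain p where "p \<in> P" "x \<in> U p" using P(2) by blast
    then show ?thesis unfolding \<psi>_def U_def using \<phi>0 P(1) by (intro sum_pos2) auto
  qed
  have C1: "C1_function (\<lambda>x. \<phi> p x / \<psi> x)" for p
    unfolding C1_function_def
  proof
    fix c assume c: "c \<in> A"
    note o = open_dom[OF c]
    have "continuously_differentiable_on 1 (cdom c) (\<lambda>w. \<Sum>p\<in>P. complex_of_real (\<phi> p (chart_inv c w)))"
      by (rule continuously_differentiable_on_sum[OF o C1_function_D(1)[OF bumpK(1) c]])
    then have "continuously_differentiable_on 1 (cdom c) (\<lambda>w. inverse (\<Sum>p\<in>P. complex_of_real (\<phi> p (chart_inv c w))))"
      by (rule continuously_differentiable_on_inverse[OF o])
        (use \<psi> in \<open>simp add: \<psi>_def less_imp_neq[symmetric] flip: of_real_sum\<close>)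
    then have "continuously_differentiable_on 1 (cdom c) (\<lambda>w. complex_of_real (\<phi> p (chart_inv c w))
        * inverse (\<Sum>p\<in>P. complex_of_real (\<phi> p (chart_inv c w))))"
      by (rule continuously_differentiable_on_bilinear[OF bounded_bilinear_mult o C1_function_D(1)[OF bumpK(1) c]])
    then show "continuously_differentiable_on 1 (cdom c) (\<lambda>w. complex_of_real (\<phi> p (chart_inv c w) / \<psi> (chart_inv c w)))"
      by (simp add: \<psi>_def divide_inverse)
  qed
  have "K p \<subseteq> fst (chart_at p)" for p
    unfolding K_def using r(2)[of p] chart_inv_in[OF chart_at(1)] by blast
  moreover have "(\<Sum>p\<in>P. \<phi> p x / \<psi> x) = 1" for x
    using \<psi>[of x] by (simp add: sum_divide_distrib[symmetric] \<psi>_def[symmetric])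
  ultimately show ?thesis
    using P(1) C1 bumpK(2) \<phi>0 \<psi>
    by (intro exI[of _ P] exI[of _ "\<lambda>p x. \<phi> p x / \<psi> x"] exI[of _ K]) (auto simp: supp intro!: divide_nonneg_pos)
qed

text \<open>\<open>lee_derivative\<close> is additive in the function, and the functions add up to a
  constant.\<close>

lemma lee_derivative_sum_const:
  assumes P: "finite P" "\<And>p. p \<in> P \<Longrightarrow> C1_function (\<rho> p)" and one: "\<And>x. (\<Sum>p\<in>P. \<rho> p x) = 1"
  shows "(\<Sum>p\<in>P. glob (lee_derivative (\<rho> p)) x) = 0"
proof -
  define c where "c = chart_at x"
  define z where "z = snd c x"
  have c: "c \<in> A" and z: "z \<in> cdom c" unfolding c_def z_def using chart_at by auto
  have "(\<Sum>p\<in>P. dz k (\<lambda>w. complex_of_real (\<rho> p (chart_inv c w))) z) = 0" for k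
  proof -
    have "(\<Sum>p\<in>P. dz k (\<lambda>w. complex_of_real (\<rho> p (chart_inv c w))) z) = dz k (\<lambda>w. \<Sum>p\<in>P. complex_of_real (\<rho> p (chart_inv c w))) z"
      by (rule dz_sum[symmetric]) (rule C1_function_D(2)[OF P(2) c z])
    also have "\<dots> = 0" by (simp add: one dz_const flip: of_real_sum)
    finally show ?thesis .
  qed
  moreover have "(\<Sum>p\<in>P. \<Sum>k\<in>UNIV. \<Sum>l\<in>UNIV. inverse_metric (g c z) k l
     * (dz k (\<lambda>w. complex_of_real (\<rho> p (chart_inv c w))) z * cnj (lee_form (g c) z l)))
     = (\<Sum>k\<in>UNIV. \<Sum>l\<in>UNIV. inverse_metric (g c z) k l
     * ((\<Sum>p\<in>P. dz k (\<lambda>w. complex_of_real (\<rho> p (chart_inv c w))) z) * cnj (lee_form (g c) z l)))"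
    by (subst sum.swap, rule sum.cong[OF refl], subst sum.swap) (simp add: sum_distrib_left sum_distrib_right)
  ultimately have "(\<Sum>p\<in>P. \<Sum>k\<in>UNIV. \<Sum>l\<in>UNIV. inverse_metric (g c z) k l
     * (dz k (\<lambda>w. complex_of_real (\<rho> p (chart_inv c w))) z * cnj (lee_form (g c) z l))) = 0" by simp
  then show ?thesis
    unfolding glob_def lee_derivative_def c_def[symmetric] z_def[symmetric] Re_sum[symmetric] by simp
qed

text \<open>This is Stokes' theorem for the \<open>(n-1)\<close>-st power of the fundamental form: integrating by parts
  in each chart leaves the derivatives of the partition functions along the Lee field, which add up
  to zero once every term is split by the partition again and moved to the other chart.\<close>

lemma lee_form_zero:
  assumes comp: "compact (UNIV :: 'a set)" and trace: "\<And>x. 0 \<le> glob lee_trace x"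
    and c: "c \<in> A" and z: "z \<in> cdom c"
  shows "lee_form (g c) z k = 0"
proof -
  obtain P \<rho> K where P: "finite P" and one: "\<And>x::'a. (\<Sum>p\<in>P. \<rho> p x) = 1"
    and PP: "\<forall>p\<in>P. C1_function (\<rho> p) \<and> compact (K p) \<and> K p \<subseteq> fst (chart_at p)
      \<and> (\<forall>x. 0 \<le> \<rho> p x) \<and> (\<forall>x. x \<notin> K p \<longrightarrow> \<rho> p x = 0)"
    using partition_of_unity[OF comp] by metis
  have C1: "C1_function (\<rho> p)" and K: "compact (K p)" "K p \<subseteq> fst (chart_at p)"
    and \<rho>0: "0 \<le> \<rho> p x" and supp: "x \<notin> K p \<Longrightarrow> \<rho> p x = 0" if "p \<in> P" for p x
    using PP that by auto
  define E where "E x = (real CARD('n) - 1) * glob lee_norm_sq x + glob lee_trace x" for x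
  define Y where "Y p = glob (lee_derivative (\<rho> p))" for p
  have Ec: "continuous_on UNIV E"
    unfolding E_def
    by (intro continuous_intros glob_continuous_on chart_invariant_lee_norm_sq chart_invariant_lee_trace
        lee_norm_sq_continuous lee_trace_continuous)
  have Yc: "continuous_on UNIV (Y p)" if "p \<in> P" for p
    unfolding Y_def by (intro glob_continuous_on chart_invariant_lee_derivative lee_derivative_continuous C1 that)
  have \<rho>c: "continuous_on UNIV (\<rho> p)" if "p \<in> P" for p by (rule C1_function_continuous[OF C1[OF that]])
  have norm0: "0 \<le> glob lee_norm_sq x" for x
    unfolding glob_def using lee_norm_sq_zero_imp(1)[OF chart_at(1)] chart_at(2) by blast
  have E0: "0 \<le> E x" for x
    unfolding E_def using trace[of x] norm0[of x] n2 by simp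
  have Ysupp: "Y p x = 0" if p: "p \<in> P" and x: "x \<notin> K p" for p x
  proof -
    let ?c = "chart_at x"
    have o: "open (snd ?c ` (fst ?c \<inter> - K p))"
      using K(1)[OF p] by (intro open_image_chart chart_at(1)) (simp add: compact_imp_closed open_Compl)
    have "dz k (\<lambda>w. complex_of_real (\<rho> p (chart_inv ?c w))) (snd ?c x) = dz k (\<lambda>w. 0) (snd ?c x)" for k
    proof (rule dz_cong_open[OF o])
      show "snd ?c x \<in> snd ?c ` (fst ?c \<inter> - K p)" using x chart_at(2) by blast
      fix w assume "w \<in> snd ?c ` (fst ?c \<inter> - K p)"
      then show "complex_of_real (\<rho> p (chart_inv ?c w)) = 0"
        using supp[OF p] unfolding image_chart_iff[OF chart_at(1)] by simp
    qed
    then show ?thesis by (simp add: Y_def glob_def lee_derivative_def dz_const)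
  qed
  have ibp: "chart_integral (chart_at p) (\<lambda>x. \<rho> p x * E x) = - chart_integral (chart_at p) (Y p)" if p: "p \<in> P" for p
  proof -
    have "chart_integral (chart_at p) (\<lambda>x. \<rho> p x * E x + Y p x) = 0"
      unfolding E_def Y_def
      by (rule chart_integration_by_parts[OF chart_at(1) K[OF p] C1[OF p] supp[OF p]])
    moreover have "chart_integral (chart_at p) (\<lambda>x. \<rho> p x * E x + Y p x)
        = chart_integral (chart_at p) (\<lambda>x. \<rho> p x * E x) + chart_integral (chart_at p) (Y p)"
      using supp[OF p] Ysupp[OF p]
      by (intro chart_integral_add chart_integrand_integrable[OF chart_at(1) K[OF p]] continuous_on_mult \<rho>c[OF p] Ec Yc[OF p]) auto
    ultimately show ?thesis by simp
  qed
  have split: "chart_integral (chart_at p) (Y p) = (\<Sum>q\<in>P. chart_integral (chart_at p) (\<lambda>x. \<rho> q x * Y p x))" if p: "p \<in> P" for p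
  proof -
    have "Y p = (\<lambda>x. \<Sum>q\<in>P. \<rho> q x * Y p x)" by (simp add: sum_distrib_right[symmetric] one)
    then have "chart_integral (chart_at p) (Y p) = chart_integral (chart_at p) (\<lambda>x. \<Sum>q\<in>P. \<rho> q x * Y p x)" by simp
    also have "\<dots> = (\<Sum>q\<in>P. chart_integral (chart_at p) (\<lambda>x. \<rho> q x * Y p x))"
      using Ysupp[OF p]
      by (intro chart_integral_sum chart_integrand_integrable[OF chart_at(1) K[OF p]] continuous_on_mult \<rho>c Yc[OF p]) auto
    finally show ?thesis .
  qed
  \<comment> \<open>\<open>\<rho> q\<close> and \<open>Y p\<close> are supported in
    \<open>K q\<close> and \<open>K p\<close>, so the product is supported where both charts are
    defined.\<close>
  have swap: "chart_integral (chart_at p) (\<lambda>x. \<rho> q x * Y p x) = chart_integral (chart_at q) (\<lambda>x. \<rho> q x * Y p x)"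
    if p: "p \<in> P" and q: "q \<in> P" for p q
  proof (rule chart_integral_transform[OF chart_at(1) chart_at(1)])
    show "compact (K p \<inter> K q)" using K(1)[OF p] K(1)[OF q] by (intro compact_Int)
    show "continuous_on UNIV (\<lambda>x. \<rho> q x * Y p x)" by (intro continuous_on_mult \<rho>c Yc p q)
    show "\<rho> q x * Y p x = 0" if "x \<notin> K p \<inter> K q" for x
      using that supp[OF q, of x] Ysupp[OF p, of x] by auto
  qed (use K(2)[OF p] K(2)[OF q] in auto)
  have "(\<Sum>p\<in>P. chart_integral (chart_at p) (\<lambda>x. \<rho> p x * E x))
      = - (\<Sum>p\<in>P. \<Sum>q\<in>P. chart_integral (chart_at p) (\<lambda>x. \<rho> q x * Y p x))"
    by (simp add: ibp split sum_negf)
  also have "(\<Sum>p\<in>P. \<Sum>q\<in>P. chart_integral (chart_at p) (\<lambda>x. \<rho> q x * Y p x))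
      = (\<Sum>q\<in>P. \<Sum>p\<in>P. chart_integral (chart_at q) (\<lambda>x. \<rho> q x * Y p x))"
    by (subst sum.swap) (intro sum.cong refl swap)
  also have "\<dots> = (\<Sum>q\<in>P. chart_integral (chart_at q) (\<lambda>x. 0))"
  proof (rule sum.cong[OF refl])
    fix q assume q: "q \<in> P"
    have "(\<Sum>p\<in>P. chart_integral (chart_at q) (\<lambda>x. \<rho> q x * Y p x)) = chart_integral (chart_at q) (\<lambda>x. \<Sum>p\<in>P. \<rho> q x * Y p x)"
      using supp[OF q]
      by (intro chart_integral_sum[symmetric] chart_integrand_integrable[OF chart_at(1) K[OF q]] continuous_on_mult \<rho>c[OF q] Yc) auto
    also have "(\<lambda>x. \<Sum>p\<in>P. \<rho> q x * Y p x) = (\<lambda>x. 0)"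
      unfolding sum_distrib_left[symmetric] Y_def using lee_derivative_sum_const[OF P C1 one] by simp
    finally show "(\<Sum>p\<in>P. chart_integral (chart_at q) (\<lambda>x. \<rho> q x * Y p x)) = chart_integral (chart_at q) (\<lambda>x. 0)" .
  qed
  also have "\<dots> = 0"
  proof -
    have "chart_integrand c (\<lambda>x. 0) = (\<lambda>z. 0)" for c by (auto simp: chart_integrand_def fun_eq_iff)
    then show ?thesis by (simp add: chart_integral_def)
  qed
  finally have sum0: "(\<Sum>p\<in>P. chart_integral (chart_at p) (\<lambda>x. \<rho> p x * E x)) = 0" by simp
  have integrand_nonneg: "0 \<le> chart_integrand (chart_at p) (\<lambda>x. \<rho> p x * E x) w" if p: "p \<in> P" for p w
    using \<rho>0[OF p] E0 less_imp_le[OF vol_density_pos[OF chart_at(1)], of w p]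
    by (simp add: chart_integrand_def mult_nonneg_nonneg)
  have int0: "chart_integral (chart_at p) (\<lambda>x. \<rho> p x * E x) = 0" if p: "p \<in> P" for p
  proof -
    have "\<forall>p\<in>P. chart_integral (chart_at p) (\<lambda>x. \<rho> p x * E x) = 0"
      using sum0 integrand_nonneg
      by (subst (asm) sum_nonneg_eq_0_iff[OF P]) (auto simp: chart_integral_def intro!: integral_nonneg_AE)
    then show ?thesis using p by blast
  qed
  \<comment> \<open>A continuous nonnegative integrand with integral zero vanishes, and the positive
    density can be divided out.\<close>
  have \<rho>E: "\<rho> p x * E x = 0" if p: "p \<in> P" for p x
  proof (cases "x \<in> K p")
    case True
    let ?c = "chart_at p"
    have sE: "\<rho> p x * E x = 0" if "x \<notin> K p" for x using supp[OF p that] by simp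
    have cE: "continuous_on UNIV (\<lambda>x. \<rho> p x * E x)" by (intro continuous_on_mult \<rho>c[OF p] Ec)
    have "chart_integrand ?c (\<lambda>x. \<rho> p x * E x) (snd ?c x) = 0"
      by (rule integral_zero_imp_zero[OF chart_integrand_continuous[OF chart_at(1) K[OF p] cE sE]
            chart_integrand_integrable[OF chart_at(1) K[OF p] cE sE] integrand_nonneg[OF p]
            int0[OF p, unfolded chart_integral_def]])
    moreover have xc: "x \<in> fst ?c" using True K(2)[OF p] by blast
    ultimately show ?thesis
      using vol_density_pos[OF chart_at(1), of "snd ?c x" p] inv_chart[OF chart_at(1) xc]
      by (simp add: chart_integrand_def)
  qed (simp add: supp[OF p])
  have "E x = 0" for x
  proof -
    have "E x = (\<Sum>p\<in>P. \<rho> p x * E x)" by (simp add: sum_distrib_right[symmetric] one)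
    then show ?thesis using \<rho>E by simp
  qed
  moreover have "(real CARD('n) - 1) * glob lee_norm_sq x \<le> E x" for x
    unfolding E_def using trace[of x] by simp
  ultimately have "(real CARD('n) - 1) * glob lee_norm_sq x \<le> 0" for x by metis
  \<comment> \<open>The factor n - 1 is positive because the dimension is at least 2.\<close>
  then have "glob lee_norm_sq x = 0" for x
    using norm0[of x] n2 by (smt (verit, best) mult_pos_pos of_nat_1 of_nat_less_iff less_le_trans one_less_numeral_iff semiring_norm(76) of_nat_numeral of_nat_le_iff)
  then have "lee_norm_sq c z = 0"
    using glob_chart_inv[OF chart_invariant_lee_norm_sq c z] by simp
  then show ?thesis by (rule lee_norm_sq_zero_imp(2)[OF c z])
qed

text \<open>Every local \<open>f\<close> with exp f g Kaehler has zero (1,0)-derivative, hence zero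
  derivative because it is real. Closedness then passes from the rescaled form to that of
  \<open>g\<close>, point by point.\<close>

lemma kaehler_of_lee_form_zero:
  assumes lee: "\<And>c z k. c \<in> A \<Longrightarrow> z \<in> cdom c \<Longrightarrow> lee_form (g c) z k = 0"
  shows "kaehler_on A UNIV g"
  unfolding kaehler_on_def
proof (intro ballI allI)
  fix c z and u v w :: "complex^'n"
  assume c: "c \<in> A" and "z \<in> snd c ` (fst c \<inter> UNIV)"
  then have z: "z \<in> cdom c" by simp
  show "exterior_derivative2 (fundamental_form (g c)) z u v w = 0"
  proof (rule local_conformal[of "chart_inv c z"])
    fix V f
    assume V: "open V" "chart_inv c z \<in> V"
      and sm: "\<And>c. c \<in> A \<Longrightarrow> smooth_on (snd c ` (fst c \<inter> V)) (\<lambda>z. f (chart_inv c z))"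
      and k: "kaehler_on A V (conformal_change f g)"
      and lk: "\<And>c. c \<in> A \<Longrightarrow> lck_chart (snd c ` (fst c \<inter> V)) (g c) (\<lambda>z. complex_of_real (- f (chart_inv c z)))"
    let ?S = "snd c ` (fst c \<inter> V)"
    let ?u = "\<lambda>z. complex_of_real (- f (chart_inv c z))"
    have zS: "z \<in> ?S" unfolding image_chart_iff[OF c] using z V(2) by simp
    have dzu: "dz k ?u z = 0" for k
      using lee[OF c z] lck_chart.lee_form_eq[OF lk[OF c] zS n2] by simp
    have du: "?u differentiable (at z)"
      by (rule smooth_on_imp_differentiable[OF lck_chart.u[OF lk[OF c]] zS])
    have fr: "frechet_derivative ?u (at z) y = 0" for y
      unfolding frechet_derivative_eq_dz_dzbar[OF du] lck_chart.dzbar_u[OF lk[OF c] zS] dzu by simp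
    have df: "(\<lambda>z. f (chart_inv c z)) differentiable (at z)"
      by (rule smooth_on_imp_differentiable[OF sm[OF c] zS])
    have "frechet_derivative (\<lambda>z. - f (chart_inv c z)) (at z) y = 0" for y
    proof -
      have "(\<lambda>z. - f (chart_inv c z)) differentiable (at z)" using df by simp
      from frechet_derivative_linear[OF bounded_linear_of_real[where 'a = complex] this, of y]
      show ?thesis using fr[of y] by simp
    qed
    then have "frechet_derivative (\<lambda>z. f (chart_inv c z)) (at z) = (\<lambda>y. 0)"
      using frechet_derivative_linear[OF bounded_linear_minus[OF bounded_linear_ident] df] by (simp add: fun_eq_iff)
    then have f0: "((\<lambda>z. f (chart_inv c z)) has_derivative (\<lambda>y. 0)) (at z)"
      using df by (simp add: frechet_derivative_works)
    have gd: "(\<lambda>w. g c w $ i $ j) differentiable (at z)" for i j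
      by (rule smooth_on_imp_differentiable[OF lck_chart.smooth_G[OF lk[OF c]] zS])
    have "exterior_derivative2 (fundamental_form (\<lambda>w. exp (f (chart_inv c w)) *\<^sub>R g c w)) z u v w = 0"
      using k c zS unfolding kaehler_on_def conformal_change_def by blast
    then show ?thesis by (rule exterior_derivative2_scale[OF gd f0])
  qed
qed

text \<open>The sign hypothesis is \<open>q \<ge> 0\<close> with the denominator cleared.
  Compactness provides a minimum of the globally defined Lee divergence, and the argument in one
  chart around that point shows its value, hence every value, to be nonnegative.\<close>

lemma kaehler_of_constant_mixed_curvature:
  assumes comp: "compact (UNIV :: 'a set)" and const: "constant_mixed_curvature A g \<alpha> \<beta> c0"
    and ab: "real CARD('n) * \<alpha> + \<beta> \<noteq> 0" "\<beta> \<noteq> 0"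
    and sgn: "c0 * ((real CARD('n) + 2) * \<alpha> + 4 * \<beta>) * ((real CARD('n) * \<alpha> + \<beta>) * \<beta>) \<le> 0"
  shows "kaehler_on A UNIV g"
proof (rule kaehler_of_lee_form_zero)
  define q where "q = - c0 * (real CARD('n) + 1) * ((real CARD('n) + 2) * \<alpha> + 4 * \<beta>)
        / (2 * (real CARD('n) * \<alpha> + \<beta>) * \<beta>)"
  have q0: "q \<ge> 0"
  proof -
    let ?d = "(real CARD('n) * \<alpha> + \<beta>) * \<beta>"
    \<comment> \<open>Multiplying numerator and denominator by \<open>d\<close> leaves a positive
      square below, so the sign is that of the product in the hypothesis.\<close>
    have "- c0 * m * b / (2 * d) = - (c0 * b * d) * (m / (2 * d\<^sup>2))" if "d \<noteq> 0" for m b d :: real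
      using that by (simp add: power2_eq_square)
    then have "q = - (c0 * ((real CARD('n) + 2) * \<alpha> + 4 * \<beta>) * ?d) * ((real CARD('n) + 1) / (2 * ?d\<^sup>2))"
      unfolding q_def mult.assoc[of 2] using ab by simp
    also have "\<dots> \<ge> 0" using sgn by (intro mult_nonneg_nonneg) auto
    finally show ?thesis .
  qed
  have cont: "continuous_on UNIV (glob lee_trace)"
    by (intro glob_continuous_on chart_invariant_lee_trace lee_trace_continuous)
  obtain p where p: "\<And>x. glob lee_trace p \<le> glob lee_trace x"
    using continuous_attains_inf[OF comp _ cont] by auto
  have "0 \<le> glob lee_trace p"
  proof -
    let ?c = "chart_at p"
    have c: "?c \<in> A" and z: "snd ?c p \<in> cdom ?c" using chart_at by auto
    obtain S u where S: "snd ?c p \<in> S" "S \<subseteq> cdom ?c" "lck_chart S (g ?c) u" using local_chart[OF c z] .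
    have cm: "constant_mixed_chart S (g ?c) u \<alpha> \<beta> c0"
    proof (rule constant_mixed_chart.intro[OF S(3)], unfold_locales)
      show "mixed_curvature \<alpha> \<beta> (g ?c) z X = complex_of_real c0" if zX: "z \<in> S" "X \<noteq> 0" for z X
      proof -
        obtain y where "y \<in> fst ?c" "z = snd ?c y" using zX(1) S(2) by blast
        then show ?thesis using const c zX(2) unfolding constant_mixed_curvature_def by blast
      qed
      show "2 \<le> CARD('n)" by (rule n2)
    qed
    have val: "glob lee_trace (chart_inv ?c w) = Re (lee_divergence (g ?c) w)" if "w \<in> S" for w
      using glob_chart_inv[OF chart_invariant_lee_trace c] S(2) that by (auto simp: lee_trace_def)
    have "0 \<le> Re (lee_divergence (g ?c) (snd ?c p))"
    proof (rule constant_mixed_chart.lee_divergence_nonneg_at_min[OF cm ab q_def q0 S(1)])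
      fix w assume w: "w \<in> S"
      have "chart_inv ?c (snd ?c p) = p" using inv_chart[OF c chart_at(2)] .
      then show "Re (lee_divergence (g ?c) (snd ?c p)) \<le> Re (lee_divergence (g ?c) w)"
        using p val[OF w] val[OF S(1)] by metis
    qed
    then show ?thesis by (simp add: glob_def lee_trace_def)
  qed
  then have "0 \<le> glob lee_trace x" for x using p[of x] by simp
  then show "lee_form (g c) z k = 0" if "c \<in> A" "z \<in> cdom c" for c z k
    by (rule lee_form_zero[OF comp _ that])
qed

end

section \<open>Dimension one and the three sign cases\<close>

lemma kaehler_one_dimensional:
  fixes A :: "('a::{t2_space, second_countable_topology}, 'n::finite) chart set"
  assumes "CARD('n) = 1" "complex_atlas A" "hermitian_metric A g"
  shows "kaehler_on A UNIV g"
  unfolding kaehler_on_def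
proof (intro ballI allI)
  fix c z and u v w :: "complex^'n"
  assume c: "c \<in> A" and z: "z \<in> snd c ` (fst c \<inter> UNIV)"
  have o: "open (snd c ` fst c)" using assms(2) c by (simp add: complex_atlas_def)
  have "smooth_on (snd c ` fst c) (g c)" using assms(3) c by (simp add: hermitian_metric_def)
  note smooth = smooth_on_vec_nth[OF o smooth_on_vec_nth[OF o this]]
  have "(\<lambda>w. g c w $ i $ j) differentiable (at z)" for i j
    by (rule smooth_on_imp_differentiable[OF smooth]) (use z in simp)
  then show "exterior_derivative2 (fundamental_form (g c)) z u v w = 0"
    by (rule exterior_derivative2_one_dimensional[OF assms(1)])
qed

theorem theorem1p4:
  fixes A :: "('a::{t2_space, second_countable_topology}, 'n::finite) chart set"
    and g :: "('a, 'n) metric"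
    and \<alpha> \<beta> c :: real
  assumes "\<beta> \<noteq> 0"
    and "complex_atlas A" and "compact (UNIV :: 'a set)"
    and "hermitian_metric A g" and "locally_conformal_kaehler A g"
    and "constant_mixed_curvature A g \<alpha> \<beta> c"
  shows "(c = 0 \<and> real CARD('n) * \<alpha> + \<beta> \<noteq> 0 \<longrightarrow> kaehler_on A UNIV g) \<and>
         (c < 0 \<and> ((real CARD('n) + 2) * \<alpha> + 4 * \<beta>) * (real CARD('n) * \<alpha> + \<beta>) * \<beta> > 0 \<longrightarrow> kaehler_on A UNIV g) \<and>
         (c > 0 \<and> ((real CARD('n) + 2) * \<alpha> + 4 * \<beta>) * (real CARD('n) * \<alpha> + \<beta>) * \<beta> < 0 \<longrightarrow> kaehler_on A UNIV g)"
proof -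
  let ?a = "real CARD('n) * \<alpha> + \<beta>" and ?b = "(real CARD('n) + 2) * \<alpha> + 4 * \<beta>"
  \<comment> \<open>One inequality serves all three cases: it is trivial for c = 0, and otherwise
    follows from c and the product having opposite signs.\<close>
  have main: "kaehler_on A UNIV g" if "?a \<noteq> 0" "c * ?b * (?a * \<beta>) \<le> 0"
  proof (cases "CARD('n) = 1")
    case True
    then show ?thesis using kaehler_one_dimensional assms(2,4) by blast
  next
    case False
    moreover have "CARD('n) > 0" by (simp add: card_gt_0_iff)
    ultimately have "CARD('n) \<ge> 2" by linarith
    then interpret lck_manifold A g by unfold_locales (use assms in auto)
    show ?thesis by (rule kaehler_of_constant_mixed_curvature[OF assms(3,6) that(1) assms(1) that(2)])
  qed
  have assoc: "c * ?b * (?a * \<beta>) = c * (?b * ?a * \<beta>)" by (simp only: mult.assoc)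
  show ?thesis
  proof (intro conjI impI)
    assume "c = 0 \<and> ?a \<noteq> 0"
    then show "kaehler_on A UNIV g" by (intro main) auto
  next
    assume *: "c < 0 \<and> ?b * ?a * \<beta> > 0"
    then have "?a \<noteq> 0" by auto
    moreover have "c * (?b * ?a * \<beta>) \<le> 0" using * by (intro mult_nonpos_nonneg) auto
    ultimately show "kaehler_on A UNIV g" by (rule main[unfolded assoc])
  next
    assume *: "c > 0 \<and> ?b * ?a * \<beta> < 0"
    then have "?a \<noteq> 0" by auto
    moreover have "c * (?b * ?a * \<beta>) \<le> 0" using * mult_nonneg_nonpos[of c "?b * ?a * \<beta>"] by simp
    ultimately show "kaehler_on A UNIV g" by (rule main[unfolded assoc])
  qed
qed

end
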